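(* Let $\Omega\subset\mathbb{R}^2$ be a bounded region whose boundary $\partial\Omega$ is the union of a finite number of disjoint simple Lipschitz loops, and let $\mathcal{O}$ be open with $\overline{\mathcal{O}}\subset\Omega$. Let $\mathbf{v}\in L^2(\Omega;\mathbb{R}^2)$. If $\mathbf{v}\in H^m(\mathcal{O})$ with $m\ge1$, then $P_G\mathbf{v}$, $P_{G0}\mathbf{v}$, $Q_G\mathbf{v}$ and $Q_{G0}\mathbf{v}$ are also in $H^m(\mathcal{O})$.
   Context: A region is a non-empty connected open subset of $\mathbb{R}^2$. A simple Lipschitz loop is a closed, non-self-intersecting curve with at least two distinct points and a uniformly Lipschitz parametrization. $L^2(\Omega;\mathbb{R}^2)$ carries the inner product $\langle\mathbf{v},\mathbf{w}\rangle=\int_\Omega\mathbf{v}\cdot\mathbf{w}\,d^2x$. $P_G$ is the orthogonal projection of $L^2(\Omega;\mathbb{R}^2)$ onto the closed subspace $G(\Omega)=\{\nabla\varphi:\varphi\in H^1(\Omega)\}$, $P_{G0}$ is the orthogonal projection onto the closed subspace $G_0(\Omega)=\{\nabla\varphi:\varphi\in H^1_0(\Omega)\}$, and $Q_G=I-P_G$, $Q_{G0}=I-P_{G0}$. A vector field is said to be $H^m$ on an open set $\mathcal{O}$ (written $\mathbf{v}\in H^m(\mathcal{O})$) provided each of its components is of class $H^m$ on $\mathcal{O}$; $m$ is an integer.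
   Formalization: "In H^m(O)" is taken locally, in hypothesis and conclusion: H^m(V) for every open V with compact closure in O; up to the boundary of O the claim is false. P_G and P_G0 project onto the L^2-closures of G and G_0. *)

theory Defs
  imports "HOL-Analysis.Analysis"
begin

section \<open>Domains\<close>

definition region :: "(real ^ 2) set \<Rightarrow> bool" where
  "region \<Omega> \<longleftrightarrow> open \<Omega> \<and> connected \<Omega> \<and> \<Omega> \<noteq> {}"

text \<open>A simple path is injective on the half-open unit interval, so its image
  automatically has at least two points.\<close>

definition simple_Lipschitz_loop :: "(real ^ 2) set \<Rightarrow> bool" where
  "simple_Lipschitz_loop C \<longleftrightarrow>
     (\<exists>\<gamma> L. simple_path \<gamma> \<and> pathfinish \<gamma> = pathstart \<gamma> \<and>
            L-lipschitz_on {0..1} \<gamma> \<and> path_image \<gamma> = C)"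

definition Lipschitz_loop_boundary :: "(real ^ 2) set \<Rightarrow> bool" where
  "Lipschitz_loop_boundary \<Omega> \<longleftrightarrow>
     (\<exists>\<L>. finite \<L> \<and> pairwise disjnt \<L> \<and>
          (\<forall>C\<in>\<L>. simple_Lipschitz_loop C) \<and> frontier \<Omega> = \<Union>\<L>)"


section \<open>Square-integrable fields\<close>

text \<open>Elements of \<open>L\<^sup>2(\<Omega>)\<close> are represented by functions on the whole plane of which only
  the values on \<open>\<Omega>\<close> matter. No quotient by almost-everywhere equality is taken; all notions
  below are insensitive to changes on null sets.\<close>

definition L2 :: "(real ^ 2) set \<Rightarrow> (real ^ 2 \<Rightarrow> 'a::euclidean_space) set" where
  "L2 \<Omega> = {v. v \<in> borel_measurable (lebesgue_on \<Omega>) \<and>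
               integrable (lebesgue_on \<Omega>) (\<lambda>x. (norm (v x))\<^sup>2)}"

definition L2_inner ::
    "(real ^ 2) set \<Rightarrow> (real ^ 2 \<Rightarrow> 'a::euclidean_space) \<Rightarrow> (real ^ 2 \<Rightarrow> 'a) \<Rightarrow> real" where
  "L2_inner \<Omega> v w = (LINT x|lebesgue_on \<Omega>. v x \<bullet> w x)"

definition L2_norm :: "(real ^ 2) set \<Rightarrow> (real ^ 2 \<Rightarrow> 'a::euclidean_space) \<Rightarrow> real" where
  "L2_norm \<Omega> v = sqrt (L2_inner \<Omega> v v)"

definition L2_closure ::
    "(real ^ 2) set \<Rightarrow> (real ^ 2 \<Rightarrow> 'a::euclidean_space) set \<Rightarrow> (real ^ 2 \<Rightarrow> 'a) set" where
  "L2_closure \<Omega> S = {v \<in> L2 \<Omega>. \<forall>\<epsilon>>0. \<exists>w\<in>S. L2_norm \<Omega> (\<lambda>x. v x - w x) < \<epsilon>}"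

text \<open>Orthogonal projection of \<open>L\<^sup>2(\<Omega>)\<close> onto a subspace \<open>S\<close>. When \<open>S\<close> is closed,
  \<open>L2_closure \<Omega> S\<close> is \<open>S\<close> itself (up to null sets) and this is the usual definition; taking
  the closure makes the projection exist for every subspace \<open>S\<close>. It is unique up to
  null sets, and \<open>SOME\<close> picks a representative.\<close>

definition orth_proj ::
    "(real ^ 2) set \<Rightarrow> (real ^ 2 \<Rightarrow> 'a::euclidean_space) set \<Rightarrow> (real ^ 2 \<Rightarrow> 'a) \<Rightarrow> real ^ 2 \<Rightarrow> 'a"
  where
  "orth_proj \<Omega> S v =
     (SOME p. p \<in> L2_closure \<Omega> S \<and> (\<forall>w\<in>S. L2_inner \<Omega> (\<lambda>x. v x - p x) w = 0))"


section \<open>Test functions and weak derivatives\<close>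

definition pderivative :: "2 \<Rightarrow> (real ^ 2 \<Rightarrow> real) \<Rightarrow> real ^ 2 \<Rightarrow> real" where
  "pderivative i f = (\<lambda>x. frechet_derivative f (at x) (axis i 1))"

definition gradient :: "(real ^ 2 \<Rightarrow> real) \<Rightarrow> real ^ 2 \<Rightarrow> real ^ 2" where
  "gradient f = (\<lambda>x. \<chi> i. pderivative i f x)"

definition mixed_pderivative :: "nat \<Rightarrow> nat \<Rightarrow> (real ^ 2 \<Rightarrow> real) \<Rightarrow> real ^ 2 \<Rightarrow> real" where
  "mixed_pderivative a b f = (pderivative 1 ^^ a) ((pderivative 2 ^^ b) f)"

primrec times_differentiable :: "nat \<Rightarrow> (real ^ 2 \<Rightarrow> real) \<Rightarrow> bool" where
  "times_differentiable 0 f \<longleftrightarrow> continuous_on UNIV f"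
| "times_differentiable (Suc k) f \<longleftrightarrow>
     (\<forall>x. f differentiable (at x)) \<and> (\<forall>i. times_differentiable k (pderivative i f))"

text \<open>\<open>C\<^sub>c\<^sup>\<infinity>(U)\<close>, each function being extended by zero to the plane.\<close>

definition test_functions :: "(real ^ 2) set \<Rightarrow> (real ^ 2 \<Rightarrow> real) set" where
  "test_functions U =
     {\<psi>. (\<forall>k. times_differentiable k \<psi>) \<and>
          compact (closure {x. \<psi> x \<noteq> 0}) \<and> closure {x. \<psi> x \<noteq> 0} \<subseteq> U}"

text \<open>\<open>g\<close> is the weak derivative of \<open>f\<close> on \<open>U\<close> with multi-index \<open>(a, b)\<close>.\<close>

definition has_weak_derivative ::
    "(real ^ 2) set \<Rightarrow> nat \<Rightarrow> nat \<Rightarrow> (real ^ 2 \<Rightarrow> real) \<Rightarrow> (real ^ 2 \<Rightarrow> real) \<Rightarrow> bool" where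
  "has_weak_derivative U a b f g \<longleftrightarrow>
     (\<forall>\<psi>\<in>test_functions U.
        (LINT x|lebesgue_on U. f x * mixed_pderivative a b \<psi> x) =
        (- 1) ^ (a + b) * (LINT x|lebesgue_on U. g x * \<psi> x))"

definition has_weak_gradient ::
    "(real ^ 2) set \<Rightarrow> (real ^ 2 \<Rightarrow> real) \<Rightarrow> (real ^ 2 \<Rightarrow> real ^ 2) \<Rightarrow> bool" where
  "has_weak_gradient U f w \<longleftrightarrow>
     has_weak_derivative U 1 0 f (\<lambda>x. w x $ 1) \<and> has_weak_derivative U 0 1 f (\<lambda>x. w x $ 2)"


section \<open>Sobolev spaces\<close>

definition Sobolev :: "nat \<Rightarrow> (real ^ 2) set \<Rightarrow> (real ^ 2 \<Rightarrow> real) set" where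
  "Sobolev m U =
     {f \<in> L2 U. \<forall>a b. a + b \<le> m \<longrightarrow> (\<exists>g\<in>L2 U. has_weak_derivative U a b f g)}"

text \<open>\<open>H\<^sup>1\<^sub>0(\<Omega>)\<close> is the closure of the test functions in the \<open>H\<^sup>1\<close> norm.\<close>

definition Sobolev10 :: "(real ^ 2) set \<Rightarrow> (real ^ 2 \<Rightarrow> real) set" where
  "Sobolev10 \<Omega> =
     {f \<in> Sobolev 1 \<Omega>. \<exists>w\<in>L2 \<Omega>. has_weak_gradient \<Omega> f w \<and>
        (\<forall>\<epsilon>>0. \<exists>\<psi>\<in>test_functions \<Omega>.
           (L2_norm \<Omega> (\<lambda>x. f x - \<psi> x))\<^sup>2 + (L2_norm \<Omega> (\<lambda>x. w x - gradient \<psi> x))\<^sup>2 < \<epsilon>\<^sup>2)}"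

text \<open>A field is ``of class \<open>H\<^sup>m\<close> on \<open>U\<close>'' in the sense of interior regularity: each of its
  components lies in \<open>H\<^sup>m(V)\<close> for every open \<open>V\<close> whose closure is a compact subset of \<open>U\<close>.
  Regularity up to the boundary of \<open>U\<close> is not inherited by the projections: if \<open>\<phi>\<close> belongs
  to \<open>H\<^sup>1\<^sub>0(\<Omega>)\<close> and is harmonic on a disc \<open>U\<close> but not in \<open>H\<^sup>2(U)\<close>, and \<open>w\<close> is a
  divergence-free field equal to \<open>\<nabla>\<phi>\<close> on \<open>U\<close>, then \<open>v = \<nabla>\<phi> - w\<close> vanishes on \<open>U\<close> while its
  projection \<open>\<nabla>\<phi>\<close> onto gradients of \<open>H\<^sup>1\<^sub>0(\<Omega>)\<close> is not in \<open>H\<^sup>1(U)\<close>.\<close>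

definition class_H :: "nat \<Rightarrow> (real ^ 2) set \<Rightarrow> (real ^ 2 \<Rightarrow> real ^ 2) set" where
  "class_H m U =
     {v. \<forall>V. open V \<and> compact (closure V) \<and> closure V \<subseteq> U \<longrightarrow>
             (\<forall>i. (\<lambda>x. v x $ i) \<in> Sobolev m V)}"


section \<open>Projections onto gradients\<close>

definition G :: "(real ^ 2) set \<Rightarrow> (real ^ 2 \<Rightarrow> real ^ 2) set" where
  "G \<Omega> = {w \<in> L2 \<Omega>. \<exists>\<phi>\<in>Sobolev 1 \<Omega>. has_weak_gradient \<Omega> \<phi> w}"

definition G0 :: "(real ^ 2) set \<Rightarrow> (real ^ 2 \<Rightarrow> real ^ 2) set" where
  "G0 \<Omega> = {w \<in> L2 \<Omega>. \<exists>\<phi>\<in>Sobolev10 \<Omega>. has_weak_gradient \<Omega> \<phi> w}"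

definition P_G :: "(real ^ 2) set \<Rightarrow> (real ^ 2 \<Rightarrow> real ^ 2) \<Rightarrow> real ^ 2 \<Rightarrow> real ^ 2" where
  "P_G \<Omega> v = orth_proj \<Omega> (G \<Omega>) v"

definition P_G0 :: "(real ^ 2) set \<Rightarrow> (real ^ 2 \<Rightarrow> real ^ 2) \<Rightarrow> real ^ 2 \<Rightarrow> real ^ 2" where
  "P_G0 \<Omega> v = orth_proj \<Omega> (G0 \<Omega>) v"

definition Q_G :: "(real ^ 2) set \<Rightarrow> (real ^ 2 \<Rightarrow> real ^ 2) \<Rightarrow> real ^ 2 \<Rightarrow> real ^ 2" where
  "Q_G \<Omega> v = (\<lambda>x. v x - P_G \<Omega> v x)"

definition Q_G0 :: "(real ^ 2) set \<Rightarrow> (real ^ 2 \<Rightarrow> real ^ 2) \<Rightarrow> real ^ 2 \<Rightarrow> real ^ 2" where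
  "Q_G0 \<Omega> v = (\<lambda>x. v x - P_G0 \<Omega> v x)"

end

theory Submission
  imports Defs "HOL-Computational_Algebra.Polynomial"
begin

text \<open>Let \<open>p\<close> be the projection of \<open>v\<close> onto \<open>G \<Omega>\<close> or \<open>G0 \<Omega>\<close>. As a limit of
  gradients, \<open>p\<close> is weakly curl-free. The residual \<open>v - p\<close> is orthogonal to the gradients of all
  test functions, so the weak divergence of \<open>p\<close> is that of \<open>v\<close>. The question is
  thus one of interior regularity for the system \<open>div p = div v\<close>, \<open>curl p = 0\<close>.

  The regularity rests on one identity. For compactly supported smooth \<open>u\<close> the integral of
  \<open>|Du|\<^sup>2\<close> equals the integral of \<open>(div u)\<^sup>2 + (curl u)\<^sup>2\<close>
  (\<open>div_curl_energy\<close>). Applied to a field multiplied by a cut-off function it bounds the gradient of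
  a smooth curl-free field on a compact set by its divergence and its values on a slightly larger
  one (\<open>interior_gradient_estimate\<close>).

  The field \<open>p\<close> is not smooth, so the estimate is applied to the derivatives of its mollifications.
  Because the equations for \<open>p\<close> are weak and have constant coefficients, they hold pointwise for
  these smooth fields away from the boundary. The derivatives of the mollifications of \<open>v\<close> are
  mollifications of its weak derivatives, hence bounded in the mean uniformly in the
  radius. An induction on the order of differentiation, shrinking the compact set at every step,
  gives the same uniform bounds for \<open>p\<close> (\<open>mollified_derivative_bounded_regularity\<close>).

  Uniform bounds suffice. They say that \<open>\<psi> \<mapsto> \<integral> p\<^sub>i \<partial>\<^sup>\<alpha>\<psi>\<close> is bounded in the \<open>L\<^sup>2\<close> norm of the test
  function \<open>\<psi>\<close>, and the Riesz representation theorem then produces the weak derivative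
  (\<open>weak_derivative_of_mollified_bound\<close>). The same theorem, in the form
  \<open>riesz_representation_L2_closure\<close>, shows that the orthogonal projections exist. The fields
  \<open>Q_G \<Omega> v\<close> and \<open>Q_G0 \<Omega> v\<close> are differences of fields already treated.\<close>


section \<open>Calculus of partial derivatives\<close>

lemma pderivative_eqI:
  assumes "(f has_derivative f') (at x)"
  shows "pderivative i f x = f' (axis i 1)"
  unfolding pderivative_def using frechet_derivative_at[OF assms] by simp

lemma has_derivative_pderivative:
  fixes f :: "real^2 \<Rightarrow> real"
  assumes "f differentiable (at x)"
  shows "(f has_derivative (\<lambda>h. \<Sum>i\<in>UNIV. h $ i * pderivative i f x)) (at x)"
proof -
  let ?f' = "frechet_derivative f (at x)"
  have d: "(f has_derivative ?f') (at x)"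
    using assms frechet_derivative_works by blast
  then have "linear ?f'" by (rule has_derivative_linear)
  have "?f' h = (\<Sum>i\<in>UNIV. h $ i * pderivative i f x)" for h
  proof -
    have "?f' h = ?f' (\<Sum>i\<in>UNIV. h $ i *\<^sub>R axis i 1)"
      using basis_expansion[of h] by (simp add: scalar_mult_eq_scaleR)
    also have "\<dots> = (\<Sum>i\<in>UNIV. h $ i * pderivative i f x)"
      using \<open>linear ?f'\<close> by (simp add: linear_sum linear_scale pderivative_def)
    finally show ?thesis .
  qed
  then have "?f' = (\<lambda>h. \<Sum>i\<in>UNIV. h $ i * pderivative i f x)" by blast
  then show ?thesis using d by simp
qed

lemma times_differentiable_continuous:
  "times_differentiable k f \<Longrightarrow> continuous_on UNIV f"
proof (cases k)
  case (Suc n)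
  assume "times_differentiable k f"
  then show ?thesis using Suc
    by (auto intro!: continuous_at_imp_continuous_on simp: differentiable_imp_continuous_within)
qed simp

lemma times_differentiable_SucD:
  "times_differentiable (Suc k) f \<Longrightarrow> times_differentiable k f"
proof (induction k arbitrary: f)
  case 0
  then show ?case using times_differentiable_continuous by fastforce
next
  case (Suc k)
  then show ?case by (metis times_differentiable.simps(2))
qed

lemma pderivative_const: "pderivative i (\<lambda>x. c) = (\<lambda>x. 0)"
  by (rule ext, rule pderivative_eqI[where f'="\<lambda>_. 0"]) simp

lemma pderivative_coord: "pderivative i (\<lambda>x. x $ j) = (\<lambda>x. if i = j then 1 else 0)"
  by (rule ext, subst pderivative_eqI[where f'="\<lambda>h. h $ j"])
     (auto intro!: bounded_linear_imp_has_derivative bounded_linear_vec_nth simp: axis_def)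

lemma pderivative_add:
  assumes "f differentiable (at x)" "g differentiable (at x)"
  shows "pderivative i (\<lambda>x. f x + g x) x = pderivative i f x + pderivative i g x"
proof -
  have "((\<lambda>x. f x + g x) has_derivative
      (\<lambda>h. frechet_derivative f (at x) h + frechet_derivative g (at x) h)) (at x)"
    using assms by (auto intro!: derivative_eq_intros simp: frechet_derivative_works[symmetric])
  from pderivative_eqI[OF this] show ?thesis by (simp add: pderivative_def)
qed

lemma pderivative_mult:
  assumes "f differentiable (at x)" "g differentiable (at x)"
  shows "pderivative i (\<lambda>x. f x * g x) x = f x * pderivative i g x + pderivative i f x * g x"
proof -
  have "((\<lambda>x. f x * g x) has_derivative
      (\<lambda>h. f x * frechet_derivative g (at x) h + frechet_derivative f (at x) h * g x)) (at x)"
    using assms by (auto intro!: derivative_eq_intros simp: frechet_derivative_works[symmetric])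
  from pderivative_eqI[OF this] show ?thesis by (simp add: pderivative_def)
qed

lemma pderivative_affine:
  assumes "f differentiable (at (c + s *\<^sub>R x))"
  shows "(\<lambda>x. f (c + s *\<^sub>R x)) differentiable (at x)"
    "pderivative i (\<lambda>x. f (c + s *\<^sub>R x)) x = s * pderivative i f (c + s *\<^sub>R x)"
proof -
  let ?f' = "frechet_derivative f (at (c + s *\<^sub>R x))"
  have 1: "(f has_derivative ?f') (at (c + s *\<^sub>R x))"
    using assms frechet_derivative_works by blast
  have d: "((\<lambda>x. f (c + s *\<^sub>R x)) has_derivative (\<lambda>h. ?f' (s *\<^sub>R h))) (at x)"
    by (rule has_derivative_compose[of "\<lambda>x. c + s *\<^sub>R x" "\<lambda>h. s *\<^sub>R h" x UNIV f, simplified])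
       (auto intro!: derivative_eq_intros 1)
  then show "(\<lambda>x. f (c + s *\<^sub>R x)) differentiable (at x)"
    unfolding differentiable_def by blast
  show "pderivative i (\<lambda>x. f (c + s *\<^sub>R x)) x = s * pderivative i f (c + s *\<^sub>R x)"
    using pderivative_eqI[OF d, of i] linear_scale[OF has_derivative_linear[OF 1]]
    by (simp add: pderivative_def)
qed

lemma times_differentiable_const: "times_differentiable k (\<lambda>x. c)"
  by (induction k arbitrary: c) (auto simp: pderivative_const)

lemma times_differentiable_coord: "times_differentiable k (\<lambda>x. x $ j)"
  by (cases k) (auto simp: pderivative_coord times_differentiable_const
      intro!: continuous_intros differentiableI bounded_linear_imp_has_derivative bounded_linear_vec_nth)

lemma times_differentiable_add:
  "times_differentiable k f \<Longrightarrow> times_differentiable k g \<Longrightarrow> times_differentiable k (\<lambda>x. f x + g x)"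
proof (induction k arbitrary: f g)
  case 0
  then show ?case by (auto intro!: continuous_intros)
next
  case (Suc k)
  have "pderivative i (\<lambda>x. f x + g x) = (\<lambda>x. pderivative i f x + pderivative i g x)" for i
    using Suc.prems by (auto simp: pderivative_add)
  then show ?case using Suc by (auto simp: Suc.IH)
qed

lemma times_differentiable_mult:
  "times_differentiable k f \<Longrightarrow> times_differentiable k g \<Longrightarrow> times_differentiable k (\<lambda>x. f x * g x)"
proof (induction k arbitrary: f g)
  case 0
  then show ?case by (auto intro!: continuous_intros)
next
  case (Suc k)
  have "pderivative i (\<lambda>x. f x * g x) = (\<lambda>x. f x * pderivative i g x + pderivative i f x * g x)" for i
    using Suc.prems by (auto simp: pderivative_mult)
  moreover have "times_differentiable k f" "times_differentiable k g"
    using Suc.prems times_differentiable_SucD by blast+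
  ultimately show ?case using Suc.prems
    by (auto intro!: times_differentiable_add Suc.IH)
qed

lemma times_differentiable_affine:
  "times_differentiable k f \<Longrightarrow> times_differentiable k (\<lambda>x. f (c + s *\<^sub>R x))"
proof (induction k arbitrary: f)
  case 0
  then have "continuous_on UNIV f" by simp
  then have "continuous_on UNIV (\<lambda>x. f (c + s *\<^sub>R x))"
    by (rule continuous_on_compose2) (auto intro!: continuous_intros)
  then show ?case by simp
next
  case (Suc k)
  have "pderivative i (\<lambda>x. f (c + s *\<^sub>R x)) = (\<lambda>x. s * pderivative i f (c + s *\<^sub>R x))" for i
    using Suc.prems by (auto simp: pderivative_affine)
  then show ?case using Suc
    by (auto intro!: times_differentiable_mult times_differentiable_const pderivative_affine Suc.IH)
qed

text \<open>A partial derivative of \<open>h n \<circ> q\<close> is \<open>h (Suc n) \<circ> q\<close> times a partial derivative of \<open>q\<close>, so the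
  induction on the order has to treat all members of the chain at once.\<close>

lemma times_differentiable_compose:
  assumes h: "\<And>n t. (h n has_real_derivative h (Suc n) t) (at t)"
    and q: "\<And>k. times_differentiable k q"
  shows "times_differentiable k (\<lambda>x. h n (q x))"
proof (induction k arbitrary: n)
  case 0
  have "isCont (h n) t" for t using h DERIV_isCont by blast
  then have "continuous_on UNIV (h n)" by (simp add: continuous_at_imp_continuous_on)
  moreover have "continuous_on UNIV q" using q[of 0] by simp
  ultimately show ?case by (auto intro: continuous_on_compose2)
next
  case (Suc k)
  have dq: "q differentiable at x" for x using q[of 1] by simp
  have d: "((\<lambda>x. h n (q x)) has_derivative (\<lambda>v. h (Suc n) (q x) * frechet_derivative q (at x) v)) (at x)" for x
    using has_derivative_compose[of q _ x UNIV "h n" , simplified,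
        OF dq[unfolded frechet_derivative_works] h[of n, unfolded has_field_derivative_def]] by simp
  then have "pderivative i (\<lambda>x. h n (q x)) = (\<lambda>x. h (Suc n) (q x) * pderivative i q x)" for i
    by (intro ext, subst pderivative_eqI[OF d]) (simp add: pderivative_def)
  moreover have "times_differentiable k (pderivative i q)" for i
    using q[of "Suc k"] by simp
  ultimately show ?case using Suc.IH d
    by (auto intro!: times_differentiable_mult differentiableI)
qed

lemma pderivative_mean_value:
  fixes f :: "real^2 \<Rightarrow> real"
  assumes "\<And>x. f differentiable (at x)"
  shows "\<exists>t. 0 < t \<and> t < 1 \<and> f (x + h) - f x = (\<Sum>i\<in>UNIV. h $ i * pderivative i f (x + t *\<^sub>R h))"
proof -
  have d: "((\<lambda>t. f (x + t *\<^sub>R h)) has_derivative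
      (\<lambda>s. s * (\<Sum>i\<in>UNIV. h $ i * pderivative i f (x + t *\<^sub>R h)))) (at t)" for t
  proof -
    have "((\<lambda>t. f (x + t *\<^sub>R h)) has_derivative
      (\<lambda>s. \<Sum>i\<in>UNIV. (s *\<^sub>R h) $ i * pderivative i f (x + t *\<^sub>R h))) (at t)"
      by (rule has_derivative_compose[of "\<lambda>t. x + t *\<^sub>R h" "\<lambda>s. s *\<^sub>R h" t UNIV f, simplified])
        (auto intro!: derivative_eq_intros has_derivative_pderivative[OF assms, simplified])
    then show ?thesis by (simp add: sum_distrib_left mult.assoc)
  qed
  have "\<exists>t\<in>{0<..<1}. f (x + 1 *\<^sub>R h) - f (x + 0 *\<^sub>R h) 
      = (1 - 0) * (\<Sum>i\<in>UNIV. h $ i * pderivative i f (x + t *\<^sub>R h))"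
    by (rule mvt_simple[where f="\<lambda>t. f (x + t *\<^sub>R h)"]) (auto intro!: has_derivative_at_withinI d)
  then show ?thesis by auto
qed

lemma pderivative_mean_value_axis:
  fixes f :: "real^2 \<Rightarrow> real"
  assumes "\<And>x. f differentiable (at x)"
  shows "\<exists>t. 0 < t \<and> t < 1 \<and> f (x + axis i s) - f x = s * pderivative i f (x + axis i (t * s))"
proof -
  have *: "t *\<^sub>R axis i s = axis i (t * s)" for t by (auto simp: axis_def vec_eq_iff)
  have "(\<Sum>j\<in>UNIV. axis i s $ j * g j) = s * g i" for g
    by (subst sum.remove[of _ i]) (auto simp: axis_def intro!: sum.neutral)
  with pderivative_mean_value[OF assms, of x "axis i s"] show ?thesis by (simp add: *)
qed

lemma norm_axis: "norm (axis i s :: real^2) = \<bar>s\<bar>"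
proof -
  have "axis i s = s *\<^sub>R (axis i 1 :: real^2)" by (auto simp: axis_def vec_eq_iff)
  then show ?thesis by (simp add: norm_axis_1)
qed

text \<open>Schwarz's theorem. Applying the mean value theorem in both directions writes the second
  difference of \<open>f\<close> over a square of side \<open>s\<close> as \<open>s\<^sup>2\<close> times either mixed derivative at a
  nearby point; by continuity the two agree in the limit of small \<open>s\<close>.\<close>

lemma pderivative_commute:
  assumes f: "times_differentiable 2 f"
  shows "pderivative i (pderivative j f) = pderivative j (pderivative i f)"
proof -
  have d1: "f differentiable at x" "pderivative i f differentiable at x" for x i
    using f by (auto simp: numeral_2_eq_2)
  have c2: "continuous_on UNIV (pderivative i (pderivative j f))" for i j
    using f by (auto simp: numeral_2_eq_2)
  have diff: "\<exists>y. dist y x \<le> 2 * s \<and>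
      (f (x + axis i s + axis j s) - f (x + axis i s)) - (f (x + axis j s) - f x)
        = s * s * pderivative i (pderivative j f) y"
    if s: "s > 0" for x s i j
  proof -
    \<comment> \<open>The first difference in direction \<open>i\<close>; its difference in direction \<open>j\<close> is the second difference.\<close>
    let ?g = "\<lambda>y. f (y + axis i s) + (-1) * f y"
    have sh: "(\<lambda>y. f (y + axis i s)) differentiable at y"
      "pderivative k (\<lambda>y. f (y + axis i s)) y = pderivative k f (y + axis i s)" for y k
      using pderivative_affine[where s=1 and c="axis i s" and f=f and x=y] d1
      by (simp_all add: add.commute)
    have dg: "?g differentiable at y" for y
      using sh(1) d1(1) by (intro differentiable_add differentiable_mult) auto
    have "pderivative k ?g y = pderivative k (\<lambda>y. f (y + axis i s)) y + pderivative k (\<lambda>y. -1 * f y) y" for y k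
      using sh(1) d1(1) by (intro pderivative_add differentiable_mult) auto
    then have pg: "pderivative k ?g y = pderivative k f (y + axis i s) - pderivative k f y" for y k
      using pderivative_mult[of "\<lambda>_. -1" y f k] d1 sh(2) by (simp add: pderivative_const)
    obtain t where t: "0 < t" "t < 1"
      and 1: "?g (x + axis j s) - ?g x = s * pderivative j ?g (x + axis j (t * s))"
      using pderivative_mean_value_axis[OF dg, of x j s] by auto
    obtain r where r: "0 < r" "r < 1"
      and 2: "pderivative j f (x + axis j (t * s) + axis i s) - pderivative j f (x + axis j (t * s))
         = s * pderivative i (pderivative j f) (x + axis j (t * s) + axis i (r * s))"
      using pderivative_mean_value_axis[of "pderivative j f" "x + axis j (t * s)" i s, OF d1(2)] by auto
    have "norm (axis j (t * s) + axis i (r * s)) \<le> \<bar>t * s\<bar> + \<bar>r * s\<bar>"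
      using norm_triangle_ineq[of "axis j (t * s)" "axis i (r * s)"] by (simp add: norm_axis)
    also have "\<dots> \<le> 2 * s" 
    proof -
      have "\<bar>t * s\<bar> \<le> s" "\<bar>r * s\<bar> \<le> s" using t r s by (simp_all add: abs_mult)
      then show ?thesis by linarith
    qed
    finally have "dist (x + axis j (t * s) + axis i (r * s)) x \<le> 2 * s"
      by (simp add: dist_norm add.assoc)
    moreover have "(f (x + axis i s + axis j s) - f (x + axis i s)) - (f (x + axis j s) - f x)
       = ?g (x + axis j s) - ?g x" by (simp add: algebra_simps)
    moreover have "?g (x + axis j s) - ?g x
        = s * s * pderivative i (pderivative j f) (x + axis j (t * s) + axis i (r * s))"
      unfolding 1 pg 2 by (rule mult.assoc[symmetric])
    ultimately show ?thesis
      by (intro exI[of _ "x + axis j (t * s) + axis i (r * s)"]) simp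
  qed
  show ?thesis
  proof (rule ext, rule ccontr)
    fix x
    let ?a = "pderivative i (pderivative j f)" and ?b = "pderivative j (pderivative i f)"
    assume "?a x \<noteq> ?b x"
    define e where "e = \<bar>?a x - ?b x\<bar> / 2"
    have e: "e > 0" using \<open>?a x \<noteq> ?b x\<close> by (simp add: e_def)
    obtain d1 where d1: "d1 > 0" "\<And>y. dist y x < d1 \<Longrightarrow> dist (?a y) (?a x) < e"
      using c2[of i j, unfolded continuous_on_iff, rule_format, OF UNIV_I, of e x] e by auto
    obtain d2 where d2: "d2 > 0" "\<And>y. dist y x < d2 \<Longrightarrow> dist (?b y) (?b x) < e"
      using c2[of j i, unfolded continuous_on_iff, rule_format, OF UNIV_I, of e x] e by auto
    define s where "s = min d1 d2 / 3"
    have s: "s > 0" "2 * s < d1" "2 * s < d2" using d1 d2 by (auto simp: s_def)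
    obtain y where y: "dist y x \<le> 2 * s" "(f (x + axis i s + axis j s) - f (x + axis i s)) - (f (x + axis j s) - f x)
        = s * s * ?a y" using diff[OF s(1), of x i j] by auto
    obtain z where z: "dist z x \<le> 2 * s" "(f (x + axis j s + axis i s) - f (x + axis j s)) - (f (x + axis i s) - f x)
        = s * s * ?b z" using diff[OF s(1), of x j i] by auto
    have "s * s * ?a y = s * s * ?b z" using y(2) z(2) by (simp add: algebra_simps)
    then have "?a y = ?b z" using s by simp
    moreover have "dist (?a y) (?a x) < e" using d1 y s by auto
    moreover have "dist (?b z) (?b x) < e" using d2 z s by auto
    moreover have "\<bar>c - a\<bar> < \<bar>a - b\<bar> / 2 \<Longrightarrow> \<bar>c - b\<bar> < \<bar>a - b\<bar> / 2 \<Longrightarrow> False" for a b c :: real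
      by (simp add: abs_if split: if_splits)
    ultimately show False unfolding e_def dist_real_def by metis
  qed
qed


section \<open>Smooth functions and test functions\<close>

definition smooth :: "(real ^ 2 \<Rightarrow> real) \<Rightarrow> bool" where
  "smooth f \<longleftrightarrow> (\<forall>k. times_differentiable k f)"

lemma smooth_continuous: "smooth f \<Longrightarrow> continuous_on S f"
  by (auto simp: smooth_def intro: times_differentiable_continuous continuous_on_subset)

lemma smooth_measurable [measurable_dest]: "smooth f \<Longrightarrow> f \<in> borel_measurable borel"
  by (intro borel_measurable_continuous_onI smooth_continuous)

lemma smooth_differentiable: "smooth f \<Longrightarrow> f differentiable (at x)"
  unfolding smooth_def by (metis times_differentiable.simps(2))

lemma smooth_pderivative: "smooth f \<Longrightarrow> smooth (pderivative i f)"
  unfolding smooth_def by (metis times_differentiable.simps(2))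

lemma smooth_add: "smooth f \<Longrightarrow> smooth g \<Longrightarrow> smooth (\<lambda>x. f x + g x)"
  by (simp add: smooth_def times_differentiable_add)

lemma smooth_mult: "smooth f \<Longrightarrow> smooth g \<Longrightarrow> smooth (\<lambda>x. f x * g x)"
  by (simp add: smooth_def times_differentiable_mult)

lemma smooth_const: "smooth (\<lambda>x. c)"
  by (simp add: smooth_def times_differentiable_const)

lemma smooth_affine: "smooth f \<Longrightarrow> smooth (\<lambda>x. f (c + s *\<^sub>R x))"
  by (simp add: smooth_def times_differentiable_affine)

lemma smooth_reflect: "smooth f \<Longrightarrow> smooth (\<lambda>y. f (x - y))"
  using smooth_affine[of f x "-1"] by simp

lemma pderivative_reflect:
  "smooth f \<Longrightarrow> pderivative i (\<lambda>y. f (x - y)) = (\<lambda>y. - pderivative i f (x - y))"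
  using pderivative_affine(2)[of f x "-1" _ i] smooth_differentiable[of f] by auto

lemma pderivative_smooth_mult:
  "smooth f \<Longrightarrow> smooth g \<Longrightarrow>
    pderivative i (\<lambda>x. f x * g x) = (\<lambda>x. f x * pderivative i g x + pderivative i f x * g x)"
  by (auto simp: pderivative_mult smooth_differentiable)

lemma pderivative_smooth_cmult:
  "smooth g \<Longrightarrow> pderivative i (\<lambda>x. c * g x) = (\<lambda>x. c * pderivative i g x)"
  by (simp add: pderivative_smooth_mult smooth_const pderivative_const)

lemma pderivative_smooth_add:
  "smooth f \<Longrightarrow> smooth g \<Longrightarrow>
    pderivative i (\<lambda>x. f x + g x) = (\<lambda>x. pderivative i f x + pderivative i g x)"
  by (auto simp: pderivative_add smooth_differentiable)

lemma pderivative_smooth_commute: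
  "smooth f \<Longrightarrow> pderivative i (pderivative j f) = pderivative j (pderivative i f)"
  by (simp add: pderivative_commute smooth_def)

lemma smooth_mixed_pderivative: "smooth f \<Longrightarrow> smooth (mixed_pderivative a b f)"
proof -
  have *: "smooth f \<Longrightarrow> smooth ((pderivative i ^^ n) f)" for f i n
    by (induction n) (auto intro: smooth_pderivative)
  then show "smooth f \<Longrightarrow> smooth (mixed_pderivative a b f)"
    by (simp add: mixed_pderivative_def)
qed

lemma mixed_pderivative_0: "mixed_pderivative 0 0 f = f"
  by (simp add: mixed_pderivative_def)

lemma mixed_pderivative_Suc_left:
  "mixed_pderivative (Suc a) b f = pderivative 1 (mixed_pderivative a b f)"
  by (simp add: mixed_pderivative_def)

text \<open>The definition puts the derivatives in direction 1 outermost; moving the new derivative in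
  direction 2 past them is where Schwarz's theorem enters.\<close>

lemma mixed_pderivative_Suc_right:
  assumes "smooth f"
  shows "mixed_pderivative a (Suc b) f = pderivative 2 (mixed_pderivative a b f)"
proof (induction a)
  case 0
  then show ?case by (simp add: mixed_pderivative_def)
next
  case (Suc a)
  then show ?case
    by (simp add: mixed_pderivative_Suc_left pderivative_smooth_commute[of _ 1 2]
        smooth_mixed_pderivative assms)
qed

lemma mixed_pderivative_1_0: "mixed_pderivative 1 0 f = pderivative 1 f"
  and mixed_pderivative_0_1: "mixed_pderivative 0 1 f = pderivative 2 f"
  by (simp_all add: mixed_pderivative_def)

lemma pderivative_outside_support:
  assumes "closed K" "\<And>x. x \<notin> K \<Longrightarrow> f x = 0" "x \<notin> K"
  shows "pderivative i f x = 0"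
proof -
  have "((\<lambda>_. 0) has_derivative (\<lambda>_. 0)) (at x)" by simp
  then have "(f has_derivative (\<lambda>_. 0)) (at x)"
    by (rule has_derivative_transform_within_open[of _ _ _ _ "- K"]) (use assms in auto)
  from pderivative_eqI[OF this] show ?thesis .
qed

lemma test_functionsI:
  assumes "smooth f" "compact K" "K \<subseteq> U" "\<And>x. x \<notin> K \<Longrightarrow> f x = 0"
  shows "f \<in> test_functions U"
proof -
  have "closure {x. f x \<noteq> 0} \<subseteq> K"
    using assms by (intro closure_minimal compact_imp_closed) auto
  moreover from this have "compact (closure {x. f x \<noteq> 0})"
    using assms(2) compact_Int_closed[of K "closure {x. f x \<noteq> 0}"] by (simp add: Int_absorb1)
  ultimately show ?thesis using assms(1,3)
    by (auto simp: test_functions_def smooth_def)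
qed

lemma test_functions_support:
  assumes "f \<in> test_functions U"
  shows "\<exists>K. compact K \<and> K \<subseteq> U \<and> (\<forall>x. x \<notin> K \<longrightarrow> f x = 0)"
proof (intro exI conjI allI impI)
  show "compact (closure {x. f x \<noteq> 0})" "closure {x. f x \<noteq> 0} \<subseteq> U"
    using assms by (auto simp: test_functions_def)
  show "f x = 0" if "x \<notin> closure {x. f x \<noteq> 0}" for x
    using that closure_subset[of "{x. f x \<noteq> 0}"] by auto
qed

lemma test_functions_smooth: "f \<in> test_functions U \<Longrightarrow> smooth f"
  by (simp add: test_functions_def smooth_def)

lemma test_functions_mono: "f \<in> test_functions U \<Longrightarrow> U \<subseteq> V \<Longrightarrow> f \<in> test_functions V"
  by (auto simp: test_functions_def)

lemma test_functions_mult: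
  assumes "f \<in> test_functions U" "smooth g"
  shows "(\<lambda>x. f x * g x) \<in> test_functions U"
proof -
  obtain K where K: "compact K" "K \<subseteq> U" "\<And>x. x \<notin> K \<Longrightarrow> f x = 0"
    using test_functions_support[OF assms(1)] by metis
  show ?thesis
    by (rule test_functionsI[of _ K])
       (use K assms in \<open>auto intro: smooth_mult test_functions_smooth\<close>)
qed

lemma test_functions_cmult: "f \<in> test_functions U \<Longrightarrow> (\<lambda>x. c * f x) \<in> test_functions U"
  using test_functions_mult[of f U "\<lambda>_. c"] by (simp add: smooth_const mult.commute)

lemma test_functions_add:
  assumes "f \<in> test_functions U" "g \<in> test_functions U"
  shows "(\<lambda>x. f x + g x) \<in> test_functions U"
proof -
  obtain K where K: "compact K" "K \<subseteq> U" "\<And>x. x \<notin> K \<Longrightarrow> f x = 0"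
    using test_functions_support[OF assms(1)] by metis
  obtain L where L: "compact L" "L \<subseteq> U" "\<And>x. x \<notin> L \<Longrightarrow> g x = 0"
    using test_functions_support[OF assms(2)] by metis
  show ?thesis
    by (rule test_functionsI[of _ "K \<union> L"])
       (use K L assms in \<open>auto intro: smooth_add test_functions_smooth\<close>)
qed

lemma test_functions_pderivative:
  assumes "f \<in> test_functions U" shows "pderivative i f \<in> test_functions U"
proof -
  obtain K where K: "compact K" "K \<subseteq> U" "\<And>x. x \<notin> K \<Longrightarrow> f x = 0"
    using test_functions_support[OF assms] by metis
  show ?thesis
    by (rule test_functionsI[of _ K])
      (use K assms in \<open>auto intro: smooth_pderivative test_functions_smooth
         pderivative_outside_support compact_imp_closed\<close>)
qed

lemma test_functions_mixed_pderivative: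
  "f \<in> test_functions U \<Longrightarrow> mixed_pderivative a b f \<in> test_functions U"
proof -
  have *: "f \<in> test_functions U \<Longrightarrow> (pderivative i ^^ n) f \<in> test_functions U" for f i n
    by (induction n) (auto intro: test_functions_pderivative)
  then show "f \<in> test_functions U \<Longrightarrow> mixed_pderivative a b f \<in> test_functions U"
    by (simp add: mixed_pderivative_def)
qed

lemma test_functions_bounded:
  assumes "f \<in> test_functions U"
  obtains B where "B > 0" "\<And>x. \<bar>f x\<bar> \<le> B"
proof -
  obtain K where K: "compact K" "K \<subseteq> U" "\<And>x. x \<notin> K \<Longrightarrow> f x = 0"
    using test_functions_support[OF assms] by metis
  have "bounded (f ` K)"
    using K assms by (intro compact_imp_bounded compact_continuous_image smooth_continuous)
       (auto intro: test_functions_smooth)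
  then obtain B where "B > 0" "\<And>x. x \<in> K \<Longrightarrow> \<bar>f x\<bar> \<le> B"
    by (auto simp: bounded_pos)
  then show ?thesis using K by (intro that[of B]) (metis abs_zero less_imp_le)+
qed

lemma test_functions_integrable:
  assumes "f \<in> test_functions U" shows "integrable lborel f"
proof -
  obtain K where K: "compact K" "K \<subseteq> U" "\<And>x. x \<notin> K \<Longrightarrow> f x = 0"
    using test_functions_support[OF assms] by metis
  have "integrable lborel (\<lambda>x. indicator K x *\<^sub>R f x)"
    using K assms by (intro borel_integrable_compact smooth_continuous test_functions_smooth)
  moreover have "(\<lambda>x. indicator K x *\<^sub>R f x) = f"
    using K(3) by (intro ext) (auto simp: indicator_def)
  ultimately show ?thesis by simp
qed

text \<open>Uniform continuity holds on the compact 1-neighbourhood of the support, and two points closer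
  than 1 either both lie in it or are both zeros of \<open>f\<close>.\<close>

lemma test_functions_uniformly_continuous:
  assumes "f \<in> test_functions U" "e > 0"
  obtains d where "d > 0" "\<And>x y. dist x y < d \<Longrightarrow> \<bar>f x - f y\<bar> < e"
proof -
  obtain K where K: "compact K" "K \<subseteq> U" "\<And>x. x \<notin> K \<Longrightarrow> f x = 0"
    using test_functions_support[OF assms(1)] by metis
  define K' where "K' = {x + y |x y. x \<in> K \<and> y \<in> cball 0 (1::real)}"
  have "compact K'" unfolding K'_def by (rule compact_sums) (use K in auto)
  then have "uniformly_continuous_on K' f"
    using assms by (intro compact_uniformly_continuous smooth_continuous test_functions_smooth)
  then obtain d where d: "d > 0" "\<And>x y. x \<in> K' \<Longrightarrow> y \<in> K' \<Longrightarrow> dist y x < d \<Longrightarrow> dist (f y) (f x) < e"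
    using \<open>e > 0\<close> unfolding uniformly_continuous_on_def by blast
  have near: "y \<in> K'" if "x \<in> K" "dist x y \<le> 1" for x y
    using that unfolding K'_def mem_Collect_eq
    by (intro exI[of _ x] exI[of _ "y - x"]) (simp add: dist_norm norm_minus_commute)
  show ?thesis
  proof (rule that[of "min d 1"])
    show "0 < min d 1" using d by simp
    fix x y :: "real^2" assume xy: "dist x y < min d 1"
    show "\<bar>f x - f y\<bar> < e"
    proof (cases "x \<in> K \<or> y \<in> K")
      case True
      then have "x \<in> K'" "y \<in> K'" using near[of x x] near[of y y] near[of x y] near[of y x] xy
        by (auto simp: dist_commute)
      then show ?thesis using d(2)[of y x] xy by (simp add: dist_real_def)
    next
      case False
      then show ?thesis using K assms by simp
    qed
  qed
qed


section \<open>Mollifiers and convolution\<close>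

lemma poly_exp_tendsto_0: "((\<lambda>x::real. x ^ k * poly p x * exp (- x)) \<longlongrightarrow> 0) at_top"
proof (induction p arbitrary: k)
  case 0
  then show ?case by simp
next
  case (pCons a p)
  have "((\<lambda>x::real. a * (x ^ k / exp x) + x ^ Suc k * poly p x * exp (- x)) \<longlongrightarrow> a * 0 + 0) at_top"
    by (intro tendsto_intros tendsto_power_div_exp_0 pCons.IH)
  then show ?case by (simp add: algebra_simps exp_minus divide_inverse)
qed

text \<open>The derivative of \<open>P(1/t) exp(-1/t)\<close> is \<open>Q(1/t) exp(-1/t)\<close> with
  \<open>Q(x) = x\<^sup>2 (P(x) - P'(x))\<close>.\<close>

primrec bump_poly :: "nat \<Rightarrow> real poly" where
  "bump_poly 0 = 1"
| "bump_poly (Suc n) = [:0, 0, 1:] * (bump_poly n - pderiv (bump_poly n))"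

text \<open>These are the successive derivatives of the standard smooth function that equals \<open>exp(-1/t)\<close>
  for positive \<open>t\<close> and vanishes on the negative axis.\<close>

definition bump_deriv :: "nat \<Rightarrow> real \<Rightarrow> real" where
  "bump_deriv n t = (if t > 0 then poly (bump_poly n) (1 / t) * exp (- (1 / t)) else 0)"

text \<open>Only \<open>t = 0\<close> needs thought: with \<open>x = 1/t\<close> the right difference quotient is
  \<open>x P(x) exp(-x)\<close>, which tends to 0.\<close>

lemma bump_deriv_has_derivative: "(bump_deriv n has_real_derivative bump_deriv (Suc n) t) (at t)"
proof -
  consider "t > 0" | "t < 0" | "t = 0" by linarith
  then show ?thesis
  proof cases
    case 1
    have "((\<lambda>t. poly (bump_poly n) (1 / t) * exp (- (1 / t))) has_real_derivative
        bump_deriv (Suc n) t) (at t)"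
      using 1 by (auto intro!: derivative_eq_intros DERIV_chain2[OF poly_DERIV]
          simp: bump_deriv_def field_simps power2_eq_square)
    then show ?thesis
      by (rule has_field_derivative_transform_within[where d=t]) (use 1 in \<open>auto simp: bump_deriv_def dist_real_def\<close>)
  next
    case 2
    have "((\<lambda>_. 0) has_real_derivative bump_deriv (Suc n) t) (at t)"
      using 2 by (simp add: bump_deriv_def)
    then show ?thesis
      by (rule has_field_derivative_transform_within[where d="-t"]) (use 2 in \<open>auto simp: bump_deriv_def dist_real_def\<close>)
  next
    case 3
    let ?q = "\<lambda>t. (bump_deriv n t - bump_deriv n 0) / (t - 0)"
    have "((\<lambda>t. inverse t ^ 1 * poly (bump_poly n) (inverse t) * exp (- inverse t)) \<longlongrightarrow> 0) (at_right 0)"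
      by (rule filterlim_compose[OF poly_exp_tendsto_0[of 1] filterlim_inverse_at_top_right])
    then have "(?q \<longlongrightarrow> 0) (at_right 0)"
      by (rule Lim_transform_eventually)
         (auto simp: bump_deriv_def eventually_at_filter divide_inverse mult_ac)
    moreover have "(?q \<longlongrightarrow> 0) (at_left 0)"
      by (rule Lim_transform_eventually[of "\<lambda>_. 0"])
         (auto simp: bump_deriv_def eventually_at_filter)
    ultimately have "(?q \<longlongrightarrow> 0) (at 0)" by (rule filterlim_split_at[rotated])
    then show ?thesis using 3 by (simp add: has_field_derivative_iff bump_deriv_def)
  qed
qed

definition mollifier :: "real \<Rightarrow> (real ^ 2 \<Rightarrow> real) \<Rightarrow> bool" where
  "mollifier r \<eta> \<longleftrightarrow> smooth \<eta> \<and> (\<forall>x. 0 \<le> \<eta> x) \<and> (\<forall>x. norm x \<ge> r \<longrightarrow> \<eta> x = 0) \<and>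
     (\<integral>x. \<eta> x \<partial>lborel) = 1"

lemma mollifier_test_function:
  assumes "mollifier r \<eta>" shows "\<eta> \<in> test_functions UNIV"
  by (rule test_functionsI[of _ "cball 0 r"]) (use assms in \<open>auto simp: mollifier_def\<close>)

lemma mollifier_mono: "mollifier r \<eta> \<Longrightarrow> r \<le> s \<Longrightarrow> mollifier s \<eta>"
  by (auto simp: mollifier_def)

lemma smooth_norm_squared: "smooth (\<lambda>x. norm x ^ 2)"
proof -
  have "smooth (\<lambda>x. x $ i * x $ i)" for i
    by (intro smooth_mult) (simp_all add: smooth_def times_differentiable_coord)
  then have "smooth (\<lambda>x. x $ 1 * x $ 1 + x $ 2 * x $ 2)" by (intro smooth_add)
  then show ?thesis
    by (simp add: power2_norm_eq_inner inner_vec_def sum_2)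
qed

text \<open>The composition of the bump function with \<open>r\<^sup>2 - |x|\<^sup>2\<close> is positive exactly inside the
  ball of radius \<open>r\<close>; it remains to divide by its integral.\<close>

lemma mollifier_exists:
  assumes "r > 0" obtains \<eta> where "mollifier r \<eta>"
proof -
  let ?b = "\<lambda>x::real^2. bump_deriv 0 (r\<^sup>2 - norm x ^ 2)"
  have "smooth (\<lambda>x::real^2. r\<^sup>2 + (-1) * norm x ^ 2)"
    by (intro smooth_add smooth_mult smooth_const smooth_norm_squared)
  then have sm: "smooth ?b"
    unfolding smooth_def using times_differentiable_compose[where h=bump_deriv and n=0 and q="\<lambda>x::real^2. r\<^sup>2 - norm x ^ 2"]
    by (simp add: bump_deriv_has_derivative)
  have nonneg: "?b x \<ge> 0" for x by (simp add: bump_deriv_def)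
  have out: "?b x = 0" if "norm x \<ge> r" for x
    using that assms power_mono[of r "norm x" 2] by (simp add: bump_deriv_def not_less)
  have test: "?b \<in> test_functions UNIV"
    by (rule test_functionsI[of _ "cball 0 r"]) (use sm out in auto)
  then have int: "integrable lborel ?b" by (rule test_functions_integrable)
  have "0 < (\<integral>x. ?b x \<partial>lborel)"
  proof (rule ccontr)
    assume "\<not> 0 < (\<integral>x. ?b x \<partial>lborel)"
    then have "(\<integral>x. ?b x \<partial>lborel) = 0"
      using Bochner_Integration.integral_nonneg[of lborel ?b] nonneg by (simp add: order_antisym)
    then have "AE x in lborel. ?b x = 0"
      using integral_nonneg_eq_0_iff_AE[OF int] nonneg by simp
    then have "emeasure lborel {x \<in> space lborel. ?b x \<noteq> 0} = 0"
      using sm by (subst (asm) AE_iff_measurable[OF _ refl]) (auto dest!: smooth_measurable)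
    moreover have "{x \<in> space lborel. ?b x \<noteq> 0} = ball 0 r"
    proof -
      have "?b x \<noteq> 0" if "norm x < r" for x
        using that power_strict_mono[of "norm x" r 2] by (simp add: bump_deriv_def)
      then show ?thesis using out by (force simp: not_le)
    qed
    ultimately have "measure lborel (ball (0::real^2) r) = 0" by (simp add: measure_def)
    then show False using content_ball_pos[OF assms, of "0::real^2"] by simp
  qed
  then have "mollifier r (\<lambda>x. (1 / (\<integral>x. ?b x \<partial>lborel)) * ?b x)"
    unfolding mollifier_def
    using nonneg out smooth_mult[OF smooth_const[of "1 / (\<integral>x. ?b x \<partial>lborel)"] sm] by auto
  then show ?thesis by (rule that)
qed

definition conv :: "(real ^ 2 \<Rightarrow> real) \<Rightarrow> (real ^ 2 \<Rightarrow> real) \<Rightarrow> real ^ 2 \<Rightarrow> real" where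
  "conv f \<kappa> x = (\<integral>y. f y * \<kappa> (x - y) \<partial>lborel)"

lemma integrable_mult_bounded:
  fixes f g :: "'a \<Rightarrow> real"
  assumes "integrable M f" "g \<in> borel_measurable M" "\<And>x. \<bar>g x\<bar> \<le> B"
  shows "integrable M (\<lambda>x. f x * g x)"
proof (rule Bochner_Integration.integrable_bound)
  show "integrable M (\<lambda>x. B * f x)" using assms(1) by simp
  have "\<bar>g x\<bar> \<le> \<bar>B\<bar>" for x using assms(3)[of x] by linarith
  then have "norm (f x * g x) \<le> norm (B * f x)" for x
    using mult_left_mono[of "\<bar>g x\<bar>" "\<bar>B\<bar>" "\<bar>f x\<bar>"] by (simp add: abs_mult mult.commute)
  then show "AE x in M. norm (f x * g x) \<le> norm (B * f x)" by simp
  show "(\<lambda>x. f x * g x) \<in> borel_measurable M" using assms by simp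
qed

lemma integrable_mult_test:
  assumes "integrable lborel f" "\<psi> \<in> test_functions U"
  shows "integrable lborel (\<lambda>x. f x * \<psi> x)"
proof -
  obtain B where "\<And>x. \<bar>\<psi> x\<bar> \<le> B" using test_functions_bounded[OF assms(2)] by metis
  then show ?thesis using assms smooth_measurable[OF test_functions_smooth[OF assms(2)]]
    by (intro integrable_mult_bounded) auto
qed

lemma test_functions_reflect:
  assumes "\<kappa> \<in> test_functions UNIV" shows "(\<lambda>y. \<kappa> (x - y)) \<in> test_functions UNIV"
proof -
  obtain K where K: "compact K" "\<And>x. x \<notin> K \<Longrightarrow> \<kappa> x = 0"
    using test_functions_support[OF assms] by metis
  show ?thesis
  proof (rule test_functionsI)
    show "smooth (\<lambda>y. \<kappa> (x - y))" using assms by (intro smooth_reflect test_functions_smooth)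
    show "compact ((\<lambda>y. x - y) ` K)" using K(1)
      by (intro compact_continuous_image continuous_intros)
    show "\<kappa> (x - y) = 0" if "y \<notin> (\<lambda>y. x - y) ` K" for y
      using that by (intro K(2)) (auto simp: image_iff)
  qed simp
qed

lemma integrable_conv:
  assumes "integrable lborel f" "\<kappa> \<in> test_functions UNIV"
  shows "integrable lborel (\<lambda>y. f y * \<kappa> (x - y))"
  using assms by (intro integrable_mult_test[where U=UNIV] test_functions_reflect)

text \<open>The partial derivatives of the kernel are uniformly continuous, so its first-order Taylor remainder
  is \<open>o(|h|)\<close> uniformly in the base point. This survives integration against an integrable \<open>f\<close>.\<close>

lemma conv_has_derivative:
  assumes f: "integrable lborel f" and k: "\<kappa> \<in> test_functions UNIV"
  shows "(conv f \<kappa> has_derivative (\<lambda>h. \<Sum>i\<in>UNIV. h $ i * conv f (pderivative i \<kappa>) x)) (at x)"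
  unfolding has_derivative_at_alt
proof (intro conjI allI impI)
  show "bounded_linear (\<lambda>h. \<Sum>i\<in>UNIV. h $ i * conv f (pderivative i \<kappa>) x)"
    by (intro bounded_linear_sum bounded_linear_mult_const bounded_linear_vec_nth)
  fix e :: real assume "e > 0"
  define N where "N = (\<integral>y. \<bar>f y\<bar> \<partial>lborel)"
  have N: "N \<ge> 0" by (simp add: N_def)
  \<comment> \<open>The 2 counts the coordinates of \<open>h\<close>, and the 1 covers the case \<open>N = 0\<close>.\<close>
  define e' where "e' = e / (2 * (N + 1))"
  have e': "e' > 0" "2 * N * e' \<le> e" using \<open>e > 0\<close> N by (auto simp: e'_def field_simps)
  have "\<exists>d>0. \<forall>y z. dist y z < d \<longrightarrow> \<bar>pderivative i \<kappa> y - pderivative i \<kappa> z\<bar> < e'" for i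
    using test_functions_uniformly_continuous[OF test_functions_pderivative[OF k] e'(1)] by metis
  then obtain d where d: "\<And>i. d i > 0"
    "\<And>i y z. dist y z < d i \<Longrightarrow> \<bar>pderivative i \<kappa> y - pderivative i \<kappa> z\<bar> < e'"
    by metis
  define D where "D = min (d 1) (d 2)"
  have D: "D > 0" "D \<le> d i" for i using d(1) exhaust_2[of i] by (auto simp: D_def)
  have taylor: "\<bar>\<kappa> (z + h) - \<kappa> z - (\<Sum>i\<in>UNIV. h $ i * pderivative i \<kappa> z)\<bar> \<le> 2 * e' * norm h"
    if "norm h < D" for z h
  proof -
    obtain t where t: "0 < t" "t < 1"
      "\<kappa> (z + h) - \<kappa> z = (\<Sum>i\<in>UNIV. h $ i * pderivative i \<kappa> (z + t *\<^sub>R h))"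
      using pderivative_mean_value[of \<kappa> z h, OF smooth_differentiable[OF test_functions_smooth[OF k]]] by auto
    have "dist (z + t *\<^sub>R h) z < d i" for i
    proof -
      have "norm (t *\<^sub>R h) \<le> norm h" using t by (simp add: mult_left_le_one_le)
      then show ?thesis using that D(2)[of i] by (simp add: dist_norm)
    qed
    then have *: "\<bar>pderivative i \<kappa> (z + t *\<^sub>R h) - pderivative i \<kappa> z\<bar> \<le> e'" for i
      using d(2) less_imp_le by blast
    have "\<bar>\<kappa> (z + h) - \<kappa> z - (\<Sum>i\<in>UNIV. h $ i * pderivative i \<kappa> z)\<bar>
      = \<bar>\<Sum>i\<in>UNIV. h $ i * (pderivative i \<kappa> (z + t *\<^sub>R h) - pderivative i \<kappa> z)\<bar>"
      unfolding t(3) by (simp add: sum_subtractf right_diff_distrib)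
    also have "\<dots> \<le> (\<Sum>i\<in>(UNIV::2 set). norm h * e')"
      unfolding abs_mult[symmetric]
      by (rule order_trans[OF sum_abs], rule sum_mono) (simp add: abs_mult mult_mono * component_le_norm_cart)
    finally show ?thesis by (simp add: mult_ac)
  qed
  show "\<exists>D>0. \<forall>x'. norm (x' - x) < D \<longrightarrow>
      norm (conv f \<kappa> x' - conv f \<kappa> x - (\<Sum>i\<in>UNIV. (x' - x) $ i * conv f (pderivative i \<kappa>) x))
        \<le> e * norm (x' - x)"
  proof (intro exI conjI allI impI)
    show "D > 0" by (rule D(1))
    fix x' assume x': "norm (x' - x) < D"
    define h where "h = x' - x"
    let ?g = "\<lambda>y. \<kappa> (x' - y) - \<kappa> (x - y) - (\<Sum>i\<in>UNIV. h $ i * pderivative i \<kappa> (x - y))"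
    have int: "integrable lborel (\<lambda>y. f y * \<kappa> (x - y))"
      "integrable lborel (\<lambda>y. f y * pderivative i \<kappa> (x - y))" for i x
      using f k by (auto intro: integrable_conv test_functions_pderivative)
    have "conv f \<kappa> x' - conv f \<kappa> x - (\<Sum>i\<in>UNIV. h $ i * conv f (pderivative i \<kappa>) x)
       = (\<integral>y. f y * \<kappa> (x' - y) - f y * \<kappa> (x - y) - (\<Sum>i\<in>UNIV. h $ i * (f y * pderivative i \<kappa> (x - y))) \<partial>lborel)"
      unfolding conv_def using int by simp
    also have "\<dots> = (\<integral>y. f y * ?g y \<partial>lborel)"
      by (intro Bochner_Integration.integral_cong) (auto simp: algebra_simps sum_distrib_left)
    finally have eq: "conv f \<kappa> x' - conv f \<kappa> x - (\<Sum>i\<in>UNIV. h $ i * conv f (pderivative i \<kappa>) x)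
       = (\<integral>y. f y * ?g y \<partial>lborel)" .
    have bd: "\<bar>?g y\<bar> \<le> 2 * e' * norm h" for y
      using taylor[of h "x - y"] x' by (simp add: h_def algebra_simps)
    have "\<bar>\<integral>y. f y * ?g y \<partial>lborel\<bar> \<le> (\<integral>y. \<bar>f y\<bar> * (2 * e' * norm h) \<partial>lborel)"
    proof (rule order_trans[OF integral_abs_bound], rule integral_mono)
      show "integrable lborel (\<lambda>y. \<bar>f y * ?g y\<bar>)"
      proof (intro integrable_abs integrable_mult_bounded[OF f _ bd])
        have [measurable]: "(\<lambda>y. \<kappa> (z - y)) \<in> borel_measurable borel"
          "(\<lambda>y. pderivative i \<kappa> (z - y)) \<in> borel_measurable borel" for z i
          by (intro smooth_measurable smooth_reflect smooth_pderivative test_functions_smooth[OF k])+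
        show "?g \<in> borel_measurable lborel" by measurable
      qed
      show "integrable lborel (\<lambda>y. \<bar>f y\<bar> * (2 * e' * norm h))" using f by simp
      show "\<bar>f y * ?g y\<bar> \<le> \<bar>f y\<bar> * (2 * e' * norm h)" for y
        using bd[of y] by (simp add: abs_mult mult_left_mono)
    qed
    also have "\<dots> = N * (2 * e' * norm h)" by (simp add: N_def)
    also have "\<dots> = (2 * N * e') * norm h" by simp
    also have "\<dots> \<le> e * norm h" using e'(2) by (rule mult_right_mono) simp
    finally show "norm (conv f \<kappa> x' - conv f \<kappa> x - (\<Sum>i\<in>UNIV. (x' - x) $ i * conv f (pderivative i \<kappa>) x))
        \<le> e * norm (x' - x)" unfolding h_def[symmetric] eq real_norm_def .
  qed
qed

lemma pderivative_conv:
  assumes "integrable lborel f" "\<kappa> \<in> test_functions UNIV"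
  shows "pderivative i (conv f \<kappa>) = conv f (pderivative i \<kappa>)"
proof
  fix x
  have "pderivative i (conv f \<kappa>) x = (\<Sum>j\<in>UNIV. axis i 1 $ j * conv f (pderivative j \<kappa>) x)"
    by (rule pderivative_eqI[OF conv_has_derivative[OF assms]])
  also have "\<dots> = conv f (pderivative i \<kappa>) x"
    by (subst sum.remove[of _ i]) (auto simp: axis_def intro!: sum.neutral)
  finally show "pderivative i (conv f \<kappa>) x = conv f (pderivative i \<kappa>) x" .
qed

lemma smooth_conv:
  assumes "integrable lborel f" "\<kappa> \<in> test_functions UNIV"
  shows "smooth (conv f \<kappa>)"
proof -
  have d: "conv f \<kappa> differentiable (at x)" if "\<kappa> \<in> test_functions UNIV" for x \<kappa>
    using conv_has_derivative[OF assms(1) that] by (rule differentiableI)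
  have "times_differentiable k (conv f \<kappa>)" if "\<kappa> \<in> test_functions UNIV" for k
    using that
  proof (induction k arbitrary: \<kappa>)
    case 0
    then show ?case using d[of \<kappa>]
      by (auto intro!: continuous_at_imp_continuous_on simp: differentiable_imp_continuous_within)
  next
    case (Suc k)
    then show ?case using d[of \<kappa>] assms
      by (auto simp: pderivative_conv test_functions_pderivative)
  qed
  then show ?thesis using assms by (simp add: smooth_def)
qed


section \<open>Integration by parts and the div-curl estimate\<close>

lemma lborel_integral_reflect:
  fixes g :: "real ^ 2 \<Rightarrow> real"
  assumes [measurable]: "g \<in> borel_measurable borel"
  shows "(\<integral>y. g (x - y) \<partial>lborel) = (\<integral>y. g y \<partial>lborel)"
proof -
  have "lborel = distr lborel borel (\<lambda>y::real^2. x - y)"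
    using lborel_affine[of "-1" x] by (simp add: density_1)
  then have "(\<integral>y. g y \<partial>lborel) = (\<integral>y. g y \<partial>distr lborel borel (\<lambda>y::real^2. x - y))" by simp
  also have "\<dots> = (\<integral>y. g (x - y) \<partial>lborel)"
    by (rule integral_distr) auto
  finally show ?thesis by simp
qed

text \<open>Convolution of \<open>\<psi>\<close> with the indicator function of a large ball is constant near the origin,
  namely the integral of \<open>\<psi>\<close>. Its derivative at the origin is therefore 0, but it is also the
  integral of the derivative of \<open>\<psi>\<close>.\<close>

lemma integral_pderivative_test_eq_0:
  assumes "\<psi> \<in> test_functions UNIV"
  shows "(\<integral>x. pderivative i \<psi> x \<partial>lborel) = 0"
proof -
  obtain K where K: "compact K" "\<And>x. x \<notin> K \<Longrightarrow> \<psi> x = 0"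
    using test_functions_support[OF assms] by metis
  obtain R where R: "\<And>x. x \<in> K \<Longrightarrow> norm x \<le> R"
    using compact_imp_bounded[OF K(1)] by (auto simp: bounded_iff)
  \<comment> \<open>The extra radius 1 keeps \<open>conv f \<psi>\<close> constant on the whole unit ball.\<close>
  define f where "f = (indicator (cball 0 (R + 1)) :: real^2 \<Rightarrow> real)"
  have f: "integrable lborel f"
    unfolding f_def by (intro integrable_real_indicator emeasure_bounded_finite) auto
  have eq: "conv f \<phi> x = (\<integral>y. \<phi> y \<partial>lborel)"
    if "norm x < 1" "smooth \<phi>" "\<And>x. x \<notin> K \<Longrightarrow> \<phi> x = 0" for \<phi> x
  proof -
    have "f y * \<phi> (x - y) = \<phi> (x - y)" for y
    proof (cases "x - y \<in> K")
      case True
      then have "norm y \<le> R + 1" using R[of "x - y"] that(1) norm_triangle_sub[of y x]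
        by (simp add: norm_minus_commute)
      then show ?thesis by (simp add: f_def)
    qed (simp add: that)
    then have "conv f \<phi> x = (\<integral>y. \<phi> (x - y) \<partial>lborel)" unfolding conv_def by presburger
    then show ?thesis
      using that(2) by (simp add: lborel_integral_reflect smooth_measurable)
  qed
  have "((\<lambda>_. \<integral>y. \<psi> y \<partial>lborel) has_derivative (\<lambda>_. 0)) (at (0::real^2))" by simp
  then have "(conv f \<psi> has_derivative (\<lambda>_. 0)) (at 0)"
    by (rule has_derivative_transform_within_open[of _ _ _ _ "ball 0 1"])
       (use K assms in \<open>auto simp: eq test_functions_smooth\<close>)
  then have "0 = pderivative i (conv f \<psi>) 0" by (simp add: pderivative_eqI)
  also have "\<dots> = conv f (pderivative i \<psi>) 0" by (simp add: pderivative_conv f assms)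
  also have "\<dots> = (\<integral>y. pderivative i \<psi> y \<partial>lborel)"
    by (rule eq) (use K assms in \<open>auto intro: smooth_pderivative test_functions_smooth
         pderivative_outside_support compact_imp_closed\<close>)
  finally show ?thesis by simp
qed

lemma integration_by_parts:
  assumes F: "smooth F" and \<psi>: "\<psi> \<in> test_functions UNIV"
  shows "(\<integral>x. pderivative i F x * \<psi> x \<partial>lborel) = - (\<integral>x. F x * pderivative i \<psi> x \<partial>lborel)"
proof -
  have t: "(\<lambda>x. \<phi> x * G x) \<in> test_functions UNIV" if "\<phi> \<in> test_functions UNIV" "smooth G" for \<phi> G
    using that by (rule test_functions_mult)
  have "0 = (\<integral>x. pderivative i (\<lambda>x. \<psi> x * F x) x \<partial>lborel)"
    using integral_pderivative_test_eq_0[OF t[OF \<psi> F]] by simp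
  also have "\<dots> = (\<integral>x. \<psi> x * pderivative i F x + pderivative i \<psi> x * F x \<partial>lborel)"
    using F \<psi> by (simp add: pderivative_smooth_mult test_functions_smooth)
  also have "\<dots> = (\<integral>x. \<psi> x * pderivative i F x \<partial>lborel) + (\<integral>x. pderivative i \<psi> x * F x \<partial>lborel)"
    by (intro Bochner_Integration.integral_add test_functions_integrable[of _ UNIV] t F \<psi>
        smooth_pderivative test_functions_pderivative)
  finally show ?thesis by (simp add: mult.commute)
qed

lemma mixed_pderivative_pderivative:
  assumes "smooth f"
  shows "mixed_pderivative a b (pderivative i f) = pderivative i (mixed_pderivative a b f)"
proof -
  have "(pderivative j ^^ n) (pderivative i f) = pderivative i ((pderivative j ^^ n) f)
      \<and> smooth ((pderivative j ^^ n) f)" if "smooth f" for j n f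
    using that by (induction n) (auto simp: pderivative_smooth_commute[of _ j i] intro: smooth_pderivative)
  then show ?thesis using assms by (simp add: mixed_pderivative_def)
qed

lemma mixed_integration_by_parts:
  assumes F: "smooth F" and "\<psi> \<in> test_functions UNIV"
  shows "(\<integral>x. mixed_pderivative a b F x * \<psi> x \<partial>lborel)
    = (-1) ^ (a + b) * (\<integral>x. F x * mixed_pderivative a b \<psi> x \<partial>lborel)"
  using assms(2)
proof (induction a arbitrary: \<psi>)
  case 0
  then show ?case
  proof (induction b arbitrary: \<psi>)
    case 0
    then show ?case by (simp add: mixed_pderivative_0)
  next
    case (Suc b)
    then show ?case using F
      by (simp add: mixed_pderivative_Suc_right test_functions_smooth integration_by_parts
          smooth_mixed_pderivative test_functions_pderivative mixed_pderivative_pderivative)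
  qed
next
  case (Suc a)
  then show ?case using F
    by (simp add: mixed_pderivative_Suc_left test_functions_smooth integration_by_parts
        smooth_mixed_pderivative test_functions_pderivative mixed_pderivative_pderivative)
qed

lemma mixed_pderivative_conv:
  assumes f: "integrable lborel f" and "\<kappa> \<in> test_functions UNIV"
  shows "mixed_pderivative a b (conv f \<kappa>) = conv f (mixed_pderivative a b \<kappa>)"
  using assms(2)
proof (induction a)
  case 0
  then show ?case
    by (induction b) (auto simp: mixed_pderivative_0 mixed_pderivative_Suc_right smooth_conv f
      test_functions_smooth pderivative_conv test_functions_mixed_pderivative)
next
  case (Suc a)
  then show ?case
    by (simp add: mixed_pderivative_Suc_left f pderivative_conv test_functions_mixed_pderivative)
qed

lemma test_functions_mult_test:
  "f \<in> test_functions U \<Longrightarrow> g \<in> test_functions V \<Longrightarrow> (\<lambda>x. f x * g x) \<in> test_functions U"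
  by (intro test_functions_mult test_functions_smooth)

text \<open>The two integrands differ by twice \<open>\<partial>\<^sub>1u\<^sub>1 \<partial>\<^sub>2u\<^sub>2 - \<partial>\<^sub>2u\<^sub>1 \<partial>\<^sub>1u\<^sub>2\<close>, the
  Jacobian determinant, whose integral vanishes after two integrations by parts.\<close>

lemma div_curl_energy:
  assumes u: "u1 \<in> test_functions UNIV" "u2 \<in> test_functions UNIV"
  shows "(\<integral>x. (pderivative 1 u1 x)\<^sup>2 + (pderivative 2 u1 x)\<^sup>2 + (pderivative 1 u2 x)\<^sup>2 + (pderivative 2 u2 x)\<^sup>2 \<partial>lborel)
    = (\<integral>x. (pderivative 1 u1 x + pderivative 2 u2 x)\<^sup>2 + (pderivative 1 u2 x - pderivative 2 u1 x)\<^sup>2 \<partial>lborel)"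
    (is "?L = ?R")
proof -
  have t: "(\<lambda>x. f x * g x) \<in> test_functions UNIV"
    if "f \<in> test_functions UNIV" "g \<in> test_functions UNIV" for f g
    using that by (rule test_functions_mult_test)
  note tp = test_functions_pderivative
  note I = test_functions_integrable[OF t]
  have "(\<integral>x. pderivative 1 u1 x * pderivative 2 u2 x \<partial>lborel)
      = - (\<integral>x. u1 x * pderivative 1 (pderivative 2 u2) x \<partial>lborel)"
    using u by (intro integration_by_parts test_functions_smooth tp)
  also have "\<dots> = - (\<integral>x. u1 x * pderivative 2 (pderivative 1 u2) x \<partial>lborel)"
    using pderivative_smooth_commute[OF test_functions_smooth[OF u(2)], of 1 2] by simp
  also have "\<dots> = (\<integral>x. pderivative 2 u1 x * pderivative 1 u2 x \<partial>lborel)"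
    using integration_by_parts[OF test_functions_smooth[OF u(1)] tp[OF u(2)], of 2 1] by simp
  finally have swap: "(\<integral>x. pderivative 1 u1 x * pderivative 2 u2 x \<partial>lborel)
      = (\<integral>x. pderivative 2 u1 x * pderivative 1 u2 x \<partial>lborel)" .
  have "?R = (\<integral>x. ((pderivative 1 u1 x)\<^sup>2 + (pderivative 2 u1 x)\<^sup>2 + (pderivative 1 u2 x)\<^sup>2 + (pderivative 2 u2 x)\<^sup>2)
      + (2 * (pderivative 1 u1 x * pderivative 2 u2 x) - 2 * (pderivative 2 u1 x * pderivative 1 u2 x)) \<partial>lborel)"
    by (rule Bochner_Integration.integral_cong) (auto simp: power2_eq_square algebra_simps)
  also have "\<dots> = ?L + (2 * (\<integral>x. pderivative 1 u1 x * pderivative 2 u2 x \<partial>lborel)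
       - 2 * (\<integral>x. pderivative 2 u1 x * pderivative 1 u2 x \<partial>lborel))"
    unfolding power2_eq_square using u by (simp add: I tp)
  finally show ?thesis using swap by simp
qed

lemma integral_le_linear_combination:
  fixes f g h :: "'a \<Rightarrow> real"
  assumes "integrable M f" "integrable M g" "integrable M h" "\<And>x. f x \<le> a * g x + b * h x"
  shows "(\<integral>x. f x \<partial>M) \<le> a * (\<integral>x. g x \<partial>M) + b * (\<integral>x. h x \<partial>M)"
proof -
  have "(\<integral>x. f x \<partial>M) \<le> (\<integral>x. a * g x + b * h x \<partial>M)"
    using assms by (intro integral_mono) auto
  then show ?thesis using assms by simp
qed

lemma integrable_indicator_compact:
  assumes "compact S" "continuous_on UNIV f"
  shows "integrable lborel (\<lambda>x::real^2. indicator S x * (f x :: real))"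
  using borel_integrable_compact[OF assms(1) continuous_on_subset[OF assms(2) subset_UNIV]] by simp

text \<open>The energy identity is applied to \<open>\<zeta> w\<close>. By the product rule its divergence and curl contain
  \<open>div w\<close> and \<open>w\<close>, but no other derivative of \<open>w\<close>, since \<open>w\<close> is curl-free where \<open>\<zeta>\<close> is not 0.
  The constant depends on \<open>\<zeta>\<close> alone, so the estimate is uniform over all such \<open>w\<close>.\<close>

lemma interior_gradient_estimate:
  assumes \<zeta>: "\<zeta> \<in> test_functions UNIV" and S: "compact S" "\<And>x. x \<notin> S \<Longrightarrow> \<zeta> x = 0"
  shows "\<exists>C. C \<ge> 0 \<and> (\<forall>w1 w2. smooth w1 \<longrightarrow> smooth w2 \<longrightarrow>
      (\<forall>x\<in>S. pderivative 1 w2 x = pderivative 2 w1 x) \<longrightarrow>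
      (\<integral>x. (\<zeta> x)\<^sup>2 * ((pderivative 1 w1 x)\<^sup>2 + (pderivative 2 w1 x)\<^sup>2 + (pderivative 1 w2 x)\<^sup>2 + (pderivative 2 w2 x)\<^sup>2) \<partial>lborel)
      \<le> C * (\<integral>x. indicator S x * ((pderivative 1 w1 x + pderivative 2 w2 x)\<^sup>2 + ((w1 x)\<^sup>2 + (w2 x)\<^sup>2)) \<partial>lborel))"
proof -
  obtain B0 where B0: "\<And>x. \<bar>\<zeta> x\<bar> \<le> B0" using test_functions_bounded[OF \<zeta>] by metis
  obtain B1 where B1: "\<And>x. \<bar>pderivative 1 \<zeta> x\<bar> \<le> B1"
    using test_functions_bounded[OF test_functions_pderivative[OF \<zeta>]] by metis
  obtain B2 where B2: "\<And>x. \<bar>pderivative 2 \<zeta> x\<bar> \<le> B2"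
    using test_functions_bounded[OF test_functions_pderivative[OF \<zeta>]] by metis
  define B where "B = max B0 (max B1 B2)"
  have sq: "t\<^sup>2 \<le> B\<^sup>2" if "\<bar>t\<bar> \<le> B" for t using power_mono[OF that, of 2] by simp
  have B: "(\<zeta> x)\<^sup>2 \<le> B\<^sup>2" "(pderivative 1 \<zeta> x)\<^sup>2 \<le> B\<^sup>2" "(pderivative 2 \<zeta> x)\<^sup>2 \<le> B\<^sup>2" for x
    using B0[of x] B1[of x] B2[of x] unfolding B_def[symmetric] by (intro sq; simp add: B_def)+
  have sum_sq: "(a + b)\<^sup>2 \<le> 2 * a\<^sup>2 + 2 * b\<^sup>2" for a b :: real
    using sum_squares_bound[of a b] by (simp add: power2_sum)
  show ?thesis
  \<comment> \<open>Every use of \<open>(a + b)\<^sup>2 \<le> 2 a\<^sup>2 + 2 b\<^sup>2\<close> below contributes a factor 2; the terms in \<open>w\<close> add up to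
    16, those in \<open>div w\<close> to 4.\<close>
  proof (intro exI[of _ "16 * B\<^sup>2"] conjI allI impI)
    show "16 * B\<^sup>2 \<ge> 0" by simp
    fix w1 w2
    assume w: "smooth w1" "smooth w2" and "\<forall>x\<in>S. pderivative 1 w2 x = pderivative 2 w1 x"
    then have curl: "\<And>x. x \<in> S \<Longrightarrow> pderivative 1 w2 x = pderivative 2 w1 x" by blast
    let ?u1 = "\<lambda>x. \<zeta> x * w1 x" and ?u2 = "\<lambda>x. \<zeta> x * w2 x"
    let ?div = "\<lambda>x. pderivative 1 w1 x + pderivative 2 w2 x"
    let ?W = "\<lambda>x. (w1 x)\<^sup>2 + (w2 x)\<^sup>2"
    have pu: "pderivative i ?u1 x = \<zeta> x * pderivative i w1 x + pderivative i \<zeta> x * w1 x"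
      "pderivative i ?u2 x = \<zeta> x * pderivative i w2 x + pderivative i \<zeta> x * w2 x" for i x
      using w \<zeta> by (simp_all add: pderivative_smooth_mult test_functions_smooth)
    have ut: "?u1 \<in> test_functions UNIV" "?u2 \<in> test_functions UNIV"
      using w \<zeta> by (auto intro: test_functions_mult)
    let ?Du = "\<lambda>x. (pderivative 1 ?u1 x)\<^sup>2 + (pderivative 2 ?u1 x)\<^sup>2 + (pderivative 1 ?u2 x)\<^sup>2 + (pderivative 2 ?u2 x)\<^sup>2"
    let ?dc = "\<lambda>x. (pderivative 1 ?u1 x + pderivative 2 ?u2 x)\<^sup>2 + (pderivative 1 ?u2 x - pderivative 2 ?u1 x)\<^sup>2"
    let ?Dw = "\<lambda>x. (\<zeta> x)\<^sup>2 * ((pderivative 1 w1 x)\<^sup>2 + (pderivative 2 w1 x)\<^sup>2 + (pderivative 1 w2 x)\<^sup>2 + (pderivative 2 w2 x)\<^sup>2)"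
    have p0: "pderivative i \<zeta> x = 0" if "x \<notin> S" for i x
      using that S by (intro pderivative_outside_support[of S]) (auto intro: compact_imp_closed)
    have 1: "?Dw x \<le> 2 * ?Du x + 4 * B\<^sup>2 * (indicator S x * ?W x)" for x
    proof (cases "x \<in> S")
      case True
      have *: "(\<zeta> x * a)\<^sup>2 \<le> 2 * (\<zeta> x * a + p * b)\<^sup>2 + 2 * (B\<^sup>2 * b\<^sup>2)" if "p\<^sup>2 \<le> B\<^sup>2" for a b p
        using sum_sq[of "\<zeta> x * a + p * b" "- (p * b)"] mult_right_mono[OF that, of "b\<^sup>2"]
        by (simp add: power_mult_distrib)
      have "?Dw x = (\<zeta> x * pderivative 1 w1 x)\<^sup>2 + (\<zeta> x * pderivative 2 w1 x)\<^sup>2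
        + (\<zeta> x * pderivative 1 w2 x)\<^sup>2 + (\<zeta> x * pderivative 2 w2 x)\<^sup>2"
        by (simp add: power_mult_distrib algebra_simps)
      also have "\<dots> \<le> 2 * ?Du x + 4 * B\<^sup>2 * ?W x"
        using *[OF B(2)[of x], of "pderivative 1 w1 x" "w1 x"] *[OF B(3)[of x], of "pderivative 2 w1 x" "w1 x"]
          *[OF B(2)[of x], of "pderivative 1 w2 x" "w2 x"] *[OF B(3)[of x], of "pderivative 2 w2 x" "w2 x"]
        unfolding pu by (simp add: algebra_simps)
      finally show ?thesis using True by simp
    qed (simp add: pu p0 S)
    have 2: "?dc x \<le> indicator S x * (2 * B\<^sup>2 * (?div x)\<^sup>2 + 6 * B\<^sup>2 * ?W x)" for x
    proof (cases "x \<in> S")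
      case True
      let ?p = "pderivative 1 \<zeta> x" and ?q = "pderivative 2 \<zeta> x"
      have l: "(p * a + q * b)\<^sup>2 \<le> 2 * (B\<^sup>2 * a\<^sup>2) + 2 * (B\<^sup>2 * b\<^sup>2)" if "p\<^sup>2 \<le> B\<^sup>2" "q\<^sup>2 \<le> B\<^sup>2" for p q a b
        using sum_sq[of "p * a" "q * b"] mult_right_mono[OF that(1), of "a\<^sup>2"] mult_right_mono[OF that(2), of "b\<^sup>2"]
        by (simp add: power_mult_distrib)
      have d: "pderivative 1 ?u1 x + pderivative 2 ?u2 x = \<zeta> x * ?div x + (?p * w1 x + ?q * w2 x)"
        unfolding pu by (simp add: algebra_simps)
      have c: "pderivative 1 ?u2 x - pderivative 2 ?u1 x = ?p * w2 x + (- ?q) * w1 x"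
        unfolding pu by (simp add: algebra_simps curl[OF True])
      have "(\<zeta> x * ?div x)\<^sup>2 \<le> B\<^sup>2 * (?div x)\<^sup>2"
        using mult_right_mono[OF B(1)[of x], of "(?div x)\<^sup>2"] by (simp add: power_mult_distrib)
      then have "?dc x \<le> 2 * B\<^sup>2 * (?div x)\<^sup>2 + 6 * B\<^sup>2 * ?W x"
        unfolding d c
        using sum_sq[of "\<zeta> x * ?div x" "?p * w1 x + ?q * w2 x"] l[OF B(2,3)[of x], of "w1 x" "w2 x"]
          l[of ?p "- ?q" "w2 x" "w1 x"] B(2,3)[of x] by (simp add: algebra_simps)
      then show ?thesis using True by simp
    qed (simp add: pu p0 S)
    have tt: "integrable lborel (\<lambda>x. (f x)\<^sup>2)" if "f \<in> test_functions UNIV" for f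
      using test_functions_integrable[OF test_functions_mult_test[OF that that]] by (simp add: power2_eq_square)
    have iu: "integrable lborel ?Du"
      using ut by (intro Bochner_Integration.integrable_add tt test_functions_pderivative)
    have minus: "(\<lambda>x. f x - g x) \<in> test_functions UNIV"
      if "f \<in> test_functions UNIV" "g \<in> test_functions UNIV" for f g
      using test_functions_add[OF that(1) test_functions_cmult[OF that(2), of "-1"]] by simp
    have id: "integrable lborel ?dc"
      using ut by (intro Bochner_Integration.integrable_add tt minus test_functions_pderivative test_functions_add)
    have iS: "integrable lborel (\<lambda>x. indicator S x * (?div x)\<^sup>2)" "integrable lborel (\<lambda>x. indicator S x * ?W x)"
      unfolding power2_eq_square using w
      by (auto intro!: integrable_indicator_compact S smooth_continuous smooth_add smooth_mult smooth_pderivative)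
    have iw: "integrable lborel ?Dw"
    proof -
      have "(\<lambda>x. (\<zeta> x * \<zeta> x) * (pderivative 1 w1 x * pderivative 1 w1 x + pderivative 2 w1 x * pderivative 2 w1 x
         + pderivative 1 w2 x * pderivative 1 w2 x + pderivative 2 w2 x * pderivative 2 w2 x)) \<in> test_functions UNIV"
        by (intro test_functions_mult[where U=UNIV] \<zeta> smooth_add smooth_mult smooth_pderivative w test_functions_smooth[OF \<zeta>])
      then show ?thesis unfolding power2_eq_square by (rule test_functions_integrable)
    qed
    have "(\<integral>x. ?Dw x \<partial>lborel) \<le> 2 * (\<integral>x. ?Du x \<partial>lborel) + 4 * B\<^sup>2 * (\<integral>x. indicator S x * ?W x \<partial>lborel)"
      by (rule integral_le_linear_combination[OF iw iu iS(2) 1])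
    moreover have "(\<integral>x. ?Du x \<partial>lborel) = (\<integral>x. ?dc x \<partial>lborel)"
      by (rule div_curl_energy[OF ut])
    moreover have "(\<integral>x. ?dc x \<partial>lborel) \<le> 2 * B\<^sup>2 * (\<integral>x. indicator S x * (?div x)\<^sup>2 \<partial>lborel) + 6 * B\<^sup>2 * (\<integral>x. indicator S x * ?W x \<partial>lborel)"
    proof (rule integral_le_linear_combination[OF id iS])
      show "?dc x \<le> 2 * B\<^sup>2 * (indicator S x * (?div x)\<^sup>2) + 6 * B\<^sup>2 * (indicator S x * ?W x)" for x
        using 2[of x] by (simp add: distrib_left mult.left_commute)
    qed
    ultimately have fin: "(\<integral>x. ?Dw x \<partial>lborel) \<le> 4 * B\<^sup>2 * (\<integral>x. indicator S x * (?div x)\<^sup>2 \<partial>lborel)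
        + 16 * B\<^sup>2 * (\<integral>x. indicator S x * ?W x \<partial>lborel)"
      by linarith
    have "0 \<le> B\<^sup>2 * (\<integral>x. indicator S x * (?div x)\<^sup>2 \<partial>lborel)"
      by (intro mult_nonneg_nonneg Bochner_Integration.integral_nonneg) auto
    with fin have "(\<integral>x. ?Dw x \<partial>lborel) \<le> 16 * B\<^sup>2 * ((\<integral>x. indicator S x * (?div x)\<^sup>2 \<partial>lborel)
        + (\<integral>x. indicator S x * ?W x \<partial>lborel))"
      unfolding distrib_left[of "16 * B\<^sup>2"] by linarith
    also have "\<dots> = 16 * B\<^sup>2 * (\<integral>x. indicator S x * ((?div x)\<^sup>2 + ?W x) \<partial>lborel)"
      using Bochner_Integration.integral_add[OF iS] by (simp only: distrib_left[where b="(?div _)\<^sup>2"])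
    finally show "(\<integral>x. ?Dw x \<partial>lborel) \<le> 16 * B\<^sup>2 * (\<integral>x. indicator S x * ((?div x)\<^sup>2 + ?W x) \<partial>lborel)" .
  qed
qed


section \<open>Mollification in the mean and cut-off functions\<close>

text \<open>For fixed \<open>y\<close> the inner integral is bounded by a constant independent of \<open>y\<close>, which makes the
  double integral absolutely convergent. With \<open>\<psi> = 1\<close> this integrates a convolution; with a test function
  it moves the mollification from \<open>f\<close> to \<open>\<psi>\<close>.\<close>

lemma conv_fubini:
  assumes f: "integrable lborel f" and k: "\<kappa> \<in> test_functions UNIV"
    and [measurable]: "\<psi> \<in> borel_measurable borel" and B: "\<And>x. \<bar>\<psi> x\<bar> \<le> B"
  shows "integrable lborel (\<lambda>x. conv f \<kappa> x * \<psi> x)"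
    and "(\<integral>x. conv f \<kappa> x * \<psi> x \<partial>lborel) = (\<integral>y. f y * (\<integral>x. \<kappa> (x - y) * \<psi> x \<partial>lborel) \<partial>lborel)"
proof -
  have [measurable]: "f \<in> borel_measurable borel" "\<kappa> \<in> borel_measurable borel"
    using borel_measurable_integrable[OF f] smooth_measurable[OF test_functions_smooth[OF k]] by auto
  have shift: "(\<lambda>x. \<kappa> (x - y)) \<in> test_functions UNIV" for y
  proof -
    have "(\<lambda>x. (\<lambda>z. \<kappa> (0 - z)) (y - x)) \<in> test_functions UNIV"
      by (intro test_functions_reflect k)
    then show ?thesis by simp
  qed
  define H where "H = (\<lambda>(y, x). f y * (\<kappa> (x - y) * \<psi> x))"
  have i1: "integrable lborel (\<lambda>x. \<kappa> (x - y) * \<psi> x)" for y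
    by (rule integrable_mult_bounded[OF test_functions_integrable[OF shift]]) (use B in auto)
  define N where "N = (\<integral>x. \<bar>\<kappa> x\<bar> \<partial>lborel)"
  have N: "(\<integral>x. \<bar>\<kappa> (x - y)\<bar> \<partial>lborel) = N" for y
    using lborel_integral_reflect[of "\<lambda>x. \<bar>\<kappa> (- x)\<bar>" y] lborel_integral_reflect[of "\<lambda>x. \<bar>\<kappa> x\<bar>" 0]
    by (simp add: N_def)
  have i2: "\<bar>\<integral>x. \<bar>\<kappa> (x - y) * \<psi> x\<bar> \<partial>lborel\<bar> \<le> N * B" for y
  proof -
    have "(\<integral>x. \<bar>\<kappa> (x - y) * \<psi> x\<bar> \<partial>lborel) \<le> (\<integral>x. \<bar>\<kappa> (x - y)\<bar> * B \<partial>lborel)"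
    proof (rule integral_mono)
      show "integrable lborel (\<lambda>x. \<bar>\<kappa> (x - y) * \<psi> x\<bar>)" using i1 by (rule integrable_abs)
      show "integrable lborel (\<lambda>x. \<bar>\<kappa> (x - y)\<bar> * B)" using test_functions_integrable[OF shift] by simp
      show "\<bar>\<kappa> (x - y) * \<psi> x\<bar> \<le> \<bar>\<kappa> (x - y)\<bar> * B" for x
        using B[of x] by (simp add: abs_mult mult_left_mono)
    qed
    also have "\<dots> = N * B" using N by simp
    finally show ?thesis by simp
  qed
  have H: "integrable (lborel \<Otimes>\<^sub>M lborel) H"
  proof (rule lborel_pair.Fubini_integrable)
    show "H \<in> borel_measurable (lborel \<Otimes>\<^sub>M lborel)" unfolding H_def by measurable
    have "integrable lborel (\<lambda>y. \<bar>f y\<bar> * (\<integral>x. \<bar>\<kappa> (x - y) * \<psi> x\<bar> \<partial>lborel))"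
      using f i2 by (intro integrable_mult_bounded) auto
    then show "integrable lborel (\<lambda>y. \<integral>x. norm (H (y, x)) \<partial>lborel)"
      by (simp add: H_def abs_mult[of "f _"])
    show "AE y in lborel. integrable lborel (\<lambda>x. H (y, x))"
      using i1 by (simp add: H_def)
  qed
  have eq: "(\<integral>y. H (y, x) \<partial>lborel) = conv f \<kappa> x * \<psi> x" for x
    by (simp add: H_def conv_def mult.assoc[symmetric])
  show "integrable lborel (\<lambda>x. conv f \<kappa> x * \<psi> x)"
    using lborel_pair.integrable_snd[of "\<lambda>y x. H (y, x)"] H by (simp add: eq)
  have "(\<integral>x. (\<integral>y. H (y, x) \<partial>lborel) \<partial>lborel) = (\<integral>y. (\<integral>x. H (y, x) \<partial>lborel) \<partial>lborel)"
    using lborel_pair.Fubini_integral[of "\<lambda>y x. H (y, x)"] H by simp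
  then show "(\<integral>x. conv f \<kappa> x * \<psi> x \<partial>lborel) = (\<integral>y. f y * (\<integral>x. \<kappa> (x - y) * \<psi> x \<partial>lborel) \<partial>lborel)"
    by (simp add: eq, simp add: H_def)
qed

lemma mollifier_integral:
  assumes "mollifier r \<eta>"
  shows "(\<integral>y. \<eta> (x - y) \<partial>lborel) = 1" "(\<integral>y. \<eta> (y - x) \<partial>lborel) = 1"
  using assms lborel_integral_reflect[of \<eta> x] lborel_integral_reflect[of "\<lambda>y. \<eta> (- y)" x] lborel_integral_reflect[of \<eta> 0]
  by (auto simp: mollifier_def dest!: smooth_measurable)

text \<open>Jensen's inequality for the probability density \<open>y \<mapsto> \<eta> (x - y)\<close>: the mean of the square exceeds
  the square of the mean by a variance.\<close>

lemma conv_mollifier_square_le: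
  assumes f: "integrable lborel f" "integrable lborel (\<lambda>x. (f x)\<^sup>2)" and m: "mollifier r \<eta>"
  shows "(conv f \<eta> x)\<^sup>2 \<le> conv (\<lambda>x. (f x)\<^sup>2) \<eta> x"
proof -
  let ?c = "conv f \<eta> x"
  note t = mollifier_test_function[OF m]
  have i: "integrable lborel (\<lambda>y. (f y)\<^sup>2 * \<eta> (x - y))" "integrable lborel (\<lambda>y. f y * \<eta> (x - y))"
    "integrable lborel (\<lambda>y. \<eta> (x - y))"
    using integrable_conv[OF f(2) t] integrable_conv[OF f(1) t]
      test_functions_integrable[OF test_functions_reflect[OF t]] by auto
  have "0 \<le> (\<integral>y. (f y - ?c)\<^sup>2 * \<eta> (x - y) \<partial>lborel)"
    using m by (intro Bochner_Integration.integral_nonneg) (auto simp: mollifier_def)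
  also have "\<dots> = (\<integral>y. (f y)\<^sup>2 * \<eta> (x - y) - 2 * ?c * (f y * \<eta> (x - y)) + ?c\<^sup>2 * \<eta> (x - y) \<partial>lborel)"
    by (rule Bochner_Integration.integral_cong) (auto simp: power2_eq_square algebra_simps)
  also have "\<dots> = conv (\<lambda>x. (f x)\<^sup>2) \<eta> x - 2 * ?c * ?c + ?c\<^sup>2"
    using i mollifier_integral[OF m] by (simp add: conv_def)
  finally show ?thesis by (simp add: power2_eq_square)
qed

lemma conv_mollifier_L2_le:
  assumes f: "integrable lborel f" "integrable lborel (\<lambda>x. (f x)\<^sup>2)" and m: "mollifier r \<eta>"
  shows "integrable lborel (\<lambda>x. (conv f \<eta> x)\<^sup>2)"
    and "(\<integral>x. (conv f \<eta> x)\<^sup>2 \<partial>lborel) \<le> (\<integral>x. (f x)\<^sup>2 \<partial>lborel)"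
proof -
  note t = mollifier_test_function[OF m]
  have i: "integrable lborel (conv (\<lambda>x. (f x)\<^sup>2) \<eta>)"
    and e: "(\<integral>x. conv (\<lambda>x. (f x)\<^sup>2) \<eta> x \<partial>lborel) = (\<integral>x. (f x)\<^sup>2 \<partial>lborel)"
    using conv_fubini[OF f(2) t, of "\<lambda>_. 1" 1] mollifier_integral[OF m] by simp_all
  have [measurable]: "conv f \<eta> \<in> borel_measurable borel"
    by (intro smooth_measurable smooth_conv f t)
  show i2: "integrable lborel (\<lambda>x. (conv f \<eta> x)\<^sup>2)"
    using conv_mollifier_square_le[OF f m]
    by (intro Bochner_Integration.integrable_bound[OF i]) (auto intro: order_trans[OF _ abs_ge_self])
  show "(\<integral>x. (conv f \<eta> x)\<^sup>2 \<partial>lborel) \<le> (\<integral>x. (f x)\<^sup>2 \<partial>lborel)"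
    unfolding e[symmetric] using conv_mollifier_square_le[OF f m] by (intro integral_mono i i2) auto
qed

text \<open>Mollifying the indicator function of the \<open>r\<close>-neighbourhood of \<open>K\<close> with radius \<open>r\<close> gives the value
  1 on \<open>K\<close> and support in the \<open>2r\<close>-neighbourhood.\<close>

lemma cutoff_exists:
  assumes K: "compact K" "open U" "K \<subseteq> U"
  obtains \<zeta> where "\<zeta> \<in> test_functions U" "\<And>x. x \<in> K \<Longrightarrow> \<zeta> x = 1"
proof -
  obtain e where e: "e > 0" "(\<Union>x\<in>K. cball x e) \<subseteq> U"
    using compact_subset_open_imp_cball_epsilon_subset[OF K] by metis
  define r where "r = e / 2"
  have r: "r > 0" using e by (simp add: r_def)
  define A where "A = {x + y |x y. x \<in> K \<and> y \<in> cball (0::real^2) r}"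
  define L where "L = {x + y |x y. x \<in> A \<and> y \<in> cball (0::real^2) r}"
  have A: "compact A" unfolding A_def by (rule compact_sums) (use K in auto)
  then have L: "compact L" unfolding L_def by (rule compact_sums) auto
  have "L \<subseteq> U"
  proof
    fix x assume "x \<in> L"
    then obtain a y z where *: "x = a + y + z" "a \<in> K" "norm y \<le> r" "norm z \<le> r"
      unfolding L_def A_def by auto
    then have "dist x a = norm (y + z)" by (simp add: dist_norm add.assoc)
    then have "x \<in> cball a e"
      using norm_triangle_ineq[of y z] * by (simp add: dist_commute r_def)
    then have "x \<in> (\<Union>x\<in>K. cball x e)" using *(2) by (rule UN_I[rotated])
    then show "x \<in> U" using e(2) by (rule subsetD[rotated])
  qed
  obtain \<eta> where m: "mollifier r \<eta>" using mollifier_exists[OF r] by metis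
  note t = mollifier_test_function[OF m]
  let ?f = "indicator A :: real^2 \<Rightarrow> real"
  have f: "integrable lborel ?f"
    using A by (intro integrable_real_indicator emeasure_compact_finite) (auto intro: borel_compact)
  show ?thesis
  proof (rule that)
    show "conv ?f \<eta> \<in> test_functions U"
    proof (rule test_functionsI[OF smooth_conv[OF f t] L \<open>L \<subseteq> U\<close>])
      fix x assume x: "x \<notin> L"
      have "?f y * \<eta> (x - y) = 0" for y
      proof (cases "y \<in> A")
        case True
        have "\<not> norm (x - y) \<le> r"
          using x True unfolding L_def by (auto dest!: spec[of _ y] spec[of _ "x - y"])
        then show ?thesis using m by (simp add: mollifier_def)
      qed simp
      then show "conv ?f \<eta> x = 0" unfolding conv_def by (simp only: Bochner_Integration.integral_zero)
    qed
    fix x assume x: "x \<in> K"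
    have *: "?f y * \<eta> (x - y) = \<eta> (x - y)" for y
    proof (cases "norm (x - y) \<le> r")
      case True
      then have "y \<in> A" unfolding A_def mem_Collect_eq using x
        by (intro exI[of _ x] exI[of _ "y - x"]) (simp add: norm_minus_commute)
      then show ?thesis by simp
    next
      case False then show ?thesis using m by (simp add: mollifier_def)
    qed
    show "conv ?f \<eta> x = 1" unfolding conv_def * by (rule mollifier_integral[OF m])
  qed
qed

lemma mollify_test_function_close:
  assumes \<psi>: "\<psi> \<in> test_functions U" and e: "e > 0"
  obtains r where "r > 0" "\<And>\<eta> y. mollifier r \<eta> \<Longrightarrow> \<bar>(\<integral>x. \<eta> (x - y) * \<psi> x \<partial>lborel) - \<psi> y\<bar> \<le> e"
proof -
  obtain d where d: "d > 0" "\<And>x y. dist x y < d \<Longrightarrow> \<bar>\<psi> x - \<psi> y\<bar> < e"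
    using test_functions_uniformly_continuous[OF \<psi> e] by metis
  show ?thesis
  proof (rule that[OF d(1)])
    fix \<eta> y assume m: "mollifier d \<eta>"
    note t = mollifier_test_function[OF m]
    have sh: "(\<lambda>x. \<eta> (x - y)) \<in> test_functions UNIV"
      using test_functions_reflect[OF test_functions_reflect[OF t, of 0], of y] by simp
    have i: "integrable lborel (\<lambda>x. \<eta> (x - y) * \<psi> x)" "integrable lborel (\<lambda>x. \<eta> (x - y))"
      using integrable_mult_test[OF test_functions_integrable[OF sh] \<psi>] test_functions_integrable[OF sh] by auto
    have "(\<integral>x. \<eta> (x - y) * \<psi> x \<partial>lborel) - \<psi> y = (\<integral>x. \<eta> (x - y) * \<psi> x - \<eta> (x - y) * \<psi> y \<partial>lborel)"
      using i mollifier_integral(2)[OF m] by simp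
    also have "\<bar>\<dots>\<bar> \<le> (\<integral>x. \<eta> (x - y) * e \<partial>lborel)"
    proof (rule order_trans[OF integral_abs_bound], rule integral_mono)
      fix x
      show "\<bar>\<eta> (x - y) * \<psi> x - \<eta> (x - y) * \<psi> y\<bar> \<le> \<eta> (x - y) * e"
      proof (cases "norm (x - y) < d")
        case True
        then have "\<bar>\<psi> x - \<psi> y\<bar> \<le> e" using d(2)[of x y] by (simp add: dist_norm)
        then show ?thesis using m unfolding right_diff_distrib[symmetric] abs_mult
          by (simp add: mollifier_def mult_left_mono)
      next
        case False then show ?thesis using m by (simp add: mollifier_def)
      qed
    qed (use i in auto)
    also have "\<dots> = e" using mollifier_integral(2)[OF m] by simp
    finally show "\<bar>(\<integral>x. \<eta> (x - y) * \<psi> x \<partial>lborel) - \<psi> y\<bar> \<le> e" .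
  qed
qed


section \<open>The Hilbert space of square-integrable fields\<close>

lemma L2_inner_integrable:
  fixes v w :: "real ^ 2 \<Rightarrow> 'a::euclidean_space"
  assumes v: "v \<in> L2 \<Omega>" and w: "w \<in> L2 \<Omega>"
  shows "integrable (lebesgue_on \<Omega>) (\<lambda>x. v x \<bullet> w x)"
proof (rule Bochner_Integration.integrable_bound)
  show "integrable (lebesgue_on \<Omega>) (\<lambda>x. (norm (v x))\<^sup>2 + (norm (w x))\<^sup>2)"
    using v w by (auto simp: L2_def)
  show "(\<lambda>x. v x \<bullet> w x) \<in> borel_measurable (lebesgue_on \<Omega>)"
    using v w by (auto simp: L2_def)
  have "\<bar>v x \<bullet> w x\<bar> \<le> (norm (v x))\<^sup>2 + (norm (w x))\<^sup>2" for x
    using Cauchy_Schwarz_ineq2[of "v x" "w x"] sum_squares_bound[of "norm (v x)" "norm (w x)"]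
      mult_nonneg_nonneg[of "norm (v x)" "norm (w x)"] norm_ge_zero[of "v x"] norm_ge_zero[of "w x"] by linarith
  then show "AE x in lebesgue_on \<Omega>. norm (v x \<bullet> w x) \<le> norm ((norm (v x))\<^sup>2 + (norm (w x))\<^sup>2)"
    by simp
qed

lemma L2_iff:
  "v \<in> L2 \<Omega> \<longleftrightarrow> v \<in> borel_measurable (lebesgue_on \<Omega>) \<and> integrable (lebesgue_on \<Omega>) (\<lambda>x. v x \<bullet> v x)"
  by (simp add: L2_def power2_norm_eq_inner)

lemma L2_add:
  assumes "v \<in> L2 \<Omega>" "w \<in> L2 \<Omega>" shows "(\<lambda>x. v x + w x) \<in> L2 \<Omega>"
proof -
  have "integrable (lebesgue_on \<Omega>) (\<lambda>x. v x \<bullet> v x + v x \<bullet> w x + (w x \<bullet> v x + w x \<bullet> w x))"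
    by (intro Bochner_Integration.integrable_add L2_inner_integrable assms)
  then show ?thesis using assms by (auto simp: L2_iff inner_add_left inner_add_right add_ac)
qed

lemma L2_scaleR: "v \<in> L2 \<Omega> \<Longrightarrow> (\<lambda>x. c *\<^sub>R v x) \<in> L2 \<Omega>"
  by (auto simp: L2_iff)

lemma L2_diff: "v \<in> L2 \<Omega> \<Longrightarrow> w \<in> L2 \<Omega> \<Longrightarrow> (\<lambda>x. v x - w x) \<in> L2 \<Omega>"
  using L2_add[of v \<Omega> "\<lambda>x. (-1) *\<^sub>R w x"] L2_scaleR[of w \<Omega> "-1"] by simp

lemma L2_inner_commute: "L2_inner \<Omega> v w = L2_inner \<Omega> w v"
  by (simp add: L2_inner_def inner_commute)

lemma L2_inner_add_left:
  "u \<in> L2 \<Omega> \<Longrightarrow> v \<in> L2 \<Omega> \<Longrightarrow> w \<in> L2 \<Omega> \<Longrightarrow>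
    L2_inner \<Omega> (\<lambda>x. u x + v x) w = L2_inner \<Omega> u w + L2_inner \<Omega> v w"
  by (simp add: L2_inner_def inner_add_left L2_inner_integrable)

lemma L2_inner_scaleR_left: "L2_inner \<Omega> (\<lambda>x. c *\<^sub>R v x) w = c * L2_inner \<Omega> v w"
  by (simp add: L2_inner_def)

lemma L2_inner_diff_left:
  "u \<in> L2 \<Omega> \<Longrightarrow> v \<in> L2 \<Omega> \<Longrightarrow> w \<in> L2 \<Omega> \<Longrightarrow>
    L2_inner \<Omega> (\<lambda>x. u x - v x) w = L2_inner \<Omega> u w - L2_inner \<Omega> v w"
  by (simp add: L2_inner_def inner_diff_left L2_inner_integrable)

lemma L2_inner_self_nonneg: "0 \<le> L2_inner \<Omega> v v"
  unfolding L2_inner_def by (rule Bochner_Integration.integral_nonneg) simp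

lemma L2_norm_power2: "(L2_norm \<Omega> v)\<^sup>2 = L2_inner \<Omega> v v"
  by (simp add: L2_norm_def L2_inner_self_nonneg)

lemma L2_norm_nonneg: "0 \<le> L2_norm \<Omega> v"
  by (simp add: L2_norm_def L2_inner_self_nonneg)

lemma L2_inner_self_add_scaleR:
  assumes "v \<in> L2 \<Omega>" "w \<in> L2 \<Omega>"
  shows "L2_inner \<Omega> (\<lambda>x. v x + t *\<^sub>R w x) (\<lambda>x. v x + t *\<^sub>R w x)
    = L2_inner \<Omega> v v + 2 * t * L2_inner \<Omega> v w + t\<^sup>2 * L2_inner \<Omega> w w"
proof -
  note m = assms L2_scaleR[OF assms(2)] L2_add[OF assms(1) L2_scaleR[OF assms(2)]]
  have "L2_inner \<Omega> (\<lambda>x. v x + t *\<^sub>R w x) u = L2_inner \<Omega> v u + t * L2_inner \<Omega> w u" if "u \<in> L2 \<Omega>" for u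
    using m that by (simp add: L2_inner_add_left L2_inner_scaleR_left)
  note lin = this
  have "L2_inner \<Omega> u (\<lambda>x. v x + t *\<^sub>R w x) = L2_inner \<Omega> u v + t * L2_inner \<Omega> u w" if "u \<in> L2 \<Omega>" for u
    using lin[OF that] by (simp only: L2_inner_commute[of \<Omega> u])
  then show ?thesis using m lin L2_inner_commute[of \<Omega> w v]
    by (simp add: power2_eq_square algebra_simps)
qed

text \<open>A quadratic polynomial without constant term is negative on one side of 0 unless its linear
  coefficient vanishes.\<close>

lemma quadratic_nonneg_imp_linear_0:
  fixes a b :: real
  assumes "\<And>t. 0 \<le> 2 * t * b + t\<^sup>2 * a" "a \<ge> 0"
  shows "b = 0"
proof (rule ccontr)
  assume "b \<noteq> 0"
  \<comment> \<open>Near the minimiser \<open>- b / a\<close>, and defined also for \<open>a = 0\<close>.\<close>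
  define s where "s = - b / (a + 1)"
  have b: "b = - (s * (a + 1))" using assms(2) by (simp add: s_def field_simps)
  have "2 * s * b + s\<^sup>2 * a = - (s\<^sup>2 * (a + 2))"
    unfolding b by (simp add: power2_eq_square algebra_simps)
  moreover have "s\<^sup>2 * (a + 2) > 0" using \<open>b \<noteq> 0\<close> b assms(2) by (intro mult_pos_pos) auto
  ultimately show False using assms(1)[of s] by linarith
qed

lemma L2_Cauchy_Schwarz:
  assumes "v \<in> L2 \<Omega>" "w \<in> L2 \<Omega>"
  shows "\<bar>L2_inner \<Omega> v w\<bar> \<le> L2_norm \<Omega> v * L2_norm \<Omega> w"
proof -
  let ?a = "L2_inner \<Omega> w w" and ?b = "L2_inner \<Omega> v w" and ?c = "L2_inner \<Omega> v v"
  have q: "0 \<le> ?c + 2 * t * ?b + t\<^sup>2 * ?a" for t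
    using L2_inner_self_add_scaleR[OF assms, of t] L2_inner_self_nonneg[of \<Omega> "\<lambda>x. v x + t *\<^sub>R w x"] by simp
  have "?b\<^sup>2 \<le> ?c * ?a"
  proof (cases "?a = 0")
    case True
    have "?b = 0"
    proof (rule ccontr)
      assume b: "?b \<noteq> 0"
      show False using q[of "- (?c + 1) / (2 * ?b)"] True b by (simp add: field_simps)
    qed
    then show ?thesis using True by simp
  next
    case False
    then have a: "?a > 0" using L2_inner_self_nonneg[of \<Omega> w] by simp
    have "0 \<le> (?c + 2 * (- ?b / ?a) * ?b + (- ?b / ?a)\<^sup>2 * ?a) * ?a"
      using q[of "- ?b / ?a"] a by (intro mult_nonneg_nonneg) auto
    also have "\<dots> = ?c * ?a - ?b\<^sup>2" using a by (simp add: field_simps power2_eq_square)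
    finally show ?thesis by simp
  qed
  then have "sqrt (?b\<^sup>2) \<le> sqrt (?c * ?a)" by (rule real_sqrt_le_mono)
  then show ?thesis by (simp add: L2_norm_def real_sqrt_mult)
qed

text \<open>On a set of finite measure the increments of a geometrically fast Cauchy sequence are summable in
  the \<open>L\<^sup>1\<close> norm, so the sequence converges almost everywhere. Fatou's lemma turns the Cauchy
  estimate into the same estimate for the distance to the limit.\<close>

lemma L2_complete:
  fixes u :: "nat \<Rightarrow> real ^ 2 \<Rightarrow> 'a::euclidean_space"
  assumes \<Omega>: "\<Omega> \<in> lmeasurable" and u: "\<And>n. u n \<in> L2 \<Omega>"
    and cauchy: "\<And>m n. n \<le> m \<Longrightarrow> L2_inner \<Omega> (\<lambda>x. u n x - u m x) (\<lambda>x. u n x - u m x) \<le> (1/4) ^ n"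
  shows "\<exists>p. p \<in> L2 \<Omega> \<and> (\<forall>n. L2_inner \<Omega> (\<lambda>x. u n x - p x) (\<lambda>x. u n x - p x) \<le> (1/4) ^ n)"
proof -
  let ?M = "lebesgue_on \<Omega>"
  have [measurable]: "u n \<in> borel_measurable ?M" for n using u by (simp add: L2_def)
  have ONE: "(\<lambda>_. 1::real) \<in> L2 \<Omega>"
    using \<Omega> by (auto simp: L2_def lmeasurable_iff_integrable integrable_restrict_space fmeasurableD)
  define g where "g n x = norm (u n x - u (Suc n) x)" for n x
  have gL2: "g n \<in> L2 \<Omega>" for n
    using L2_diff[OF u u] by (simp add: g_def[abs_def] L2_def)
  have gi: "integrable ?M (g n)" for n
    using L2_inner_integrable[OF gL2 ONE] by simp
  have gb: "(\<integral>x. g n x \<partial>?M) \<le> L2_norm \<Omega> (\<lambda>_. 1::real) * (1/2) ^ n" for n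
  proof -
    have "L2_inner \<Omega> (g n) (g n) \<le> (1/4) ^ n"
      using cauchy[of n "Suc n"] by (simp add: L2_inner_def g_def power2_eq_square[symmetric] power2_norm_eq_inner)
    also have "\<dots> = ((1/2) ^ n)\<^sup>2" by (simp add: power2_eq_square power_mult_distrib[symmetric])
    finally have "L2_norm \<Omega> (g n) \<le> (1/2) ^ n"
      unfolding L2_norm_def by (intro real_le_lsqrt) (auto simp: L2_inner_self_nonneg)
    then have "L2_norm \<Omega> (g n) * L2_norm \<Omega> (\<lambda>_. 1::real) \<le> (1/2) ^ n * L2_norm \<Omega> (\<lambda>_. 1::real)"
      by (rule mult_right_mono) (rule L2_norm_nonneg)
    moreover have "(\<integral>x. g n x \<partial>?M) \<le> L2_norm \<Omega> (g n) * L2_norm \<Omega> (\<lambda>_. 1::real)"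
      using L2_Cauchy_Schwarz[OF gL2[of n] ONE] by (simp add: L2_inner_def)
    ultimately show ?thesis by (simp add: mult.commute)
  qed
  have "AE x in ?M. summable (\<lambda>n. g n x)"
  proof -
    have [measurable]: "g n \<in> borel_measurable ?M" for n unfolding g_def by measurable
    have "(\<integral>\<^sup>+x. (\<Sum>n. ennreal (g n x)) \<partial>?M) = (\<Sum>n. \<integral>\<^sup>+x. ennreal (g n x) \<partial>?M)"
      by (rule nn_integral_suminf) simp
    also have "\<dots> = (\<Sum>n. ennreal (\<integral>x. g n x \<partial>?M))"
      by (intro suminf_cong nn_integral_eq_integral gi) (simp add: g_def)
    also have "\<dots> \<le> (\<Sum>n. ennreal (L2_norm \<Omega> (\<lambda>_. 1::real) * (1/2) ^ n))"
      using gb by (intro suminf_le ennreal_leI summableI)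
    also have "\<dots> = ennreal (\<Sum>n. L2_norm \<Omega> (\<lambda>_. 1::real) * (1/2) ^ n)"
      by (rule suminf_ennreal2) (auto simp: L2_norm_nonneg intro!: summable_mult summable_geometric)
    also have "\<dots> < \<infinity>" by simp
    finally have "AE x in ?M. (\<Sum>n. ennreal (g n x)) \<noteq> \<infinity>"
      by (intro nn_integral_PInf_AE) auto
    then show ?thesis
      by eventually_elim (auto intro!: summable_suminf_not_top simp: g_def)
  qed
  then have conv: "AE x in ?M. convergent (\<lambda>n. u n x)"
  proof eventually_elim
    case (elim x)
    then have "summable (\<lambda>n. u n x - u (Suc n) x)"
      unfolding g_def by (rule summable_norm_cancel)
    then have "convergent (\<lambda>n. \<Sum>k<n. u k x - u (Suc k) x)" by (simp add: summable_iff_convergent)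
    then have "convergent (\<lambda>n. u 0 x - u n x)" by (simp only: sum_lessThan_telescope'[of "\<lambda>k. u k x"])
    from convergent_diff[OF convergent_const[of "u 0 x"] this] show ?case by simp
  qed
  define p where "p x = lim (\<lambda>n. u n x)" for x
  have [measurable]: "p \<in> borel_measurable ?M" unfolding p_def by measurable
  have lim: "AE x in ?M. (\<lambda>n. u n x) \<longlonglongrightarrow> p x"
    using conv by eventually_elim (simp add: p_def convergent_LIMSEQ_iff)
  have bound: "(\<integral>\<^sup>+x. ennreal ((norm (u n x - p x))\<^sup>2) \<partial>?M) \<le> ennreal ((1/4) ^ n)" for n
  proof -
    have "AE x in ?M. ennreal ((norm (u n x - p x))\<^sup>2) = liminf (\<lambda>m. ennreal ((norm (u n x - u m x))\<^sup>2))"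
      using lim
    proof eventually_elim
      case (elim x)
      have "(\<lambda>m. ennreal ((norm (u n x - u m x))\<^sup>2)) \<longlonglongrightarrow> ennreal ((norm (u n x - p x))\<^sup>2)"
        by (intro tendsto_intros elim)
      from lim_imp_Liminf[OF _ this] show ?case by simp
    qed
    then have "(\<integral>\<^sup>+x. ennreal ((norm (u n x - p x))\<^sup>2) \<partial>?M)
        = (\<integral>\<^sup>+x. liminf (\<lambda>m. ennreal ((norm (u n x - u m x))\<^sup>2)) \<partial>?M)"
      by (rule nn_integral_cong_AE)
    also have "\<dots> \<le> liminf (\<lambda>m. \<integral>\<^sup>+x. ennreal ((norm (u n x - u m x))\<^sup>2) \<partial>?M)"
      by (rule nn_integral_liminf) measurable
    also have "\<dots> \<le> liminf (\<lambda>m. ennreal ((1/4) ^ n))"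
    proof (rule Liminf_mono)
      show "\<forall>\<^sub>F m in sequentially. (\<integral>\<^sup>+x. ennreal ((norm (u n x - u m x))\<^sup>2) \<partial>?M) \<le> ennreal ((1/4) ^ n)"
        using eventually_ge_at_top[of n]
      proof eventually_elim
        case (elim m)
        have "(\<integral>\<^sup>+x. ennreal ((norm (u n x - u m x))\<^sup>2) \<partial>?M) = ennreal (\<integral>x. (norm (u n x - u m x))\<^sup>2 \<partial>?M)"
          using L2_diff[OF u u, of n m] by (intro nn_integral_eq_integral) (auto simp: L2_def)
        also have "\<dots> \<le> ennreal ((1/4) ^ n)"
          using cauchy[OF elim] by (intro ennreal_leI) (simp add: L2_inner_def power2_norm_eq_inner)
        finally show ?case .
      qed
    qed
    also have "\<dots> = ennreal ((1/4) ^ n)" by (simp add: Liminf_const)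
    finally show ?thesis .
  qed
  have int: "integrable ?M (\<lambda>x. (norm (u n x - p x))\<^sup>2)" for n
    using bound[of n] by (intro integrableI_bounded) (auto simp: le_less_trans)
  then have diff: "(\<lambda>x. u n x - p x) \<in> L2 \<Omega>" for n by (simp add: L2_def)
  show ?thesis
  proof (intro exI conjI allI)
    show "p \<in> L2 \<Omega>" using L2_diff[OF u diff, of 0 0] by simp
    fix n
    have "ennreal (\<integral>x. (norm (u n x - p x))\<^sup>2 \<partial>?M) \<le> ennreal ((1/4) ^ n)"
      using bound[of n] nn_integral_eq_integral[OF int, of n] by simp
    then show "L2_inner \<Omega> (\<lambda>x. u n x - p x) (\<lambda>x. u n x - p x) \<le> (1/4) ^ n"
      by (simp add: L2_inner_def power2_norm_eq_inner)
  qed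
qed

text \<open>Minimise \<open>J w = \<langle>w, w\<rangle> - 2 l w\<close> over \<open>S\<close>. By the parallelogram law a minimising sequence is
  Cauchy, and the vanishing of the first variation of \<open>J\<close> at its limit is the representation of \<open>l\<close>.
  For \<open>l w = \<langle>v, w\<rangle>\<close> the limit is the orthogonal projection of \<open>v\<close>; for a derivative functional on
  test functions it is a weak derivative.\<close>

lemma riesz_representation_L2_closure:
  fixes S :: "(real ^ 2 \<Rightarrow> 'a::euclidean_space) set"
  assumes \<Omega>: "\<Omega> \<in> lmeasurable" and S: "S \<subseteq> L2 \<Omega>" "S \<noteq> {}"
    and S_add: "\<And>v w. v \<in> S \<Longrightarrow> w \<in> S \<Longrightarrow> (\<lambda>x. v x + w x) \<in> S"
    and S_scaleR: "\<And>c v. v \<in> S \<Longrightarrow> (\<lambda>x. c *\<^sub>R v x) \<in> S"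
    and l_add: "\<And>v w. v \<in> S \<Longrightarrow> w \<in> S \<Longrightarrow> l (\<lambda>x. v x + w x) = l v + l w"
    and l_scaleR: "\<And>c v. v \<in> S \<Longrightarrow> l (\<lambda>x. c *\<^sub>R v x) = c * l v"
    and l_bounded: "\<And>v. v \<in> S \<Longrightarrow> \<bar>l v\<bar> \<le> C * L2_norm \<Omega> v"
  obtains p where "p \<in> L2_closure \<Omega> S" "\<And>w. w \<in> S \<Longrightarrow> L2_inner \<Omega> p w = l w"
proof -
  note SL = subsetD[OF S(1)]
  define J where "J w = L2_inner \<Omega> w w - 2 * l w" for w
  have J_lower: "- C\<^sup>2 \<le> J w" if "w \<in> S" for w
  proof -
    have "0 \<le> (L2_norm \<Omega> w - C)\<^sup>2" by simp
    also have "\<dots> = L2_inner \<Omega> w w - 2 * (C * L2_norm \<Omega> w) + C\<^sup>2"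
      by (simp add: power2_diff L2_norm_power2)
    finally show ?thesis using l_bounded[OF that] by (simp add: J_def)
  qed
  define d where "d = Inf (J ` S)"
  have bdd: "bdd_below (J ` S)" using J_lower by (auto intro!: bdd_belowI)
  have d: "d \<le> J w" if "w \<in> S" for w using that bdd by (auto simp: d_def intro: cInf_lower)
  \<comment> \<open>With this tolerance the parallelogram law bounds the squared distance of the \<open>n\<close>th from every
    later element by \<open>(1/4) ^ n\<close>, as completeness requires.\<close>
  have "\<exists>w\<in>S. J w < d + (1/4) ^ n / 4" for n
    using cInf_lessD[of "J ` S" "d + (1/4) ^ n / 4"] S(2) by (auto simp: d_def)
  then obtain u where u: "\<And>n. u n \<in> S" "\<And>n. J (u n) < d + (1/4) ^ n / 4" by metis
  have Jt: "J (\<lambda>x. v x + t *\<^sub>R w x) = J v + 2 * t * (L2_inner \<Omega> v w - l w) + t\<^sup>2 * L2_inner \<Omega> w w"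
    if "v \<in> S" "w \<in> S" for v w t
    using that by (simp add: J_def L2_inner_self_add_scaleR SL S_scaleR l_add l_scaleR algebra_simps)
  have "\<exists>p. p \<in> L2 \<Omega> \<and> (\<forall>n. L2_inner \<Omega> (\<lambda>x. u n x - p x) (\<lambda>x. u n x - p x) \<le> (1/4) ^ n)"
  proof (rule L2_complete[OF \<Omega> SL[OF u(1)]])
    fix m n :: nat assume "n \<le> m"
    then have "(1/4) ^ m \<le> (1/4::real) ^ n" by (intro power_decreasing) auto
    let ?v = "u n" and ?w = "u m"
    let ?mid = "\<lambda>x. (1/2) *\<^sub>R ?v x + (1/2) *\<^sub>R ?w x"
    have h: "(\<lambda>x. (1/2) *\<^sub>R ?v x) \<in> S" using u by (intro S_scaleR)
    have "?mid \<in> S" using u h by (intro S_add S_scaleR)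
    then have "d \<le> J ?mid" by (rule d)
    moreover have "J ?mid = J (\<lambda>x. (1/2) *\<^sub>R ?v x) + (L2_inner \<Omega> (\<lambda>x. (1/2) *\<^sub>R ?v x) ?w - l ?w) + L2_inner \<Omega> ?w ?w / 4"
      using Jt[OF h u(1), of "1/2" m] by (simp add: power2_eq_square)
    moreover have "J (\<lambda>x. (1/2) *\<^sub>R ?v x) = L2_inner \<Omega> ?v ?v / 4 - l ?v"
      using u L2_inner_commute[of \<Omega> ?v "\<lambda>x. (1/2) *\<^sub>R ?v x"]
      by (simp add: J_def L2_inner_scaleR_left l_scaleR)
    moreover have "L2_inner \<Omega> (\<lambda>x. ?v x - ?w x) (\<lambda>x. ?v x - ?w x)
       = L2_inner \<Omega> ?v ?v - 2 * L2_inner \<Omega> ?v ?w + L2_inner \<Omega> ?w ?w"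
      using L2_inner_self_add_scaleR[OF SL[OF u(1)] SL[OF u(1)], of n "-1" m] by simp
    ultimately have "L2_inner \<Omega> (\<lambda>x. ?v x - ?w x) (\<lambda>x. ?v x - ?w x) \<le> 2 * J ?v + 2 * J ?w - 4 * d"
      by (simp add: J_def L2_inner_scaleR_left)
    then show "L2_inner \<Omega> (\<lambda>x. ?v x - ?w x) (\<lambda>x. ?v x - ?w x) \<le> (1/4) ^ n"
      using u(2)[of n] u(2)[of m] \<open>(1/4) ^ m \<le> (1/4) ^ n\<close> by linarith
  qed
  then obtain p where p: "p \<in> L2 \<Omega>" "\<And>n. L2_inner \<Omega> (\<lambda>x. u n x - p x) (\<lambda>x. u n x - p x) \<le> (1/4) ^ n"
    by metis
  have to0: "(\<lambda>n. L2_inner \<Omega> (\<lambda>x. u n x - p x) (\<lambda>x. u n x - p x)) \<longlonglongrightarrow> 0"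
    by (rule tendsto_sandwich[of "\<lambda>_. 0" _ _ "\<lambda>n. (1/4) ^ n"])
       (auto intro!: always_eventually L2_inner_self_nonneg p LIMSEQ_realpow_zero)
  then have norm0: "(\<lambda>n. L2_norm \<Omega> (\<lambda>x. u n x - p x)) \<longlonglongrightarrow> 0"
    unfolding L2_norm_def using tendsto_real_sqrt by fastforce
  show ?thesis
  proof (rule that)
    show "p \<in> L2_closure \<Omega> S"
      unfolding L2_closure_def
    proof (intro CollectI conjI allI impI p(1))
      fix e :: real assume "e > 0"
      then obtain n where "L2_norm \<Omega> (\<lambda>x. u n x - p x) < e"
        using order_tendstoD(2)[OF norm0] by (auto simp: eventually_sequentially)
      moreover have "L2_norm \<Omega> (\<lambda>x. u n x - p x) = L2_norm \<Omega> (\<lambda>x. p x - u n x)"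
        by (simp add: L2_norm_def L2_inner_def power2_norm_eq_inner[symmetric] norm_minus_commute)
      ultimately show "\<exists>w\<in>S. L2_norm \<Omega> (\<lambda>x. p x - w x) < e" using u(1) by auto
    qed
    fix w assume w: "w \<in> S"
    have "(\<lambda>n. L2_inner \<Omega> (u n) w - L2_inner \<Omega> p w) \<longlonglongrightarrow> 0"
    proof (rule Lim_null_comparison)
      show "\<forall>\<^sub>F n in sequentially. norm (L2_inner \<Omega> (u n) w - L2_inner \<Omega> p w)
          \<le> L2_norm \<Omega> (\<lambda>x. u n x - p x) * L2_norm \<Omega> w"
        using L2_Cauchy_Schwarz[OF L2_diff[OF SL[OF u(1)] p(1)] SL[OF w]] SL[OF u(1)] SL[OF w] p(1)
        by (auto simp: L2_inner_diff_left)
      show "(\<lambda>n. L2_norm \<Omega> (\<lambda>x. u n x - p x) * L2_norm \<Omega> w) \<longlonglongrightarrow> 0"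
        using tendsto_mult_left_zero[OF norm0] .
    qed
    then have ip: "(\<lambda>n. L2_inner \<Omega> (u n) w) \<longlonglongrightarrow> L2_inner \<Omega> p w" by (simp add: LIM_zero_iff)
    have "L2_inner \<Omega> p w - l w = 0"
    proof (rule quadratic_nonneg_imp_linear_0)
      fix t
      have "0 \<le> (1/4) ^ n / 4 + 2 * t * (L2_inner \<Omega> (u n) w - l w) + t\<^sup>2 * L2_inner \<Omega> w w" for n
        using d[OF S_add[OF u(1) S_scaleR[OF w]], of n t] u(2)[of n] Jt[OF u(1) w, of n t] by simp
      moreover have "(\<lambda>n. (1/4) ^ n / 4 + 2 * t * (L2_inner \<Omega> (u n) w - l w) + t\<^sup>2 * L2_inner \<Omega> w w)
         \<longlonglongrightarrow> 0 / 4 + 2 * t * (L2_inner \<Omega> p w - l w) + t\<^sup>2 * L2_inner \<Omega> w w"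
        by (intro tendsto_intros ip LIMSEQ_realpow_zero) auto
      ultimately show "0 \<le> 2 * t * (L2_inner \<Omega> p w - l w) + t\<^sup>2 * L2_inner \<Omega> w w"
        using LIMSEQ_le_const by fastforce
    qed (rule L2_inner_self_nonneg)
    then show "L2_inner \<Omega> p w = l w" by simp
  qed
qed


section \<open>Interior bounds for mollified fields\<close>

text \<open>Convolution at \<open>x\<close> is integration against this function, so weak equations on \<open>U\<close> become
  pointwise equations at all \<open>x\<close> whose distance from the complement of \<open>U\<close> exceeds \<open>r\<close>.\<close>

lemma shifted_test_function:
  assumes "smooth \<kappa>" "\<And>x. x \<notin> cball 0 r \<Longrightarrow> \<kappa> x = 0" "cball x r \<subseteq> U"
  shows "(\<lambda>y. \<kappa> (x - y)) \<in> test_functions U"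
proof (rule test_functionsI)
  show "smooth (\<lambda>y. \<kappa> (x - y))" using assms(1) by (rule smooth_reflect)
  show "\<kappa> (x - y) = 0" if "y \<notin> cball x r" for y
    using that by (intro assms(2)) (simp add: dist_norm norm_minus_commute)
qed (use assms in auto)

lemma mixed_pderivative_support:
  assumes "\<And>x. x \<notin> cball 0 r \<Longrightarrow> \<kappa> x = 0" "x \<notin> cball 0 r"
  shows "mixed_pderivative a b \<kappa> x = 0"
proof -
  have "\<forall>x. x \<notin> cball 0 r \<longrightarrow> (pderivative i ^^ n) f x = 0"
    if "\<forall>x. x \<notin> cball 0 r \<longrightarrow> f x = 0" for i n f
    using that
  proof (induction n)
    case (Suc n)
    then show ?case using pderivative_outside_support[of "cball 0 r" "(pderivative i ^^ n) f"] by auto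
  qed simp
  from this[OF this] assms show ?thesis unfolding mixed_pderivative_def by blast
qed

lemma mixed_pderivative_reflect:
  assumes "smooth \<kappa>"
  shows "mixed_pderivative a b (\<lambda>y. \<kappa> (x - y)) = (\<lambda>y. (-1) ^ (a + b) * mixed_pderivative a b \<kappa> (x - y))"
proof (induction a)
  case 0
  show ?case
  proof (induction b)
    case 0
    then show ?case by (simp add: mixed_pderivative_0)
  next
    case (Suc b)
    have "smooth (mixed_pderivative 0 b \<kappa>)" using assms by (rule smooth_mixed_pderivative)
    then show ?case using Suc assms
      by (simp add: mixed_pderivative_Suc_right smooth_reflect pderivative_smooth_cmult pderivative_reflect)
  qed
next
  case (Suc a)
  have "smooth (mixed_pderivative a b \<kappa>)" using assms by (rule smooth_mixed_pderivative)
  then show ?case using Suc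
    by (simp add: mixed_pderivative_Suc_left smooth_reflect pderivative_smooth_cmult pderivative_reflect)
qed

text \<open>In the sense of distributions on \<open>\<Omega>\<close>, the fields \<open>p\<close> and \<open>v\<close> have the same divergence, and the curl of
  \<open>p\<close> vanishes.\<close>

definition weakly_div_curl :: "(real ^ 2) set \<Rightarrow> (2 \<Rightarrow> real ^ 2 \<Rightarrow> real) \<Rightarrow> (2 \<Rightarrow> real ^ 2 \<Rightarrow> real) \<Rightarrow> bool" where
  "weakly_div_curl \<Omega> p v \<longleftrightarrow> (\<forall>\<psi>\<in>test_functions \<Omega>.
     (\<integral>x. p 1 x * pderivative 1 \<psi> x \<partial>lborel) + (\<integral>x. p 2 x * pderivative 2 \<psi> x \<partial>lborel)
       = (\<integral>x. v 1 x * pderivative 1 \<psi> x \<partial>lborel) + (\<integral>x. v 2 x * pderivative 2 \<psi> x \<partial>lborel) \<and>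
     (\<integral>x. p 1 x * pderivative 2 \<psi> x \<partial>lborel) = (\<integral>x. p 2 x * pderivative 1 \<psi> x \<partial>lborel))"

lemma weakly_div_curl_conv:
  assumes "weakly_div_curl \<Omega> p v"
    and k: "smooth \<kappa>" "\<And>x. x \<notin> cball 0 r \<Longrightarrow> \<kappa> x = 0" "cball x r \<subseteq> \<Omega>"
  shows "conv (p 1) (pderivative 1 \<kappa>) x + conv (p 2) (pderivative 2 \<kappa>) x
      = conv (v 1) (pderivative 1 \<kappa>) x + conv (v 2) (pderivative 2 \<kappa>) x"
    and "conv (p 1) (pderivative 2 \<kappa>) x = conv (p 2) (pderivative 1 \<kappa>) x"
  using assms(1) shifted_test_function[OF k] k(1)
  by (auto simp: weakly_div_curl_def conv_def pderivative_reflect dest!: bspec)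

lemma weak_derivative_conv:
  assumes g: "\<And>\<psi>. \<psi> \<in> test_functions V \<Longrightarrow>
      (\<integral>x. f x * mixed_pderivative a b \<psi> x \<partial>lborel) = (-1) ^ (a + b) * (\<integral>x. g x * \<psi> x \<partial>lborel)"
    and k: "smooth \<kappa>" "\<And>x. x \<notin> cball 0 r \<Longrightarrow> \<kappa> x = 0" "cball x r \<subseteq> V"
  shows "conv f (mixed_pderivative a b \<kappa>) x = conv g \<kappa> x"
proof -
  have "(-1) ^ (a + b) * conv f (mixed_pderivative a b \<kappa>) x = (-1) ^ (a + b) * conv g \<kappa> x"
    using g[OF shifted_test_function[OF k]] k(1)
    by (simp add: conv_def mixed_pderivative_reflect mult.left_commute[of "f _"])
  then show ?thesis by simp
qed

text \<open>The quantitative form of having a weak derivative that is locally square integrable in \<open>U\<close>. It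
  is phrased with mollified functions because these can be differentiated and cut off freely.\<close>

definition mollified_derivative_bounded ::
    "(real ^ 2) set \<Rightarrow> nat \<Rightarrow> nat \<Rightarrow> (real ^ 2 \<Rightarrow> real) \<Rightarrow> bool" where
  "mollified_derivative_bounded U a b f \<longleftrightarrow> (\<forall>K. compact K \<and> K \<subseteq> U \<longrightarrow>
     (\<exists>C. \<exists>r>0. \<forall>\<eta>. mollifier r \<eta> \<longrightarrow>
        (\<integral>x. indicator K x * (conv f (mixed_pderivative a b \<eta>) x)\<^sup>2 \<partial>lborel) \<le> C))"

lemma mollified_derivative_boundedD:
  assumes "mollified_derivative_bounded U a b f" "compact K" "K \<subseteq> U"
  shows "\<exists>C r. r > 0 \<and> (\<forall>\<eta>. mollifier r \<eta> \<longrightarrow>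
        (\<integral>x. indicator K x * (conv f (mixed_pderivative a b \<eta>) x)\<^sup>2 \<partial>lborel) \<le> C)"
  using assms(1)[unfolded mollified_derivative_bounded_def, rule_format, OF conjI, OF assms(2,3)]
  by (elim exE conjE) (intro exI conjI)

lemma compact_neighbourhood_exists:
  fixes K :: "(real ^ 2) set"
  assumes "compact K" "open U" "K \<subseteq> U"
  shows "\<exists>V r. open V \<and> compact (closure V) \<and> closure V \<subseteq> U \<and> r > 0 \<and> (\<forall>x\<in>K. cball x r \<subseteq> V)"
proof -
  obtain e where e: "e > 0" "(\<Union>x\<in>K. cball x e) \<subseteq> U"
    using compact_subset_open_imp_cball_epsilon_subset[OF assms] by metis
  define V where "V = (\<Union>x\<in>K. ball x e)"
  define L where "L = {x + y |x y. x \<in> K \<and> y \<in> cball (0::real^2) e}"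
  have L: "compact L" unfolding L_def by (rule compact_sums) (use assms in auto)
  have "V \<subseteq> L"
  proof
    fix y assume "y \<in> V"
    then obtain x where "x \<in> K" "dist x y < e" by (auto simp: V_def)
    then show "y \<in> L" unfolding L_def mem_Collect_eq
      by (intro exI[of _ x] exI[of _ "y - x"]) (simp add: dist_norm norm_minus_commute)
  qed
  then have cV: "closure V \<subseteq> L" using L by (intro closure_minimal compact_imp_closed)
  have LU: "L \<subseteq> (\<Union>x\<in>K. cball x e)"
  proof
    fix z assume "z \<in> L"
    then obtain x y where "z = x + y" "x \<in> K" "norm y \<le> e" by (auto simp: L_def)
    then show "z \<in> (\<Union>x\<in>K. cball x e)" by (intro UN_I[of x]) (auto simp: dist_norm)
  qed
  have sub: "cball x (e / 2) \<subseteq> V" if "x \<in> K" for x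
  proof -
    have "cball x (e / 2) \<subseteq> ball x e" using e(1) by (auto simp: subset_iff)
    then show ?thesis using that by (auto simp: V_def)
  qed
  have "compact (closure V)"
    using compact_Int_closed[OF L closed_closure, of V] cV by (simp add: Int_absorb1)
  moreover have "closure V \<subseteq> U" using cV LU e(2) by (rule order_trans[OF order_trans])
  moreover have "open V" by (auto simp: V_def)
  ultimately show ?thesis using sub e(1) by (intro exI[of _ V] exI[of _ "e / 2"]) simp
qed

text \<open>Near \<open>K\<close> the derivative of a mollification is the mollification of the weak derivative, and
  mollification does not increase the \<open>L\<^sup>2\<close> norm.\<close>

lemma mollified_derivative_bounded_of_weak_derivative:
  assumes U: "open U" and f: "integrable lborel f"
    and weak: "\<And>V. open V \<Longrightarrow> compact (closure V) \<Longrightarrow> closure V \<subseteq> U \<Longrightarrow>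
       \<exists>g. integrable lborel g \<and> integrable lborel (\<lambda>x. (g x)\<^sup>2) \<and> (\<forall>\<psi>\<in>test_functions V.
         (\<integral>x. f x * mixed_pderivative a b \<psi> x \<partial>lborel) = (-1) ^ (a + b) * (\<integral>x. g x * \<psi> x \<partial>lborel))"
  shows "mollified_derivative_bounded U a b f"
  unfolding mollified_derivative_bounded_def
proof (intro allI impI)
  fix K assume "compact K \<and> K \<subseteq> U"
  then have K: "compact K" "K \<subseteq> U" by auto
  obtain V r where V: "open V" "compact (closure V)" "closure V \<subseteq> U"
    and r: "r > 0" "\<And>x. x \<in> K \<Longrightarrow> cball x r \<subseteq> V"
    using compact_neighbourhood_exists[OF K(1) U K(2)] by metis
  obtain g where g0: "integrable lborel g \<and> integrable lborel (\<lambda>x. (g x)\<^sup>2) \<and> (\<forall>\<psi>\<in>test_functions V.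
         (\<integral>x. f x * mixed_pderivative a b \<psi> x \<partial>lborel) = (-1) ^ (a + b) * (\<integral>x. g x * \<psi> x \<partial>lborel))"
    using weak[OF V] by (elim exE) (rule that)
  then have g: "integrable lborel g" "integrable lborel (\<lambda>x. (g x)\<^sup>2)"
    "\<And>\<psi>. \<psi> \<in> test_functions V \<Longrightarrow>
       (\<integral>x. f x * mixed_pderivative a b \<psi> x \<partial>lborel) = (-1) ^ (a + b) * (\<integral>x. g x * \<psi> x \<partial>lborel)"
    by simp_all
  show "\<exists>C. \<exists>r>0. \<forall>\<eta>. mollifier r \<eta> \<longrightarrow>
        (\<integral>x. indicator K x * (conv f (mixed_pderivative a b \<eta>) x)\<^sup>2 \<partial>lborel) \<le> C"
  proof (rule exI[of _ "\<integral>x. (g x)\<^sup>2 \<partial>lborel"], rule exI[of _ r], intro conjI allI impI r(1))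
    fix \<eta> assume m: "mollifier r \<eta>"
    note t = mollifier_test_function[OF m]
    have eq: "indicator K x * (conv f (mixed_pderivative a b \<eta>) x)\<^sup>2 = indicator K x * (conv g \<eta> x)\<^sup>2" for x
      using weak_derivative_conv[where V=V and \<kappa>=\<eta> and r=r and x=x, OF g(3)] m r(2)[of x]
      by (cases "x \<in> K") (auto simp: mollifier_def)
    have "(\<integral>x. indicator K x * (conv g \<eta> x)\<^sup>2 \<partial>lborel) \<le> (\<integral>x. (conv g \<eta> x)\<^sup>2 \<partial>lborel)"
    proof (rule integral_mono)
      show "integrable lborel (\<lambda>x. indicator K x * (conv g \<eta> x)\<^sup>2)"
        using K g(1) t unfolding power2_eq_square
        by (intro integrable_indicator_compact smooth_continuous smooth_mult smooth_conv) auto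
      show "integrable lborel (\<lambda>x. (conv g \<eta> x)\<^sup>2)" by (rule conv_mollifier_L2_le(1)[OF g(1,2) m])
    qed (auto simp: indicator_def)
    also have "\<dots> \<le> (\<integral>x. (g x)\<^sup>2 \<partial>lborel)" by (rule conv_mollifier_L2_le(2)[OF g(1,2) m])
    finally show "(\<integral>x. indicator K x * (conv f (mixed_pderivative a b \<eta>) x)\<^sup>2 \<partial>lborel) \<le> (\<integral>x. (g x)\<^sup>2 \<partial>lborel)"
      unfolding eq .
  qed
qed

lemma mollified_derivative_bounded_0:
  assumes U: "open U" and f: "integrable lborel f" "integrable lborel (\<lambda>x. (f x)\<^sup>2)"
  shows "mollified_derivative_bounded U 0 0 f"
  using f by (intro mollified_derivative_bounded_of_weak_derivative U f)
    (auto simp: mixed_pderivative_0 intro!: exI[of _ f])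

text \<open>The smooth field \<open>w\<^sub>i = p\<^sub>i * \<partial>\<^sup>\<alpha>\<eta>\<close> is curl-free on the support of the
  cut-off function, and its divergence is expressed there by derivatives of the mollified \<open>v\<close> of order one
  higher. So the interior gradient estimate bounds \<open>Dw\<close> by quantities that are under control.\<close>

lemma mollified_gradient_estimate:
  assumes U: "open U" "U \<subseteq> \<Omega>" and wdc: "weakly_div_curl \<Omega> p v"
    and p: "\<And>i. integrable lborel (p i)" and v: "\<And>i. integrable lborel (v i)"
    and bp: "\<And>i. mollified_derivative_bounded U a b (p i)"
    and bv: "mollified_derivative_bounded U (Suc a) b (v 1)" "mollified_derivative_bounded U a (Suc b) (v 2)"
    and K: "compact K" "K \<subseteq> U"
  shows "\<exists>C. \<exists>r>0. \<forall>\<eta>. mollifier r \<eta> \<longrightarrow> (\<forall>i j.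
     (\<integral>x. indicator K x * (conv (p i) (pderivative j (mixed_pderivative a b \<eta>)) x)\<^sup>2 \<partial>lborel) \<le> C)"
proof -
  obtain \<zeta> where \<zeta>: "\<zeta> \<in> test_functions U" "\<And>x. x \<in> K \<Longrightarrow> \<zeta> x = 1"
    using cutoff_exists[OF K(1) U(1) K(2)] by metis
  have \<zeta>t: "\<zeta> \<in> test_functions UNIV" using \<zeta>(1) by (rule test_functions_mono) simp
  obtain S where S: "compact S" "S \<subseteq> U" "\<And>x. x \<notin> S \<Longrightarrow> \<zeta> x = 0"
    using test_functions_support[OF \<zeta>(1)] by metis
  obtain e where e: "e > 0" "(\<Union>x\<in>S. cball x e) \<subseteq> U"
    using compact_subset_open_imp_cball_epsilon_subset[OF S(1) U(1) S(2)] by metis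
  obtain C0 where C0: "C0 \<ge> 0 \<and> (\<forall>w1 w2. smooth w1 \<longrightarrow> smooth w2 \<longrightarrow>
      (\<forall>x\<in>S. pderivative 1 w2 x = pderivative 2 w1 x) \<longrightarrow>
      (\<integral>x. (\<zeta> x)\<^sup>2 * ((pderivative 1 w1 x)\<^sup>2 + (pderivative 2 w1 x)\<^sup>2 + (pderivative 1 w2 x)\<^sup>2 + (pderivative 2 w2 x)\<^sup>2) \<partial>lborel)
      \<le> C0 * (\<integral>x. indicator S x * ((pderivative 1 w1 x + pderivative 2 w2 x)\<^sup>2 + ((w1 x)\<^sup>2 + (w2 x)\<^sup>2)) \<partial>lborel))"
    by (rule exE[OF interior_gradient_estimate[OF \<zeta>t S(1,3)]], assumption) (rule that)
  obtain C1 r1 where 1: "r1 > 0 \<and> (\<forall>\<eta>. mollifier r1 \<eta> \<longrightarrow>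
        (\<integral>x. indicator S x * (conv (p 1) (mixed_pderivative a b \<eta>) x)\<^sup>2 \<partial>lborel) \<le> C1)"
    using mollified_derivative_boundedD[OF bp[of 1] S(1,2)] by (elim exE) (rule that)
  obtain C2 r2 where 2: "r2 > 0 \<and> (\<forall>\<eta>. mollifier r2 \<eta> \<longrightarrow>
        (\<integral>x. indicator S x * (conv (p 2) (mixed_pderivative a b \<eta>) x)\<^sup>2 \<partial>lborel) \<le> C2)"
    using mollified_derivative_boundedD[OF bp[of 2] S(1,2)] by (elim exE) (rule that)
  obtain C3 r3 where 3: "r3 > 0 \<and> (\<forall>\<eta>. mollifier r3 \<eta> \<longrightarrow>
        (\<integral>x. indicator S x * (conv (v 1) (mixed_pderivative (Suc a) b \<eta>) x)\<^sup>2 \<partial>lborel) \<le> C3)"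
    using mollified_derivative_boundedD[OF bv(1) S(1,2)] by (elim exE) (rule that)
  obtain C4 r4 where 4: "r4 > 0 \<and> (\<forall>\<eta>. mollifier r4 \<eta> \<longrightarrow>
        (\<integral>x. indicator S x * (conv (v 2) (mixed_pderivative a (Suc b) \<eta>) x)\<^sup>2 \<partial>lborel) \<le> C4)"
    using mollified_derivative_boundedD[OF bv(2) S(1,2)] by (elim exE) (rule that)
  \<comment> \<open>The bound by \<open>e\<close> keeps the supports of the shifted kernels inside \<open>\<Omega>\<close>.\<close>
  define r where "r = min e (min (min r1 r2) (min r3 r4))"
  have r: "r > 0" "r \<le> e" "r \<le> r1" "r \<le> r2" "r \<le> r3" "r \<le> r4" using e 1 2 3 4 by (auto simp: r_def)
  show ?thesis
  proof (rule exI[of _ "C0 * (2 * C3 + 2 * C4 + (C1 + C2))"], rule exI[of _ r], intro conjI allI impI r(1))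
    fix \<eta> i j assume m: "mollifier r \<eta>"
    define \<kappa> where "\<kappa> = mixed_pderivative a b \<eta>"
    have sm: "smooth \<eta>" using m by (simp add: mollifier_def)
    have kt: "\<kappa> \<in> test_functions UNIV"
      unfolding \<kappa>_def by (intro test_functions_mixed_pderivative mollifier_test_function[OF m])
    have k: "smooth \<kappa>" "\<And>x. x \<notin> cball 0 r \<Longrightarrow> \<kappa> x = 0"
      unfolding \<kappa>_def using m by (auto simp: mollifier_def intro!: smooth_mixed_pderivative mixed_pderivative_support[of r])
    have k1: "pderivative 1 \<kappa> = mixed_pderivative (Suc a) b \<eta>"
      and k2: "pderivative 2 \<kappa> = mixed_pderivative a (Suc b) \<eta>"
      using sm by (simp_all add: \<kappa>_def mixed_pderivative_Suc_left mixed_pderivative_Suc_right)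
    let ?w = "\<lambda>i. conv (p i) \<kappa>"
    have sw: "smooth (?w i)" for i by (rule smooth_conv[OF p kt])
    have dw: "pderivative j (?w i) = conv (p i) (pderivative j \<kappa>)" for i j
      by (rule pderivative_conv[OF p kt])
    have inO: "cball x r \<subseteq> \<Omega>" if "x \<in> S" for x
    proof -
      have "cball x r \<subseteq> cball x e" using r(2) by auto
      also have "\<dots> \<subseteq> U" using e(2) that by blast
      finally show ?thesis using U(2) by blast
    qed
    have curl: "pderivative 1 (?w 2) x = pderivative 2 (?w 1) x" if "x \<in> S" for x
      unfolding dw using weakly_div_curl_conv(2)[OF wdc k inO[OF that]] by simp
    have div: "pderivative 1 (?w 1) x + pderivative 2 (?w 2) x
        = conv (v 1) (pderivative 1 \<kappa>) x + conv (v 2) (pderivative 2 \<kappa>) x" if "x \<in> S" for x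
      unfolding dw using weakly_div_curl_conv(1)[OF wdc k inO[OF that]] by simp
    have sv: "smooth (conv (v i) (pderivative j \<kappa>))" for i j
      by (intro smooth_conv v test_functions_pderivative kt)
    have iS: "integrable lborel (\<lambda>x. indicator L x * (f x)\<^sup>2)" if "smooth f" "compact L" for f L
      unfolding power2_eq_square using that
      by (intro integrable_indicator_compact smooth_continuous smooth_mult)
    let ?D = "\<lambda>x. pderivative 1 (?w 1) x + pderivative 2 (?w 2) x"
    let ?Dw = "\<lambda>x. (pderivative 1 (?w 1) x)\<^sup>2 + (pderivative 2 (?w 1) x)\<^sup>2 + (pderivative 1 (?w 2) x)\<^sup>2 + (pderivative 2 (?w 2) x)\<^sup>2"
    have "(\<integral>x. indicator S x * (?D x)\<^sup>2 \<partial>lborel)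
      \<le> 2 * (\<integral>x. indicator S x * (conv (v 1) (pderivative 1 \<kappa>) x)\<^sup>2 \<partial>lborel)
       + 2 * (\<integral>x. indicator S x * (conv (v 2) (pderivative 2 \<kappa>) x)\<^sup>2 \<partial>lborel)"
    proof (rule integral_le_linear_combination)
      show "integrable lborel (\<lambda>x. indicator S x * (?D x)\<^sup>2)"
        by (intro iS smooth_add smooth_pderivative sw S)
      show "integrable lborel (\<lambda>x. indicator S x * (conv (v 1) (pderivative 1 \<kappa>) x)\<^sup>2)"
        "integrable lborel (\<lambda>x. indicator S x * (conv (v 2) (pderivative 2 \<kappa>) x)\<^sup>2)"
        by (intro iS sv S)+
      fix x
      have sum_sq: "(a + b)\<^sup>2 \<le> 2 * a\<^sup>2 + 2 * b\<^sup>2" for a b :: real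
        using sum_squares_bound[of a b] by (simp add: power2_sum)
      show "indicator S x * (?D x)\<^sup>2 \<le> 2 * (indicator S x * (conv (v 1) (pderivative 1 \<kappa>) x)\<^sup>2)
         + 2 * (indicator S x * (conv (v 2) (pderivative 2 \<kappa>) x)\<^sup>2)"
        by (cases "x \<in> S") (simp_all add: div sum_sq)
    qed
    also have "\<dots> \<le> 2 * C3 + 2 * C4"
      using conjunct2[OF 3, rule_format, OF mollifier_mono[OF m r(5)]] conjunct2[OF 4, rule_format, OF mollifier_mono[OF m r(6)]] by (simp add: k1 k2)
    finally have d: "(\<integral>x. indicator S x * (?D x)\<^sup>2 \<partial>lborel) \<le> 2 * C3 + 2 * C4" .
    have w1: "(\<integral>x. indicator S x * (?w 1 x)\<^sup>2 \<partial>lborel) \<le> C1"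
      using conjunct2[OF 1, rule_format, OF mollifier_mono[OF m r(3)]] by (simp add: \<kappa>_def)
    have w2: "(\<integral>x. indicator S x * (?w 2 x)\<^sup>2 \<partial>lborel) \<le> C2"
      using conjunct2[OF 2, rule_format, OF mollifier_mono[OF m r(4)]] by (simp add: \<kappa>_def)
    have "(\<integral>x. indicator S x * ((?D x)\<^sup>2 + ((?w 1 x)\<^sup>2 + (?w 2 x)\<^sup>2)) \<partial>lborel)
      = (\<integral>x. indicator S x * (?D x)\<^sup>2 + (indicator S x * (?w 1 x)\<^sup>2 + indicator S x * (?w 2 x)\<^sup>2) \<partial>lborel)"
      by (simp add: distrib_left)
    also have "\<dots> = (\<integral>x. indicator S x * (?D x)\<^sup>2 \<partial>lborel) +
        ((\<integral>x. indicator S x * (?w 1 x)\<^sup>2 \<partial>lborel) + (\<integral>x. indicator S x * (?w 2 x)\<^sup>2 \<partial>lborel))"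
      using iS[OF sw S(1)] iS[OF smooth_add[OF smooth_pderivative[OF sw] smooth_pderivative[OF sw]] S(1)]
      by (subst Bochner_Integration.integral_add; simp)
    also have "\<dots> \<le> 2 * C3 + 2 * C4 + (C1 + C2)" using d w1 w2 by linarith
    finally have tot: "(\<integral>x. indicator S x * ((?D x)\<^sup>2 + ((?w 1 x)\<^sup>2 + (?w 2 x)\<^sup>2)) \<partial>lborel)
       \<le> 2 * C3 + 2 * C4 + (C1 + C2)" .
    have "(\<integral>x. indicator K x * (pderivative j (?w i) x)\<^sup>2 \<partial>lborel) \<le> (\<integral>x. (\<zeta> x)\<^sup>2 * ?Dw x \<partial>lborel)"
    proof (rule integral_mono)
      show "integrable lborel (\<lambda>x. indicator K x * (pderivative j (?w i) x)\<^sup>2)"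
        by (intro iS smooth_pderivative sw K)
      have "(\<lambda>x. (\<zeta> x * \<zeta> x) * (pderivative 1 (?w 1) x * pderivative 1 (?w 1) x + pderivative 2 (?w 1) x * pderivative 2 (?w 1) x
         + pderivative 1 (?w 2) x * pderivative 1 (?w 2) x + pderivative 2 (?w 2) x * pderivative 2 (?w 2) x)) \<in> test_functions UNIV"
        by (intro test_functions_mult[where U=UNIV] \<zeta>t smooth_add smooth_mult smooth_pderivative sw test_functions_smooth[OF \<zeta>t])
      then show "integrable lborel (\<lambda>x. (\<zeta> x)\<^sup>2 * ?Dw x)"
        unfolding power2_eq_square by (rule test_functions_integrable)
      fix x
      have "(pderivative j (?w i) x)\<^sup>2 \<le> ?Dw x"
        using exhaust_2[of i] exhaust_2[of j] by (auto intro: add_nonneg_nonneg)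
      then show "indicator K x * (pderivative j (?w i) x)\<^sup>2 \<le> (\<zeta> x)\<^sup>2 * ?Dw x"
        using \<zeta>(2)[of x] by (cases "x \<in> K") auto
    qed
    also have "\<dots> \<le> C0 * (\<integral>x. indicator S x * ((?D x)\<^sup>2 + ((?w 1 x)\<^sup>2 + (?w 2 x)\<^sup>2)) \<partial>lborel)"
      by (rule conjunct2[OF C0, rule_format, OF sw sw curl])
    also have "\<dots> \<le> C0 * (2 * C3 + 2 * C4 + (C1 + C2))"
      using tot conjunct1[OF C0] by (rule mult_left_mono)
    finally show "(\<integral>x. indicator K x * (conv (p i) (pderivative j (mixed_pderivative a b \<eta>)) x)\<^sup>2 \<partial>lborel)
        \<le> C0 * (2 * C3 + 2 * C4 + (C1 + C2))"
      unfolding dw unfolding \<kappa>_def .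
  qed
qed

text \<open>Induction on the order of the derivative. Order 0 is the \<open>L\<^sup>2\<close> bound for mollifications, and
  each step costs one derivative of \<open>v\<close> and a passage to a larger compact set.\<close>

lemma mollified_derivative_bounded_regularity:
  assumes U: "open U" "U \<subseteq> \<Omega>" and wdc: "weakly_div_curl \<Omega> p v"
    and p: "\<And>i. integrable lborel (p i)" "\<And>i. integrable lborel (\<lambda>x. (p i x)\<^sup>2)"
    and v: "\<And>i. integrable lborel (v i)"
    and bv: "\<And>i a b. a + b \<le> m \<Longrightarrow> mollified_derivative_bounded U a b (v i)"
    and "a + b \<le> m"
  shows "mollified_derivative_bounded U a b (p i)"
proof -
  have "\<forall>a b i. a + b = n \<longrightarrow> n \<le> m \<longrightarrow> mollified_derivative_bounded U a b (p i)" for n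
  proof (induction n)
    case 0
    then show ?case using mollified_derivative_bounded_0[OF U(1) p] by simp
  next
    case (Suc n)
    show ?case
    proof (intro allI impI)
      fix a b i assume ab: "a + b = Suc n" "Suc n \<le> m"
      have step: "\<exists>C. \<exists>r>0. \<forall>\<eta>. mollifier r \<eta> \<longrightarrow> (\<forall>i j.
          (\<integral>x. indicator K x * (conv (p i) (pderivative j (mixed_pderivative a' b' \<eta>)) x)\<^sup>2 \<partial>lborel) \<le> C)"
        if "a' + b' = n" "compact K" "K \<subseteq> U" for a' b' K
        by (rule mollified_gradient_estimate[OF U wdc p(1) v _ _ _ that(2,3)])
           (use Suc.IH that(1) ab bv in auto)
      show "mollified_derivative_bounded U a b (p i)"
        unfolding mollified_derivative_bounded_def
      proof (intro allI impI)
        fix K assume K: "compact K \<and> K \<subseteq> U"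
        show "\<exists>C. \<exists>r>0. \<forall>\<eta>. mollifier r \<eta> \<longrightarrow>
            (\<integral>x. indicator K x * (conv (p i) (mixed_pderivative a b \<eta>) x)\<^sup>2 \<partial>lborel) \<le> C"
        proof (cases a)
          case (Suc a')
          then have "a' + b = n" using ab by simp
          from step[OF this conjunct1[OF K] conjunct2[OF K]] show ?thesis
            unfolding Suc mixed_pderivative_Suc_left by (elim ex_forward conj_forward) simp_all
        next
          case 0
          then have "0 + (b - 1) = n" and b: "b = Suc (b - 1)" using ab by auto
          have eq: "mixed_pderivative a b \<eta> = pderivative 2 (mixed_pderivative 0 (b - 1) \<eta>)"
            if "smooth \<eta>" for \<eta>
            using mixed_pderivative_Suc_right[OF that, of 0 "b - 1"] b 0 by simp
          from step[OF \<open>0 + (b - 1) = n\<close> conjunct1[OF K] conjunct2[OF K]] show ?thesis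
            by (elim ex_forward conj_forward) (simp_all add: eq mollifier_def)
        qed
      qed
    qed
  qed
  then show ?thesis using assms(8) by blast
qed


section \<open>From mollified bounds to weak derivatives\<close>

lemma lebesgue_on_lborel:
  fixes F :: "real ^ 2 \<Rightarrow> real"
  assumes V: "open V" and [measurable]: "F \<in> borel_measurable borel"
  shows "integrable (lebesgue_on V) F \<longleftrightarrow> integrable lborel (\<lambda>x. indicator V x * F x)"
    and "(\<integral>x. F x \<partial>lebesgue_on V) = (\<integral>x. indicator V x * F x \<partial>lborel)"
    and "F \<in> borel_measurable (lebesgue_on V)"
proof -
  have [measurable]: "V \<in> sets borel" using V by simp
  have VL: "V \<inter> space lebesgue \<in> sets lebesgue" using V by simp
  have m: "(\<lambda>x. indicator V x * F x) \<in> borel_measurable lborel" by measurable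
  show "integrable (lebesgue_on V) F \<longleftrightarrow> integrable lborel (\<lambda>x. indicator V x * F x)"
    unfolding integrable_restrict_space[OF VL] using integrable_completion[OF m] by simp
  show "(\<integral>x. F x \<partial>lebesgue_on V) = (\<integral>x. indicator V x * F x \<partial>lborel)"
    unfolding integral_restrict_space[OF VL] using integral_completion[OF m] by simp
  show "F \<in> borel_measurable (lebesgue_on V)"
    by (intro measurable_restrict_space1 measurable_completion) simp
qed

lemma lebesgue_on_lborel_support:
  fixes F :: "real ^ 2 \<Rightarrow> real"
  assumes V: "open V" and F: "F \<in> borel_measurable borel" "\<And>x. x \<notin> V \<Longrightarrow> F x = 0"
  shows "integrable (lebesgue_on V) F \<longleftrightarrow> integrable lborel F"
    and "(\<integral>x. F x \<partial>lebesgue_on V) = (\<integral>x. F x \<partial>lborel)"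
proof -
  have "(\<lambda>x. indicator V x * F x) = F"
  proof
    show "indicator V x * F x = F x" for x by (cases "x \<in> V") (simp_all add: F(2))
  qed
  then show "integrable (lebesgue_on V) F \<longleftrightarrow> integrable lborel F"
    "(\<integral>x. F x \<partial>lebesgue_on V) = (\<integral>x. F x \<partial>lborel)"
    using lebesgue_on_lborel[OF V F(1)] by simp_all
qed

lemma lebesgue_on_subset_integral:
  fixes F :: "real ^ 2 \<Rightarrow> real"
  assumes "open V" "open \<Omega>" "V \<subseteq> \<Omega>" "\<And>x. x \<notin> V \<Longrightarrow> F x = 0"
  shows "(\<integral>x. F x \<partial>lebesgue_on V) = (\<integral>x. F x \<partial>lebesgue_on \<Omega>)"
proof -
  have 1: "(\<lambda>x. indicator V x *\<^sub>R F x) = F"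
  proof
    show "indicator V x *\<^sub>R F x = F x" for x by (cases "x \<in> V") (simp_all add: assms(4))
  qed
  have 2: "(\<lambda>x. indicator \<Omega> x *\<^sub>R F x) = F"
  proof
    show "indicator \<Omega> x *\<^sub>R F x = F x" for x
      using assms(3) by (cases "x \<in> V") (auto simp: assms(4))
  qed
  from 1 2 show ?thesis using assms(1,2) by (simp add: integral_restrict_space)
qed

text \<open>Functions in \<open>L2 \<Omega>\<close> are only Lebesgue measurable, and their values outside \<open>\<Omega>\<close> are meaningless. Convolution
  and Fubini's theorem on the plane call for a Borel function that is integrable there and
  gives the same integrals against Borel functions.\<close>

definition borel_representative :: "(real ^ 2) set \<Rightarrow> (real ^ 2 \<Rightarrow> real) \<Rightarrow> (real ^ 2 \<Rightarrow> real) \<Rightarrow> bool" where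
  "borel_representative \<Omega> f f' \<longleftrightarrow> integrable lborel f' \<and> integrable lborel (\<lambda>x. (f' x)\<^sup>2) \<and>
     (\<forall>h\<in>borel_measurable borel. (\<integral>x. f x * h x \<partial>lebesgue_on \<Omega>) = (\<integral>x. f' x * h x \<partial>lborel))"

lemma borel_representative_exists:
  fixes f :: "real ^ 2 \<Rightarrow> real"
  assumes \<Omega>: "open \<Omega>" "bounded \<Omega>" and f: "f \<in> L2 \<Omega>"
  shows "\<exists>f'. borel_representative \<Omega> f f'"
proof -
  have OL: "\<Omega> \<inter> space lebesgue \<in> sets lebesgue" and [measurable]: "\<Omega> \<in> sets borel" using \<Omega> by auto
  have fm: "(\<lambda>x. indicator \<Omega> x *\<^sub>R f x) \<in> borel_measurable lebesgue"
    using f OL by (simp add: L2_def borel_measurable_restrict_space_iff)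
  then obtain g where [measurable]: "g \<in> borel_measurable lborel"
    and g: "AE x in lborel. indicator \<Omega> x *\<^sub>R f x = g x"
    using completion_ex_borel_measurable_real by blast
  define f' where "f' x = indicator \<Omega> x * g x" for x
  have [measurable]: "f' \<in> borel_measurable borel" unfolding f'_def by measurable
  have ae: "AE x in lebesgue. indicator \<Omega> x *\<^sub>R f x = f' x"
    using AE_completion[OF g] by eventually_elim (auto simp: f'_def indicator_def)
  have eq: "(\<integral>x. f x * h x \<partial>lebesgue_on \<Omega>) = (\<integral>x. f' x * h x \<partial>lborel)"
    if [measurable]: "h \<in> borel_measurable borel" for h
  proof -
    have m: "(\<lambda>x. f' x * h x) \<in> borel_measurable lborel" by measurable
    have hm: "h \<in> borel_measurable lebesgue" by (intro measurable_completion) simp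
    have "(\<integral>x. f x * h x \<partial>lebesgue_on \<Omega>) = (\<integral>x. (indicator \<Omega> x *\<^sub>R f x) * h x \<partial>lebesgue)"
      by (simp add: integral_restrict_space[OF OL] mult.assoc)
    also have "\<dots> = (\<integral>x. f' x * h x \<partial>lebesgue)"
      using ae by (intro integral_cong_AE borel_measurable_times fm hm measurable_completion[OF m]) auto
    also have "\<dots> = (\<integral>x. f' x * h x \<partial>lborel)" by (rule integral_completion[OF m])
    finally show ?thesis .
  qed
  have m2: "(\<lambda>x. (f' x)\<^sup>2) \<in> borel_measurable lborel" by measurable
  have i2: "integrable lborel (\<lambda>x. (f' x)\<^sup>2)"
  proof -
    have "integrable lebesgue (\<lambda>x. indicator \<Omega> x *\<^sub>R (f x)\<^sup>2)"
      using f by (simp add: L2_def integrable_restrict_space[OF OL])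
    moreover have "integrable lebesgue (\<lambda>x. indicator \<Omega> x *\<^sub>R (f x)\<^sup>2) \<longleftrightarrow> integrable lebesgue (\<lambda>x. (f' x)\<^sup>2)"
    proof (rule integrable_cong_AE)
      have "(\<lambda>x. (indicator \<Omega> x *\<^sub>R f x)\<^sup>2) \<in> borel_measurable lebesgue" using fm by measurable
      moreover have "(indicator \<Omega> x *\<^sub>R f x)\<^sup>2 = indicator \<Omega> x *\<^sub>R (f x)\<^sup>2" for x by (simp add: indicator_def)
      ultimately show "(\<lambda>x. indicator \<Omega> x *\<^sub>R (f x)\<^sup>2) \<in> borel_measurable lebesgue" by simp
      show "(\<lambda>x. (f' x)\<^sup>2) \<in> borel_measurable lebesgue" by (rule measurable_completion[OF m2])
      show "AE x in lebesgue. indicator \<Omega> x *\<^sub>R (f x)\<^sup>2 = (f' x)\<^sup>2"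
        using ae by eventually_elim (auto simp: indicator_def split: if_splits)
    qed
    ultimately show ?thesis using integrable_completion[OF m2] by simp
  qed
  have i1: "integrable lborel f'"
  proof (rule Bochner_Integration.integrable_bound)
    have "integrable lborel (indicator \<Omega> :: real^2 \<Rightarrow> real)"
      using \<Omega> by (intro integrable_real_indicator emeasure_bounded_finite) auto
    with i2 show "integrable lborel (\<lambda>x. (f' x)\<^sup>2 + indicator \<Omega> x)" by (rule Bochner_Integration.integrable_add)
    have "\<bar>t\<bar> \<le> t\<^sup>2 + 1" for t :: real
      using sum_squares_bound[of "\<bar>t\<bar>" 1] by (simp add: power2_abs) 
    then show "AE x in lborel. norm (f' x) \<le> norm ((f' x)\<^sup>2 + indicator \<Omega> x)"
      by (intro AE_I2) (simp add: f'_def indicator_def)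
  qed simp
  show ?thesis using i1 i2 eq unfolding borel_representative_def by blast
qed

lemma borel_representative_subset:
  assumes "borel_representative \<Omega> f f'" "open \<Omega>" "open V" "V \<subseteq> \<Omega>"
    and "h \<in> borel_measurable borel" "\<And>x. x \<notin> V \<Longrightarrow> h x = 0"
  shows "(\<integral>x. f x * h x \<partial>lebesgue_on V) = (\<integral>x. f' x * h x \<partial>lborel)"
proof -
  have "(\<integral>x. f x * h x \<partial>lebesgue_on V) = (\<integral>x. f x * h x \<partial>lebesgue_on \<Omega>)"
    using assms(6) by (intro lebesgue_on_subset_integral assms(2-4)) simp
  then show ?thesis using assms(1,5) by (simp add: borel_representative_def)
qed

lemma test_functions_outside: "\<psi> \<in> test_functions U \<Longrightarrow> x \<notin> U \<Longrightarrow> \<psi> x = 0"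
  using test_functions_support[of \<psi> U] by auto

lemma test_functions_measurable: "\<psi> \<in> test_functions U \<Longrightarrow> \<psi> \<in> borel_measurable borel"
  by (intro smooth_measurable test_functions_smooth)

lemma smooth_in_L2:
  assumes "open V" "bounded V" "smooth f"
  shows "f \<in> L2 V"
proof -
  have [measurable]: "V \<in> sets borel" "f \<in> borel_measurable borel"
    using assms(1) smooth_measurable[OF assms(3)] by simp_all
  have "integrable lborel (\<lambda>x. indicator (closure V) x * (f x * f x))"
    using assms by (intro integrable_indicator_compact smooth_continuous smooth_mult) (auto simp: compact_eq_bounded_closed)
  then have "integrable lborel (\<lambda>x. indicator V x * (f x * f x))"
  proof (rule Bochner_Integration.integrable_bound)
    show "AE x in lborel. norm (indicator V x * (f x * f x)) \<le> norm (indicator (closure V) x * (f x * f x))"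
      using closure_subset[of V] by (intro AE_I2) (auto simp: indicator_def)
  qed measurable
  moreover have "(\<lambda>x. f x * f x) \<in> borel_measurable borel" by measurable
  ultimately have "integrable (lebesgue_on V) (\<lambda>x. f x * f x)"
    by (subst lebesgue_on_lborel(1)[OF assms(1)])
  moreover have "f \<in> borel_measurable (lebesgue_on V)"
    by (rule lebesgue_on_lborel(3)[OF assms(1)]) measurable
  ultimately show ?thesis by (simp add: L2_iff)
qed

text \<open>Replace \<open>\<partial>\<^sup>\<alpha>\<psi>\<close> by its mollification, which is uniformly close. Moving the mollifier to
  \<open>f\<close> and integrating by parts leaves the pairing of \<open>\<psi>\<close> with the bounded derivative
  of the mollified \<open>f\<close>.\<close>

lemma mollified_derivative_bounded_imp_functional_bounded:
  assumes f: "integrable lborel f" and b: "mollified_derivative_bounded U a b f"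
    and V: "open V" "compact (closure V)" "closure V \<subseteq> U"
  shows "\<exists>C. \<forall>\<psi>\<in>test_functions V. \<bar>\<integral>x. f x * mixed_pderivative a b \<psi> x \<partial>lborel\<bar> \<le> C * L2_norm V \<psi>"
proof -
  have bV: "bounded V" using V(2) by (meson bounded_subset closure_subset compact_imp_bounded)
  obtain C0 r0 where C0: "r0 > 0 \<and> (\<forall>\<eta>. mollifier r0 \<eta> \<longrightarrow>
        (\<integral>x. indicator (closure V) x * (conv f (mixed_pderivative a b \<eta>) x)\<^sup>2 \<partial>lborel) \<le> C0)"
    using mollified_derivative_boundedD[OF b V(2,3)] by (elim exE) (rule that)
  define N where "N = (\<integral>x. \<bar>f x\<bar> \<partial>lborel)"
  have N: "N \<ge> 0" by (simp add: N_def)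
  show ?thesis
  proof (intro exI[of _ "sqrt C0"] ballI)
    fix \<psi> assume \<psi>: "\<psi> \<in> test_functions V"
    have \<psi>U: "\<psi> \<in> test_functions UNIV" using \<psi> by (rule test_functions_mono) simp
    let ?D = "mixed_pderivative a b \<psi>"
    have D: "?D \<in> test_functions UNIV" using \<psi>U by (rule test_functions_mixed_pderivative)
    have approx: "\<bar>\<integral>x. f x * ?D x \<partial>lborel\<bar> \<le> sqrt C0 * L2_norm V \<psi> + N * e" if e: "e > 0" for e
    proof -
      obtain r1 where r1: "r1 > 0" "\<And>\<eta> y. mollifier r1 \<eta> \<Longrightarrow> \<bar>(\<integral>x. \<eta> (x - y) * ?D x \<partial>lborel) - ?D y\<bar> \<le> e"
        using mollify_test_function_close[OF D e] by blast
      \<comment> \<open>Radius below \<open>r0\<close> for the uniform bound, below \<open>r1\<close> for the approximation of \<open>?D\<close>.\<close>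
      obtain \<eta> where m: "mollifier (min r0 r1) \<eta>" using mollifier_exists[of "min r0 r1"] C0 r1(1) by auto
      note t = mollifier_test_function[OF m]
      let ?M = "\<lambda>y. \<integral>x. \<eta> (x - y) * ?D x \<partial>lborel"
      let ?c = "conv f (mixed_pderivative a b \<eta>)"
      have sc: "smooth ?c" by (intro smooth_conv f test_functions_mixed_pderivative t)
      obtain B where B: "\<And>x. \<bar>?D x\<bar> \<le> B" using test_functions_bounded[OF D] by metis
      have close: "\<bar>?M y - ?D y\<bar> \<le> e" for y
        by (rule r1(2)[OF mollifier_mono[OF m]]) simp
      have Mb: "\<bar>?M y\<bar> \<le> B + e" for y using close[of y] B[of y] by linarith
      have [measurable]: "\<eta> \<in> borel_measurable borel" "?D \<in> borel_measurable borel"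
        using t D by (auto intro: test_functions_measurable)
      have Mm: "?M \<in> borel_measurable lborel" by measurable
      have iM: "integrable lborel (\<lambda>y. f y * ?M y)"
        by (rule integrable_mult_bounded[OF f Mm Mb])
      have iD: "integrable lborel (\<lambda>y. f y * ?D y)" by (rule integrable_mult_test[OF f D])
      have "(\<integral>x. f x * ?D x \<partial>lborel) = (\<integral>x. f x * ?M x \<partial>lborel) - (\<integral>x. f x * (?M x - ?D x) \<partial>lborel)"
        using iM iD by (simp add: right_diff_distrib)
      moreover have "\<bar>\<integral>x. f x * (?M x - ?D x) \<partial>lborel\<bar> \<le> N * e"
      proof -
        have "\<bar>\<integral>x. f x * (?M x - ?D x) \<partial>lborel\<bar> \<le> (\<integral>x. \<bar>f x\<bar> * e \<partial>lborel)"
        proof (rule order_trans[OF integral_abs_bound], rule integral_mono)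
          show "integrable lborel (\<lambda>x. \<bar>f x * (?M x - ?D x)\<bar>)"
            unfolding right_diff_distrib using iM iD by simp
          show "integrable lborel (\<lambda>x. \<bar>f x\<bar> * e)" using f by simp
          show "\<bar>f x * (?M x - ?D x)\<bar> \<le> \<bar>f x\<bar> * e" for x
            unfolding abs_mult using close[of x] by (rule mult_left_mono) simp
        qed
        then show ?thesis by (simp add: N_def)
      qed
      moreover have "\<bar>\<integral>x. f x * ?M x \<partial>lborel\<bar> \<le> sqrt C0 * L2_norm V \<psi>"
      proof -
        have "(\<integral>x. f x * ?M x \<partial>lborel) = (\<integral>x. conv f \<eta> x * ?D x \<partial>lborel)"
          using conv_fubini(2)[OF f t test_functions_measurable[OF D] B] by simp
        moreover have "(\<integral>x. ?c x * \<psi> x \<partial>lborel) = (-1) ^ (a + b) * (\<integral>x. conv f \<eta> x * ?D x \<partial>lborel)"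
          using mixed_integration_by_parts[OF smooth_conv[OF f t] \<psi>U, of a b]
          unfolding mixed_pderivative_conv[OF f t] .
        ultimately have "\<bar>\<integral>x. f x * ?M x \<partial>lborel\<bar> = \<bar>\<integral>x. ?c x * \<psi> x \<partial>lborel\<bar>"
          by (simp add: abs_mult power_abs)
        also have "(\<integral>x. ?c x * \<psi> x \<partial>lborel) = L2_inner V ?c \<psi>"
          using lebesgue_on_lborel_support(2)[OF V(1), of "\<lambda>x. ?c x * \<psi> x"] smooth_measurable[OF sc] test_functions_measurable[OF \<psi>]
            test_functions_outside[OF \<psi>] by (simp add: L2_inner_def)
        also have "\<bar>\<dots>\<bar> \<le> L2_norm V ?c * L2_norm V \<psi>"
          by (intro L2_Cauchy_Schwarz smooth_in_L2 V bV sc test_functions_smooth[OF \<psi>])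
        also have "\<dots> \<le> sqrt C0 * L2_norm V \<psi>"
        proof (rule mult_right_mono)
          have "L2_inner V ?c ?c = (\<integral>x. indicator V x * (?c x * ?c x) \<partial>lborel)"
            using lebesgue_on_lborel(2)[OF V(1), of "\<lambda>x. ?c x * ?c x"] smooth_measurable[OF sc]
            by (simp add: L2_inner_def)
          also have "\<dots> \<le> (\<integral>x. indicator (closure V) x * (?c x * ?c x) \<partial>lborel)"
          proof (rule integral_mono)
            show "integrable lborel (\<lambda>x. indicator V x * (?c x * ?c x))"
              using smooth_in_L2[OF V(1) bV sc] lebesgue_on_lborel(1)[OF V(1), of "\<lambda>x. ?c x * ?c x"] smooth_measurable[OF sc]
              by (simp add: L2_iff)
            show "integrable lborel (\<lambda>x. indicator (closure V) x * (?c x * ?c x))"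
              by (intro integrable_indicator_compact V smooth_continuous smooth_mult sc)
            show "indicator V x * (?c x * ?c x) \<le> indicator (closure V) x * (?c x * ?c x)" for x
              using closure_subset[of V] by (auto simp: indicator_def)
          qed
          also have "\<dots> \<le> C0"
            using conjunct2[OF C0, rule_format, OF mollifier_mono[OF m]] by (simp add: power2_eq_square)
          finally show "L2_norm V ?c \<le> sqrt C0" by (simp add: L2_norm_def)
        qed (rule L2_norm_nonneg)
        finally show ?thesis .
      qed
      ultimately show ?thesis by linarith
    qed
    show "\<bar>\<integral>x. f x * ?D x \<partial>lborel\<bar> \<le> sqrt C0 * L2_norm V \<psi>"
    proof (rule field_le_epsilon)
      fix d :: real assume d: "d > 0"
      \<comment> \<open>The 1 covers the case \<open>N = 0\<close>.\<close>
      have "N * (d / (N + 1)) \<le> d" using N d by (simp add: field_simps)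
      with approx[of "d / (N + 1)"] N d
      show "\<bar>\<integral>x. f x * ?D x \<partial>lborel\<bar> \<le> sqrt C0 * L2_norm V \<psi> + d" by simp
    qed
  qed
qed

text \<open>A weak derivative is a function representing the functional \<open>\<psi> \<mapsto> \<plusminus>\<integral> f \<partial>\<^sup>\<alpha>\<psi>\<close>; once this
  functional is bounded, the Riesz representation theorem supplies such a function.\<close>

lemma weak_derivative_of_mollified_bound:
  assumes \<Omega>: "open \<Omega>" and f: "borel_representative \<Omega> f f'" and b: "mollified_derivative_bounded U a b f'"
    and V: "open V" "compact (closure V)" "closure V \<subseteq> U" "V \<subseteq> \<Omega>"
  shows "\<exists>g\<in>L2 V. has_weak_derivative V a b f g"
proof -
  have f1: "integrable lborel f'" using f by (simp add: borel_representative_def)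
  have bV: "bounded V" using V(2) by (meson bounded_subset closure_subset compact_imp_bounded)
  obtain C where C: "\<forall>\<psi>\<in>test_functions V. \<bar>\<integral>x. f' x * mixed_pderivative a b \<psi> x \<partial>lborel\<bar> \<le> C * L2_norm V \<psi>"
    using mollified_derivative_bounded_imp_functional_bounded[OF f1 b V(1-3)] by (elim exE) (rule that)
  define l where "l \<psi> = (-1) ^ (a + b) * (\<integral>x. f' x * mixed_pderivative a b \<psi> x \<partial>lborel)" for \<psi>
  have i: "integrable lborel (\<lambda>x. f' x * mixed_pderivative a b \<psi> x)" if "\<psi> \<in> test_functions V" for \<psi>
    by (rule integrable_mult_test[OF f1 test_functions_mixed_pderivative[OF that]])
  have mixed_add: "mixed_pderivative a b (\<lambda>x. \<phi> x + \<psi> x) = (\<lambda>x. mixed_pderivative a b \<phi> x + mixed_pderivative a b \<psi> x)"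
    if "smooth \<phi>" "smooth \<psi>" for \<phi> \<psi>
  proof -
    have "(pderivative i ^^ n) (\<lambda>x. \<phi> x + \<psi> x) = (\<lambda>x. (pderivative i ^^ n) \<phi> x + (pderivative i ^^ n) \<psi> x)
       \<and> smooth ((pderivative i ^^ n) \<phi>) \<and> smooth ((pderivative i ^^ n) \<psi>)"
      if "smooth \<phi>" "smooth \<psi>" for i n \<phi> \<psi>
      using that by (induction n) (auto simp: pderivative_smooth_add intro: smooth_pderivative)
    then show ?thesis using that by (simp add: mixed_pderivative_def)
  qed
  have mixed_cmult: "mixed_pderivative a b (\<lambda>x. c * \<psi> x) = (\<lambda>x. c * mixed_pderivative a b \<psi> x)"
    if "smooth \<psi>" for c \<psi>
  proof -
    have "(pderivative i ^^ n) (\<lambda>x. c * \<psi> x) = (\<lambda>x. c * (pderivative i ^^ n) \<psi> x)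
       \<and> smooth ((pderivative i ^^ n) \<psi>)"
      if "smooth \<psi>" for i n \<psi>
      using that by (induction n) (auto simp: pderivative_smooth_cmult intro: smooth_pderivative)
    then show ?thesis using that by (simp add: mixed_pderivative_def)
  qed
  have "V \<in> lmeasurable" using V(1) bV by (simp add: lmeasurable_open)
  then obtain g where g: "g \<in> L2_closure V (test_functions V)"
    "\<And>\<psi>. \<psi> \<in> test_functions V \<Longrightarrow> L2_inner V g \<psi> = l \<psi>"
  proof (rule riesz_representation_L2_closure[of V "test_functions V" l C])
    show "test_functions V \<subseteq> L2 V" using V(1) bV by (auto intro!: smooth_in_L2 test_functions_smooth)
    show "test_functions V \<noteq> {}"
      using test_functionsI[of "\<lambda>_. 0" "{}" V] by (auto simp: smooth_const)
    show "\<bar>l \<psi>\<bar> \<le> C * L2_norm V \<psi>" if "\<psi> \<in> test_functions V" for \<psi>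
      using C that by (simp add: l_def abs_mult power_abs)
    show "l (\<lambda>x. \<phi> x + \<psi> x) = l \<phi> + l \<psi>" if "\<phi> \<in> test_functions V" "\<psi> \<in> test_functions V" for \<phi> \<psi>
      using that i by (simp add: l_def mixed_add test_functions_smooth distrib_left)
    show "l (\<lambda>x. c *\<^sub>R \<psi> x) = c * l \<psi>" if "\<psi> \<in> test_functions V" for c \<psi>
      using that by (simp add: l_def mixed_cmult test_functions_smooth mult.left_commute[of _ c])
  qed (auto intro: test_functions_add test_functions_cmult)
  show ?thesis
  proof (intro bexI[of _ g])
    show "g \<in> L2 V" using g(1) by (simp add: L2_closure_def)
    show "has_weak_derivative V a b f g"
      unfolding has_weak_derivative_def
    proof
      fix \<psi> assume \<psi>: "\<psi> \<in> test_functions V"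
      note D = test_functions_mixed_pderivative[OF \<psi>, of a b]
      have "(\<integral>x. f x * mixed_pderivative a b \<psi> x \<partial>lebesgue_on V) = (\<integral>x. f' x * mixed_pderivative a b \<psi> x \<partial>lborel)"
        by (rule borel_representative_subset[OF f \<Omega> V(1,4) test_functions_measurable[OF D] test_functions_outside[OF D]])
      also have "\<dots> = (-1) ^ (a + b) * l \<psi>" by (simp add: l_def)
      also have "l \<psi> = (\<integral>x. g x * \<psi> x \<partial>lebesgue_on V)" using g(2)[OF \<psi>] by (simp add: L2_inner_def)
      finally show "(\<integral>x. f x * mixed_pderivative a b \<psi> x \<partial>lebesgue_on V)
         = (-1) ^ (a + b) * (\<integral>x. g x * \<psi> x \<partial>lebesgue_on V)" .
    qed
  qed
qed


section \<open>Projections onto gradients\<close>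

lemma has_weak_derivative_add:
  assumes V: "open V" "bounded V" and L: "f1 \<in> L2 V" "f2 \<in> L2 V" "g1 \<in> L2 V" "g2 \<in> L2 V"
    and d: "has_weak_derivative V a b f1 g1" "has_weak_derivative V a b f2 g2"
  shows "has_weak_derivative V a b (\<lambda>x. f1 x + f2 x) (\<lambda>x. g1 x + g2 x)"
  unfolding has_weak_derivative_def
proof
  fix \<psi> assume \<psi>: "\<psi> \<in> test_functions V"
  have i: "integrable (lebesgue_on V) (\<lambda>x. f x * \<phi> x)" if "f \<in> L2 V" "smooth \<phi>" for f \<phi>
    using L2_inner_integrable[OF that(1) smooth_in_L2[OF V that(2)]] by simp
  have s: "smooth \<psi>" "smooth (mixed_pderivative a b \<psi>)"
    using \<psi> by (auto intro: test_functions_smooth smooth_mixed_pderivative)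
  show "(\<integral>x. (f1 x + f2 x) * mixed_pderivative a b \<psi> x \<partial>lebesgue_on V) =
      (-1) ^ (a + b) * (\<integral>x. (g1 x + g2 x) * \<psi> x \<partial>lebesgue_on V)"
    using d \<psi> i[OF L(1) s(2)] i[OF L(2) s(2)] i[OF L(3) s(1)] i[OF L(4) s(1)]
    by (simp add: has_weak_derivative_def distrib_right distrib_left)
qed

lemma has_weak_derivative_scaleR:
  assumes "has_weak_derivative V a b f g"
  shows "has_weak_derivative V a b (\<lambda>x. c *\<^sub>R f x) (\<lambda>x. c *\<^sub>R g x)"
  using assms by (simp add: has_weak_derivative_def mult.assoc mult.left_commute[of _ c])

lemma Sobolev_add:
  assumes V: "open V" "bounded V" and "f1 \<in> Sobolev m V" "f2 \<in> Sobolev m V"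
  shows "(\<lambda>x. f1 x + f2 x) \<in> Sobolev m V"
  unfolding Sobolev_def
proof (intro CollectI conjI allI impI)
  have L: "f1 \<in> L2 V" "f2 \<in> L2 V" using assms by (auto simp: Sobolev_def)
  then show "(\<lambda>x. f1 x + f2 x) \<in> L2 V" by (rule L2_add)
  fix a b assume "a + b \<le> m"
  then obtain g1 g2 where "g1 \<in> L2 V" "has_weak_derivative V a b f1 g1"
    "g2 \<in> L2 V" "has_weak_derivative V a b f2 g2"
    using assms(3,4) unfolding Sobolev_def by blast
  then show "\<exists>g\<in>L2 V. has_weak_derivative V a b (\<lambda>x. f1 x + f2 x) g"
    by (intro bexI[of _ "\<lambda>x. g1 x + g2 x"] has_weak_derivative_add V L L2_add)
qed

lemma Sobolev_scaleR:
  assumes "f \<in> Sobolev m V" shows "(\<lambda>x. c *\<^sub>R f x) \<in> Sobolev m V"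
  using assms unfolding Sobolev_def by (blast intro: L2_scaleR has_weak_derivative_scaleR)

lemma L2_subset:
  assumes f: "f \<in> L2 \<Omega>" and V: "open V" "open \<Omega>" "V \<subseteq> \<Omega>"
  shows "f \<in> L2 V"
proof -
  have "lebesgue_on V = restrict_space (lebesgue_on \<Omega>) V"
    using V by (simp add: restrict_restrict_space Int_absorb1)
  moreover have "V \<inter> space (lebesgue_on \<Omega>) \<in> sets (lebesgue_on \<Omega>)"
    using V by (auto simp: sets_restrict_space image_iff intro!: exI[of _ V] bexI[of _ V])
  moreover have "integrable (restrict_space (lebesgue_on \<Omega>) V) g"
    if "integrable (lebesgue_on \<Omega>) g" "V \<inter> space (lebesgue_on \<Omega>) \<in> sets (lebesgue_on \<Omega>)" for g :: "real^2 \<Rightarrow> real"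
    using that integrable_mult_indicator[of "V \<inter> space (lebesgue_on \<Omega>)" "lebesgue_on \<Omega>" g] V(3)
    by (simp add: integrable_restrict_space Int_absorb2)
  ultimately show ?thesis
    using f by (auto simp: L2_def intro: measurable_restrict_space1)
qed

lemma L2_component:
  fixes w :: "real ^ 2 \<Rightarrow> real ^ 2"
  assumes "w \<in> L2 \<Omega>" shows "(\<lambda>x. w x $ i) \<in> L2 \<Omega>"
proof -
  have "(\<lambda>y::real^2. y $ i) \<in> borel_measurable borel"
    by (intro borel_measurable_continuous_onI continuous_intros)
  moreover have "w \<in> borel_measurable (lebesgue_on \<Omega>)" using assms by (simp add: L2_def)
  ultimately have m: "(\<lambda>x. w x $ i) \<in> borel_measurable (lebesgue_on \<Omega>)"
    by (rule measurable_compose[rotated])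
  have "integrable (lebesgue_on \<Omega>) (\<lambda>x. (norm (w x $ i))\<^sup>2)"
  proof (rule Bochner_Integration.integrable_bound)
    show "integrable (lebesgue_on \<Omega>) (\<lambda>x. (norm (w x))\<^sup>2)" using assms by (simp add: L2_def)
    have "(norm (w x $ i))\<^sup>2 \<le> (norm (w x))\<^sup>2" for x
      by (rule power_mono) (simp_all add: component_le_norm_cart)
    then show "AE x in lebesgue_on \<Omega>. norm ((norm (w x $ i))\<^sup>2) \<le> norm ((norm (w x))\<^sup>2)"
      by simp
    show "(\<lambda>x. (norm (w x $ i))\<^sup>2) \<in> borel_measurable (lebesgue_on \<Omega>)"
      by (rule borel_measurable_power[OF measurable_compose[OF m borel_measurable_norm]])
  qed
  then show ?thesis using m by (simp add: L2_def)
qed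

lemma L2_vec_lambda:
  fixes w :: "real ^ 2 \<Rightarrow> real ^ 2"
  assumes "\<And>i. (\<lambda>x. w x $ i) \<in> L2 \<Omega>" shows "w \<in> L2 \<Omega>"
proof -
  have "(\<lambda>x. w x $ i) \<in> borel_measurable (lebesgue_on \<Omega>)" for i
    using assms by (simp add: L2_def)
  then have "w \<in> borel_measurable (lebesgue_on \<Omega>)"
    by (subst borel_measurable_euclidean_space) (auto simp: Basis_vec_def inner_axis)
  moreover have "integrable (lebesgue_on \<Omega>) (\<lambda>x. w x \<bullet> w x)"
    unfolding inner_vec_def by (rule Bochner_Integration.integrable_sum) (rule L2_inner_integrable[OF assms assms])
  ultimately show ?thesis by (simp add: L2_iff)
qed

lemma L2_inner_components:
  fixes v w :: "real ^ 2 \<Rightarrow> real ^ 2"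
  assumes "v \<in> L2 \<Omega>" "w \<in> L2 \<Omega>"
  shows "L2_inner \<Omega> v w = (\<integral>x. v x $ 1 * w x $ 1 \<partial>lebesgue_on \<Omega>) + (\<integral>x. v x $ 2 * w x $ 2 \<partial>lebesgue_on \<Omega>)"
proof -
  have "integrable (lebesgue_on \<Omega>) (\<lambda>x. v x $ i * w x $ i)" for i
    using L2_inner_integrable[OF L2_component[OF assms(1)] L2_component[OF assms(2)]] by simp
  then show ?thesis by (simp add: L2_inner_def inner_vec_def sum_2)
qed

lemma gradient_component: "gradient f x $ i = pderivative i f x"
  by (simp add: gradient_def)

lemma gradient_in_L2:
  assumes "open \<Omega>" "bounded \<Omega>" "smooth \<psi>" shows "gradient \<psi> \<in> L2 \<Omega>"
  by (rule L2_vec_lambda) (simp add: gradient_component smooth_in_L2 smooth_pderivative assms)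

lemma test_function_weak_derivative:
  assumes \<Omega>: "open \<Omega>" and \<psi>: "\<psi> \<in> test_functions \<Omega>"
  shows "has_weak_derivative \<Omega> a b \<psi> (mixed_pderivative a b \<psi>)"
  unfolding has_weak_derivative_def
proof
  fix \<phi> assume \<phi>: "\<phi> \<in> test_functions \<Omega>"
  have t: "(\<lambda>x. f x * g x) \<in> borel_measurable borel" "x \<notin> \<Omega> \<Longrightarrow> f x * g x = 0"
    if "f \<in> test_functions \<Omega>" "g \<in> test_functions \<Omega>" for f g x
    using test_functions_measurable[OF test_functions_mult_test[OF that]] test_functions_outside[OF that(1)] by simp_all
  have D: "mixed_pderivative a b f \<in> test_functions \<Omega>" if "f \<in> test_functions \<Omega>" for f
    using that by (rule test_functions_mixed_pderivative)
  have "(\<integral>x. \<psi> x * mixed_pderivative a b \<phi> x \<partial>lebesgue_on \<Omega>) = (\<integral>x. \<psi> x * mixed_pderivative a b \<phi> x \<partial>lborel)"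
    by (intro lebesgue_on_lborel_support \<Omega> t D \<psi> \<phi>)
  also have "\<dots> = (-1) ^ (a + b) * (\<integral>x. mixed_pderivative a b \<psi> x * \<phi> x \<partial>lborel)"
    using mixed_integration_by_parts[OF test_functions_smooth[OF \<psi>] test_functions_mono[OF \<phi> subset_UNIV]]
    by simp
  also have "(\<integral>x. mixed_pderivative a b \<psi> x * \<phi> x \<partial>lborel) = (\<integral>x. mixed_pderivative a b \<psi> x * \<phi> x \<partial>lebesgue_on \<Omega>)"
    by (intro lebesgue_on_lborel_support[symmetric] \<Omega> t D \<psi> \<phi>)
  finally show "(\<integral>x. \<psi> x * mixed_pderivative a b \<phi> x \<partial>lebesgue_on \<Omega>) =
      (-1) ^ (a + b) * (\<integral>x. mixed_pderivative a b \<psi> x * \<phi> x \<partial>lebesgue_on \<Omega>)" .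
qed

lemma test_function_weak_gradient:
  assumes "open \<Omega>" "\<psi> \<in> test_functions \<Omega>"
  shows "has_weak_gradient \<Omega> \<psi> (gradient \<psi>)"
  using test_function_weak_derivative[OF assms, of 1 0] test_function_weak_derivative[OF assms, of 0 1]
  by (simp add: has_weak_gradient_def gradient_component mixed_pderivative_1_0[unfolded One_nat_def]
      mixed_pderivative_0_1[unfolded One_nat_def])

lemma gradient_test_function_in_G0:
  assumes \<Omega>: "open \<Omega>" "bounded \<Omega>" and \<psi>: "\<psi> \<in> test_functions \<Omega>"
  shows "gradient \<psi> \<in> G0 \<Omega>"
proof -
  have s: "smooth \<psi>" using \<psi> by (rule test_functions_smooth)
  have "\<psi> \<in> Sobolev 1 \<Omega>"
    unfolding Sobolev_def
    using smooth_in_L2[OF \<Omega> s] smooth_in_L2[OF \<Omega> smooth_mixed_pderivative[OF s]]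
      test_function_weak_derivative[OF \<Omega>(1) \<psi>] by blast
  moreover have "(L2_norm \<Omega> (\<lambda>x. \<psi> x - \<psi> x))\<^sup>2 + (L2_norm \<Omega> (\<lambda>x. gradient \<psi> x - gradient \<psi> x))\<^sup>2 < \<epsilon>\<^sup>2"
    if "\<epsilon> > 0" for \<epsilon>
    using that by (simp add: L2_norm_def L2_inner_def)
  ultimately have "\<psi> \<in> Sobolev10 \<Omega>"
    unfolding Sobolev10_def using gradient_in_L2[OF \<Omega> s] test_function_weak_gradient[OF \<Omega>(1) \<psi>] \<psi> by blast
  then show ?thesis
    unfolding G0_def using gradient_in_L2[OF \<Omega> s] test_function_weak_gradient[OF \<Omega>(1) \<psi>] by blast
qed

lemma G0_subset_G: "G0 \<Omega> \<subseteq> G \<Omega>"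
  by (auto simp: G0_def G_def Sobolev10_def)

lemma has_weak_gradient_add:
  assumes V: "open V" "bounded V" and L: "f1 \<in> L2 V" "f2 \<in> L2 V" "w1 \<in> L2 V" "w2 \<in> L2 V"
    and d: "has_weak_gradient V f1 w1" "has_weak_gradient V f2 w2"
  shows "has_weak_gradient V (\<lambda>x. f1 x + f2 x) (\<lambda>x. w1 x + w2 x)"
  using d has_weak_derivative_add[OF V L(1,2) L2_component[OF L(3)] L2_component[OF L(4)]]
  by (simp add: has_weak_gradient_def)

lemma has_weak_gradient_scaleR:
  "has_weak_gradient V f w \<Longrightarrow> has_weak_gradient V (\<lambda>x. c *\<^sub>R f x) (\<lambda>x. c *\<^sub>R w x)"
  unfolding has_weak_gradient_def using has_weak_derivative_scaleR[where c=c]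
  by (auto simp del: real_scaleR_def simp: vector_scaleR_component)

lemma G_add:
  assumes \<Omega>: "open \<Omega>" "bounded \<Omega>" and "w1 \<in> G \<Omega>" "w2 \<in> G \<Omega>"
  shows "(\<lambda>x. w1 x + w2 x) \<in> G \<Omega>"
proof -
  obtain f1 f2 where f: "f1 \<in> Sobolev 1 \<Omega>" "has_weak_gradient \<Omega> f1 w1" "f2 \<in> Sobolev 1 \<Omega>" "has_weak_gradient \<Omega> f2 w2"
    using assms by (auto simp: G_def)
  moreover have "f1 \<in> L2 \<Omega>" "f2 \<in> L2 \<Omega>" "w1 \<in> L2 \<Omega>" "w2 \<in> L2 \<Omega>"
    using f assms by (auto simp: G_def Sobolev_def)
  ultimately show ?thesis unfolding G_def
    by (blast intro: L2_add Sobolev_add[OF \<Omega>] has_weak_gradient_add[OF \<Omega>])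
qed

lemma G_scaleR: "w \<in> G \<Omega> \<Longrightarrow> (\<lambda>x. c *\<^sub>R w x) \<in> G \<Omega>"
  unfolding G_def by (blast intro: L2_scaleR Sobolev_scaleR has_weak_gradient_scaleR)

lemma L2_norm_add_square_le:
  assumes "v \<in> L2 \<Omega>" "w \<in> L2 \<Omega>"
  shows "(L2_norm \<Omega> (\<lambda>x. v x + w x))\<^sup>2 \<le> 2 * (L2_norm \<Omega> v)\<^sup>2 + 2 * (L2_norm \<Omega> w)\<^sup>2"
proof -
  have "0 \<le> L2_inner \<Omega> v v - 2 * L2_inner \<Omega> v w + L2_inner \<Omega> w w"
    using L2_inner_self_add_scaleR[OF assms, of "-1"] L2_inner_self_nonneg[of \<Omega> "\<lambda>x. v x + (-1) *\<^sub>R w x"] by simp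
  then show ?thesis using L2_inner_self_add_scaleR[OF assms, of 1] by (simp add: L2_norm_power2)
qed

lemma L2_norm_scaleR_square: "(L2_norm \<Omega> (\<lambda>x. c *\<^sub>R v x))\<^sup>2 = c\<^sup>2 * (L2_norm \<Omega> v)\<^sup>2"
  unfolding L2_norm_power2 by (simp add: L2_inner_def power2_eq_square mult.assoc)

lemma gradient_add: "smooth f \<Longrightarrow> smooth g \<Longrightarrow> gradient (\<lambda>x. f x + g x) = (\<lambda>x. gradient f x + gradient g x)"
  by (auto simp: vec_eq_iff gradient_component pderivative_smooth_add)

lemma gradient_cmult: "smooth f \<Longrightarrow> gradient (\<lambda>x. c * f x) = (\<lambda>x. c *\<^sub>R gradient f x)"
  by (auto simp: vec_eq_iff gradient_component pderivative_smooth_cmult)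

lemma Sobolev10_add:
  assumes \<Omega>: "open \<Omega>" "bounded \<Omega>" and "f1 \<in> Sobolev10 \<Omega>" "f2 \<in> Sobolev10 \<Omega>"
  shows "(\<lambda>x. f1 x + f2 x) \<in> Sobolev10 \<Omega>"
proof -
  let ?E = "\<lambda>f w \<psi>. (L2_norm \<Omega> (\<lambda>x. f x - \<psi> x))\<^sup>2 + (L2_norm \<Omega> (\<lambda>x. w x - gradient \<psi> x))\<^sup>2"
  obtain w1 where 1: "w1 \<in> L2 \<Omega>" "has_weak_gradient \<Omega> f1 w1" "\<forall>\<epsilon>>0. \<exists>\<psi>\<in>test_functions \<Omega>. ?E f1 w1 \<psi> < \<epsilon>\<^sup>2"
    using assms(3) unfolding Sobolev10_def by blast
  obtain w2 where 2: "w2 \<in> L2 \<Omega>" "has_weak_gradient \<Omega> f2 w2" "\<forall>\<epsilon>>0. \<exists>\<psi>\<in>test_functions \<Omega>. ?E f2 w2 \<psi> < \<epsilon>\<^sup>2"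
    using assms(4) unfolding Sobolev10_def by blast
  have S: "f1 \<in> Sobolev 1 \<Omega>" "f2 \<in> Sobolev 1 \<Omega>" using assms by (auto simp: Sobolev10_def)
  then have L: "f1 \<in> L2 \<Omega>" "f2 \<in> L2 \<Omega>" by (auto simp: Sobolev_def)
  have "\<exists>\<psi>\<in>test_functions \<Omega>. ?E (\<lambda>x. f1 x + f2 x) (\<lambda>x. w1 x + w2 x) \<psi> < \<epsilon>\<^sup>2" if e: "\<epsilon> > 0" for \<epsilon>
  proof -
    \<comment> \<open>Squared norms of sums cost a factor 2, and \<open>2 (\<epsilon>/2)\<^sup>2 + 2 (\<epsilon>/2)\<^sup>2 = \<epsilon>\<^sup>2\<close>.\<close>
    have e2: "\<epsilon> / 2 > 0" using e by simp
    obtain \<psi>1 where p1: "\<psi>1 \<in> test_functions \<Omega>" "?E f1 w1 \<psi>1 < (\<epsilon>/2)\<^sup>2"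
      using 1(3)[rule_format, OF e2] by (elim bexE) (rule that)
    obtain \<psi>2 where p2: "\<psi>2 \<in> test_functions \<Omega>" "?E f2 w2 \<psi>2 < (\<epsilon>/2)\<^sup>2"
      using 2(3)[rule_format, OF e2] by (elim bexE) (rule that)
    have s: "smooth \<psi>1" "smooth \<psi>2" using p1 p2 by (auto intro: test_functions_smooth)
    have "(L2_norm \<Omega> (\<lambda>x. (f1 x - \<psi>1 x) + (f2 x - \<psi>2 x)))\<^sup>2
        \<le> 2 * (L2_norm \<Omega> (\<lambda>x. f1 x - \<psi>1 x))\<^sup>2 + 2 * (L2_norm \<Omega> (\<lambda>x. f2 x - \<psi>2 x))\<^sup>2"
      by (intro L2_norm_add_square_le L2_diff L smooth_in_L2 \<Omega> s)
    moreover have "(L2_norm \<Omega> (\<lambda>x. (w1 x - gradient \<psi>1 x) + (w2 x - gradient \<psi>2 x)))\<^sup>2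
        \<le> 2 * (L2_norm \<Omega> (\<lambda>x. w1 x - gradient \<psi>1 x))\<^sup>2 + 2 * (L2_norm \<Omega> (\<lambda>x. w2 x - gradient \<psi>2 x))\<^sup>2"
      by (intro L2_norm_add_square_le L2_diff 1 2 gradient_in_L2 \<Omega> s)
    ultimately have "?E (\<lambda>x. f1 x + f2 x) (\<lambda>x. w1 x + w2 x) (\<lambda>x. \<psi>1 x + \<psi>2 x) \<le> 2 * ?E f1 w1 \<psi>1 + 2 * ?E f2 w2 \<psi>2"
      by (simp add: gradient_add s add_diff_add)
    also have "\<dots> < \<epsilon>\<^sup>2" using p1(2) p2(2) by (simp add: power_divide)
    finally show ?thesis by (intro bexI[of _ "\<lambda>x. \<psi>1 x + \<psi>2 x"] test_functions_add p1 p2)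
  qed
  moreover have "has_weak_gradient \<Omega> (\<lambda>x. f1 x + f2 x) (\<lambda>x. w1 x + w2 x)"
    by (intro has_weak_gradient_add \<Omega> L 1 2)
  ultimately show ?thesis
    unfolding Sobolev10_def using Sobolev_add[OF \<Omega> S] L2_add[OF 1(1) 2(1)] by blast
qed

lemma Sobolev10_scaleR:
  assumes f: "f \<in> Sobolev10 \<Omega>"
  shows "(\<lambda>x. c *\<^sub>R f x) \<in> Sobolev10 \<Omega>"
proof -
  let ?E = "\<lambda>f w \<psi>. (L2_norm \<Omega> (\<lambda>x. f x - \<psi> x))\<^sup>2 + (L2_norm \<Omega> (\<lambda>x. w x - gradient \<psi> x))\<^sup>2"
  obtain w where w: "w \<in> L2 \<Omega>" "has_weak_gradient \<Omega> f w" "\<forall>\<epsilon>>0. \<exists>\<psi>\<in>test_functions \<Omega>. ?E f w \<psi> < \<epsilon>\<^sup>2"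
    using assms unfolding Sobolev10_def by blast
  have "\<exists>\<psi>\<in>test_functions \<Omega>. ?E (\<lambda>x. c *\<^sub>R f x) (\<lambda>x. c *\<^sub>R w x) \<psi> < \<epsilon>\<^sup>2" if "\<epsilon> > 0" for \<epsilon>
  proof -
    have e: "\<epsilon> / (\<bar>c\<bar> + 1) > 0" using that by simp
    obtain \<psi> where p: "\<psi> \<in> test_functions \<Omega>" "?E f w \<psi> < (\<epsilon> / (\<bar>c\<bar> + 1))\<^sup>2"
      using w(3)[rule_format, OF e] by (elim bexE) (rule that)
    have "?E (\<lambda>x. c *\<^sub>R f x) (\<lambda>x. c *\<^sub>R w x) (\<lambda>x. c * \<psi> x) = c\<^sup>2 * ?E f w \<psi>"
      using L2_norm_scaleR_square[of \<Omega> c "\<lambda>x. f x - \<psi> x"] L2_norm_scaleR_square[of \<Omega> c "\<lambda>x. w x - gradient \<psi> x"]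
      by (simp add: gradient_cmult test_functions_smooth[OF p(1)] algebra_simps)
    also have "\<dots> \<le> (\<bar>c\<bar> + 1)\<^sup>2 * ?E f w \<psi>"
      by (intro mult_right_mono) (auto simp: power2_eq_square algebra_simps)
    also have "\<dots> < (\<bar>c\<bar> + 1)\<^sup>2 * (\<epsilon> / (\<bar>c\<bar> + 1))\<^sup>2"
      by (intro mult_strict_left_mono p) (auto intro!: zero_less_power)
    also have "\<dots> = \<epsilon>\<^sup>2" by (simp add: power_divide)
    finally show ?thesis by (intro bexI[of _ "\<lambda>x. c * \<psi> x"] test_functions_cmult p)
  qed
  moreover have "(\<lambda>x. c *\<^sub>R f x) \<in> Sobolev 1 \<Omega>" using f Sobolev_scaleR unfolding Sobolev10_def by blast
  ultimately show ?thesis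
    unfolding Sobolev10_def using has_weak_gradient_scaleR[OF w(2), of c] L2_scaleR[OF w(1), of c] by blast
qed

lemma G0_add:
  assumes \<Omega>: "open \<Omega>" "bounded \<Omega>" and "w1 \<in> G0 \<Omega>" "w2 \<in> G0 \<Omega>"
  shows "(\<lambda>x. w1 x + w2 x) \<in> G0 \<Omega>"
proof -
  obtain f1 f2 where f: "f1 \<in> Sobolev10 \<Omega>" "has_weak_gradient \<Omega> f1 w1" "f2 \<in> Sobolev10 \<Omega>" "has_weak_gradient \<Omega> f2 w2"
    using assms by (auto simp: G0_def)
  moreover have "f1 \<in> L2 \<Omega>" "f2 \<in> L2 \<Omega>" "w1 \<in> L2 \<Omega>" "w2 \<in> L2 \<Omega>"
    using f assms by (auto simp: G0_def Sobolev10_def Sobolev_def)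
  ultimately show ?thesis unfolding G0_def
    by (blast intro: L2_add Sobolev10_add[OF \<Omega>] has_weak_gradient_add[OF \<Omega>])
qed

lemma G0_scaleR: "w \<in> G0 \<Omega> \<Longrightarrow> (\<lambda>x. c *\<^sub>R w x) \<in> G0 \<Omega>"
  unfolding G0_def by (blast intro: L2_scaleR Sobolev10_scaleR has_weak_gradient_scaleR)

text \<open>This is what makes the choice in the definition of \<open>orth_proj\<close> meaningful: the projection
  exists for every linear subspace.\<close>

lemma orth_proj_characterization:
  assumes \<Omega>: "\<Omega> \<in> lmeasurable" and S: "S \<subseteq> L2 \<Omega>" "S \<noteq> {}"
    and S_add: "\<And>v w. v \<in> S \<Longrightarrow> w \<in> S \<Longrightarrow> (\<lambda>x. v x + w x) \<in> S"
    and S_scaleR: "\<And>c v. v \<in> S \<Longrightarrow> (\<lambda>x. c *\<^sub>R v x) \<in> S"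
    and v: "v \<in> L2 \<Omega>"
  shows "orth_proj \<Omega> S v \<in> L2_closure \<Omega> S \<and> (\<forall>w\<in>S. L2_inner \<Omega> (\<lambda>x. v x - orth_proj \<Omega> S v x) w = 0)"
proof -
  note SL = subsetD[OF S(1)]
  have "\<exists>p. p \<in> L2_closure \<Omega> S \<and> (\<forall>w\<in>S. L2_inner \<Omega> (\<lambda>x. v x - p x) w = 0)"
  proof (rule riesz_representation_L2_closure[OF \<Omega> S S_add S_scaleR, of "L2_inner \<Omega> v" "L2_norm \<Omega> v"])
    show "L2_inner \<Omega> v (\<lambda>x. f x + g x) = L2_inner \<Omega> v f + L2_inner \<Omega> v g" if "f \<in> S" "g \<in> S" for f g
      using L2_inner_add_left[OF SL[OF that(1)] SL[OF that(2)] v] by (simp only: L2_inner_commute[of \<Omega> v])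
    show "L2_inner \<Omega> v (\<lambda>x. c *\<^sub>R f x) = c * L2_inner \<Omega> v f" for c f
      using L2_inner_scaleR_left[of \<Omega> c f v] by (simp only: L2_inner_commute[of \<Omega> v])
    show "\<bar>L2_inner \<Omega> v f\<bar> \<le> L2_norm \<Omega> v * L2_norm \<Omega> f" if "f \<in> S" for f
      by (rule L2_Cauchy_Schwarz[OF v SL[OF that]])
    fix p assume p: "p \<in> L2_closure \<Omega> S" "\<And>w. w \<in> S \<Longrightarrow> L2_inner \<Omega> p w = L2_inner \<Omega> v w"
    have "p \<in> L2 \<Omega>" using p(1) by (simp add: L2_closure_def)
    then have "\<forall>w\<in>S. L2_inner \<Omega> (\<lambda>x. v x - p x) w = 0"
      using p(2) by (simp add: L2_inner_diff_left[OF v] SL)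
    with p(1) show ?thesis by blast
  qed
  then show ?thesis unfolding orth_proj_def by (rule someI_ex)
qed

lemma L2_inner_closure_zero:
  assumes p: "p \<in> L2_closure \<Omega> S" and S: "S \<subseteq> L2 \<Omega>" and r: "r \<in> L2 \<Omega>"
    and z: "\<And>w. w \<in> S \<Longrightarrow> L2_inner \<Omega> w r = 0"
  shows "L2_inner \<Omega> p r = 0"
proof -
  have pL: "p \<in> L2 \<Omega>" using p by (simp add: L2_closure_def)
  have "\<bar>L2_inner \<Omega> p r\<bar> \<le> 0 + d" if d: "d > 0" for d
  proof -
    let ?N = "L2_norm \<Omega> r"
    have "d / (?N + 1) > 0" using d L2_norm_nonneg[of \<Omega> r] by (intro divide_pos_pos) auto
    then obtain w where w: "w \<in> S" "L2_norm \<Omega> (\<lambda>x. p x - w x) < d / (?N + 1)"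
      using p unfolding L2_closure_def by blast
    have wL: "w \<in> L2 \<Omega>" using w S by auto
    have "L2_inner \<Omega> p r = L2_inner \<Omega> (\<lambda>x. p x - w x) r"
      using z[OF w(1)] by (simp add: L2_inner_diff_left[OF pL wL r])
    also have "\<bar>\<dots>\<bar> \<le> L2_norm \<Omega> (\<lambda>x. p x - w x) * ?N"
      by (intro L2_Cauchy_Schwarz L2_diff pL wL r)
    also have "\<dots> \<le> d / (?N + 1) * ?N" using w(2) by (intro mult_right_mono L2_norm_nonneg) simp
    also have "\<dots> \<le> d" using d L2_norm_nonneg[of \<Omega> r] by (simp add: field_simps)
    finally show ?thesis by simp
  qed
  then have "\<bar>L2_inner \<Omega> p r\<bar> \<le> 0" by (rule field_le_epsilon)
  then show ?thesis by simp
qed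

text \<open>Pairing a field with the gradient turned by a right angle tests its curl.\<close>

definition rotated_gradient :: "(real ^ 2 \<Rightarrow> real) \<Rightarrow> real ^ 2 \<Rightarrow> real ^ 2" where
  "rotated_gradient f x = (\<chi> i. if i = 1 then pderivative 2 f x else - pderivative 1 f x)"

lemma rotated_gradient_component:
  "rotated_gradient f x $ 1 = pderivative 2 f x" "rotated_gradient f x $ 2 = - pderivative 1 f x"
  by (simp_all add: rotated_gradient_def)

lemma rotated_gradient_in_L2:
  assumes "open \<Omega>" "bounded \<Omega>" "smooth \<psi>" shows "rotated_gradient \<psi> \<in> L2 \<Omega>"
proof (rule L2_vec_lambda)
  fix i :: 2
  have "(\<lambda>x. -1 * pderivative 1 \<psi> x) \<in> L2 \<Omega>"
    by (intro smooth_in_L2 smooth_mult smooth_const smooth_pderivative assms)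
  moreover have "pderivative 2 \<psi> \<in> L2 \<Omega>" by (intro smooth_in_L2 smooth_pderivative assms)
  ultimately show "(\<lambda>x. rotated_gradient \<psi> x $ i) \<in> L2 \<Omega>"
    using exhaust_2[of i] by (auto simp: rotated_gradient_component)
qed

text \<open>Gradients are weakly curl-free, since the mixed second derivatives of a test function agree.\<close>

lemma G_orthogonal_rotated_gradient:
  assumes \<Omega>: "open \<Omega>" "bounded \<Omega>" and w: "w \<in> G \<Omega>" and \<psi>: "\<psi> \<in> test_functions \<Omega>"
  shows "L2_inner \<Omega> w (rotated_gradient \<psi>) = 0"
proof -
  have wL: "w \<in> L2 \<Omega>" using w by (simp add: G_def)
  have s: "smooth \<psi>" using \<psi> by (rule test_functions_smooth)
  obtain \<phi> where "has_weak_gradient \<Omega> \<phi> w" using w by (auto simp: G_def)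
  then have 1: "(\<integral>x. \<phi> x * mixed_pderivative 1 0 \<theta> x \<partial>lebesgue_on \<Omega>) = - (\<integral>x. w x $ 1 * \<theta> x \<partial>lebesgue_on \<Omega>)"
    and 2: "(\<integral>x. \<phi> x * mixed_pderivative 0 1 \<theta> x \<partial>lebesgue_on \<Omega>) = - (\<integral>x. w x $ 2 * \<theta> x \<partial>lebesgue_on \<Omega>)"
    if "\<theta> \<in> test_functions \<Omega>" for \<theta>
    using that by (auto simp: has_weak_gradient_def has_weak_derivative_def dest!: bspec)
  have "(\<integral>x. w x $ 1 * pderivative 2 \<psi> x \<partial>lebesgue_on \<Omega>) = - (\<integral>x. \<phi> x * pderivative 1 (pderivative 2 \<psi>) x \<partial>lebesgue_on \<Omega>)"
    using 1[OF test_functions_pderivative[OF \<psi>, of 2]] unfolding mixed_pderivative_1_0 by simp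
  moreover have "(\<integral>x. w x $ 2 * pderivative 1 \<psi> x \<partial>lebesgue_on \<Omega>) = - (\<integral>x. \<phi> x * pderivative 2 (pderivative 1 \<psi>) x \<partial>lebesgue_on \<Omega>)"
    using 2[OF test_functions_pderivative[OF \<psi>, of 1]] unfolding mixed_pderivative_0_1 by simp
  ultimately show ?thesis
    by (simp add: L2_inner_components[OF wL rotated_gradient_in_L2[OF \<Omega> s]] rotated_gradient_component
        pderivative_smooth_commute[OF s, of 1 2])
qed

text \<open>Only two properties of the subspace matter: its elements are gradients, which makes the
  projection curl-free, and it contains the gradients of the test functions, which makes the residual
  divergence-free.\<close>

lemma orth_proj_class_H:
  assumes \<Omega>: "open \<Omega>" "bounded \<Omega>" and U: "open U" "U \<subseteq> \<Omega>"
    and S: "S \<subseteq> G \<Omega>" "\<And>\<psi>. \<psi> \<in> test_functions \<Omega> \<Longrightarrow> gradient \<psi> \<in> S"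
    and S_add: "\<And>v w. v \<in> S \<Longrightarrow> w \<in> S \<Longrightarrow> (\<lambda>x. v x + w x) \<in> S"
    and S_scaleR: "\<And>c v. v \<in> S \<Longrightarrow> (\<lambda>x. c *\<^sub>R v x) \<in> S"
    and v: "v \<in> L2 \<Omega>" "v \<in> class_H m U"
  shows "orth_proj \<Omega> S v \<in> class_H m U"
proof -
  define p where "p = orth_proj \<Omega> S v"
  have SL: "S \<subseteq> L2 \<Omega>" using S(1) by (auto simp: G_def)
  have "(\<lambda>_. 0) \<in> test_functions \<Omega>" by (rule test_functionsI[of _ "{}"]) (auto simp: smooth_const)
  then have "S \<noteq> {}" using S(2) by blast
  have lm: "\<Omega> \<in> lmeasurable" using \<Omega> by (simp add: lmeasurable_open)
  have op: "p \<in> L2_closure \<Omega> S \<and> (\<forall>w\<in>S. L2_inner \<Omega> (\<lambda>x. v x - p x) w = 0)"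
    unfolding p_def by (rule orth_proj_characterization[OF lm SL \<open>S \<noteq> {}\<close> S_add S_scaleR v(1)])
  note p = conjunct1[OF op] and orth = bspec[OF conjunct2[OF op]]
  have pL: "p \<in> L2 \<Omega>" using p by (simp add: L2_closure_def)
  have "\<forall>i. \<exists>f'. borel_representative \<Omega> (\<lambda>x. p x $ i) f'"
    by (intro allI borel_representative_exists[OF \<Omega> L2_component[OF pL]])
  then obtain p' where p': "\<And>i. borel_representative \<Omega> (\<lambda>x. p x $ i) (p' i)" by metis
  have "\<forall>i. \<exists>f'. borel_representative \<Omega> (\<lambda>x. v x $ i) f'"
    by (intro allI borel_representative_exists[OF \<Omega> L2_component[OF v(1)]])
  then obtain v' where v': "\<And>i. borel_representative \<Omega> (\<lambda>x. v x $ i) (v' i)" by metis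
  have rep: "(\<integral>x. f x * \<psi> x \<partial>lebesgue_on \<Omega>) = (\<integral>x. f' x * \<psi> x \<partial>lborel)"
    if "borel_representative \<Omega> f f'" "smooth \<psi>" for f f' \<psi>
    using that smooth_measurable by (auto simp: borel_representative_def)
  have wdc: "weakly_div_curl \<Omega> p' v'"
    unfolding weakly_div_curl_def
  proof (intro ballI conjI)
    fix \<psi> assume \<psi>: "\<psi> \<in> test_functions \<Omega>"
    have s: "smooth (pderivative i \<psi>)" for i using \<psi> by (intro smooth_pderivative test_functions_smooth)
    have g: "gradient \<psi> \<in> L2 \<Omega>" "rotated_gradient \<psi> \<in> L2 \<Omega>"
      using \<psi> by (auto intro!: gradient_in_L2 rotated_gradient_in_L2 \<Omega> test_functions_smooth)
    have "L2_inner \<Omega> p (gradient \<psi>) = L2_inner \<Omega> v (gradient \<psi>)"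
      using orth[OF S(2)[OF \<psi>]] by (simp add: L2_inner_diff_left[OF v(1) pL g(1)])
    then show "(\<integral>x. p' 1 x * pderivative 1 \<psi> x \<partial>lborel) + (\<integral>x. p' 2 x * pderivative 2 \<psi> x \<partial>lborel)
       = (\<integral>x. v' 1 x * pderivative 1 \<psi> x \<partial>lborel) + (\<integral>x. v' 2 x * pderivative 2 \<psi> x \<partial>lborel)"
      unfolding L2_inner_components[OF pL g(1)] L2_inner_components[OF v(1) g(1)] gradient_component
      using rep[OF p' s] rep[OF v' s] by simp
    have "L2_inner \<Omega> p (rotated_gradient \<psi>) = 0"
      by (rule L2_inner_closure_zero[OF p SL g(2)])
         (use S(1) G_orthogonal_rotated_gradient[OF \<Omega> _ \<psi>] in blast)
    then show "(\<integral>x. p' 1 x * pderivative 2 \<psi> x \<partial>lborel) = (\<integral>x. p' 2 x * pderivative 1 \<psi> x \<partial>lborel)"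
      unfolding L2_inner_components[OF pL g(2)] rotated_gradient_component
      using rep[OF p' s] by simp
  qed
  have i: "integrable lborel (p' i)" "integrable lborel (\<lambda>x. (p' i x)\<^sup>2)" "integrable lborel (v' i)" for i
    using p' v' by (auto simp: borel_representative_def)
  have bv: "mollified_derivative_bounded U a b (v' i)" if ab: "a + b \<le> m" for i a b
  proof (rule mollified_derivative_bounded_of_weak_derivative[OF U(1) i(3)])
    fix V assume V: "open V" "compact (closure V)" "closure V \<subseteq> U"
    have bV: "bounded V" using V(2) by (meson bounded_subset closure_subset compact_imp_bounded)
    have V\<Omega>: "V \<subseteq> \<Omega>" using V(3) U(2) closure_subset by blast
    have "(\<lambda>x. v x $ i) \<in> Sobolev m V" using v(2) V by (simp add: class_H_def)
    then obtain g where g: "g \<in> L2 V" "has_weak_derivative V a b (\<lambda>x. v x $ i) g"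
      using ab unfolding Sobolev_def by blast
    obtain g' where g': "borel_representative V g g'"
      using borel_representative_exists[OF V(1) bV g(1)] by (elim exE) (rule that)
    show "\<exists>g. integrable lborel g \<and> integrable lborel (\<lambda>x. (g x)\<^sup>2) \<and> (\<forall>\<psi>\<in>test_functions V.
         (\<integral>x. v' i x * mixed_pderivative a b \<psi> x \<partial>lborel) = (-1) ^ (a + b) * (\<integral>x. g x * \<psi> x \<partial>lborel))"
    proof (rule exI[of _ g'], intro conjI ballI)
      show "integrable lborel g'" "integrable lborel (\<lambda>x. (g' x)\<^sup>2)"
        using g' by (auto simp: borel_representative_def)
      fix \<psi> assume \<psi>: "\<psi> \<in> test_functions V"
      note D = test_functions_mixed_pderivative[OF \<psi>, of a b]
      have "(\<integral>x. v' i x * mixed_pderivative a b \<psi> x \<partial>lborel) = (\<integral>x. v x $ i * mixed_pderivative a b \<psi> x \<partial>lebesgue_on V)"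
        by (rule borel_representative_subset[OF v' \<Omega>(1) V(1) V\<Omega> test_functions_measurable[OF D] test_functions_outside[OF D], symmetric])
      also have "\<dots> = (-1) ^ (a + b) * (\<integral>x. g x * \<psi> x \<partial>lebesgue_on V)"
        using g(2) \<psi> by (simp add: has_weak_derivative_def)
      also have "(\<integral>x. g x * \<psi> x \<partial>lebesgue_on V) = (\<integral>x. g' x * \<psi> x \<partial>lborel)"
        using g' test_functions_measurable[OF \<psi>] by (simp add: borel_representative_def)
      finally show "(\<integral>x. v' i x * mixed_pderivative a b \<psi> x \<partial>lborel) = (-1) ^ (a + b) * (\<integral>x. g' x * \<psi> x \<partial>lborel)" .
    qed
  qed
  have bp: "mollified_derivative_bounded U a b (p' i)" if "a + b \<le> m" for i a b
    by (rule mollified_derivative_bounded_regularity[OF U wdc i(1,2,3) bv that])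
  show ?thesis
    unfolding p_def[symmetric] class_H_def
  proof (intro CollectI allI impI)
    fix V i assume "open V \<and> compact (closure V) \<and> closure V \<subseteq> U"
    then have V: "open V" "compact (closure V)" "closure V \<subseteq> U" by auto
    have V\<Omega>: "V \<subseteq> \<Omega>" using V(3) U(2) closure_subset by blast
    have "(\<lambda>x. p x $ i) \<in> L2 V"
      by (rule L2_subset[OF L2_component[OF pL] V(1) \<Omega>(1) V\<Omega>])
    then show "(\<lambda>x. p x $ i) \<in> Sobolev m V"
      unfolding Sobolev_def
      using weak_derivative_of_mollified_bound[OF \<Omega>(1) p' bp V V\<Omega>] by blast
  qed
qed

lemma class_H_diff:
  assumes "v \<in> class_H m U" "w \<in> class_H m U"
  shows "(\<lambda>x. v x - w x) \<in> class_H m U"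
  unfolding class_H_def
proof (intro CollectI allI impI)
  fix V i assume V: "open V \<and> compact (closure V) \<and> closure V \<subseteq> U"
  then have bV: "open V" "bounded V" by (meson bounded_subset closure_subset compact_imp_bounded)+
  have "(\<lambda>x. v x $ i) \<in> Sobolev m V" "(\<lambda>x. w x $ i) \<in> Sobolev m V"
    using assms V by (auto simp: class_H_def)
  then have "(\<lambda>x. v x $ i + (-1) *\<^sub>R w x $ i) \<in> Sobolev m V"
    by (intro Sobolev_add bV Sobolev_scaleR)
  then show "(\<lambda>x. (v x - w x) $ i) \<in> Sobolev m V" by simp
qed

theorem theorem3p3:
  fixes \<Omega> U :: "(real ^ 2) set" and v :: "real ^ 2 \<Rightarrow> real ^ 2" and m :: nat
  assumes "region \<Omega>" and "bounded \<Omega>" and "Lipschitz_loop_boundary \<Omega>"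
    and "open U" and "closure U \<subseteq> \<Omega>"
    and "v \<in> L2 \<Omega>"
    and "m \<ge> 1" and "v \<in> class_H m U"
  shows "P_G \<Omega> v \<in> class_H m U \<and> P_G0 \<Omega> v \<in> class_H m U \<and>
         Q_G \<Omega> v \<in> class_H m U \<and> Q_G0 \<Omega> v \<in> class_H m U"
proof -
  have \<Omega>: "open \<Omega>" "bounded \<Omega>" using assms by (auto simp: region_def)
  have U: "open U" "U \<subseteq> \<Omega>" using assms(4,5) closure_subset[of U] by auto
  have "P_G \<Omega> v \<in> class_H m U"
    unfolding P_G_def
    by (rule orth_proj_class_H[OF \<Omega> U order_refl _ G_add[OF \<Omega>] G_scaleR assms(6,8)])
       (use gradient_test_function_in_G0[OF \<Omega>] G0_subset_G in blast)
  moreover have "P_G0 \<Omega> v \<in> class_H m U"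
    unfolding P_G0_def
    by (rule orth_proj_class_H[OF \<Omega> U G0_subset_G gradient_test_function_in_G0[OF \<Omega>] G0_add[OF \<Omega>] G0_scaleR assms(6,8)])
  ultimately show ?thesis
    using class_H_diff[OF assms(8)] by (simp add: Q_G_def Q_G0_def)
qed

end
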